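(* Let $u$ be a non-negative solution of the minimal surface equation in a bounded domain $\Omega\subset\mathbb{H}^2$. Then at each point $p\in\Omega$ we have $$W(p)\leq C,$$ where $C$ is a positive constant which depends only on $u(p)$, on the distance of $p$ to $\partial\Omega$, and on bounds of $\lambda$ and its derivatives on $\Omega$.
   Context: Let $\mathbb{H}^2$ be the hyperbolic plane (curvature $-1$) with global conformal coordinates $(x,y)$ in which its metric is $\lambda^2(dx^2+dy^2)$ (for instance $\lambda=1/y$ on the half-plane $y>0$, or $\lambda=\frac{1}{1-(x^2+y^2)/4}$ on the disc $x^2+y^2<4$). For a function $u$ on a domain $\Omega\subset\mathbb{H}^2$ set $$\alpha=\frac{\lambda_y}{\lambda^2}-\frac{u_x}{\lambda},\quad \beta=-\frac{\lambda_x}{\lambda^2}-\frac{u_y}{\lambda},\quad W=\sqrt{1+\alpha^2+\beta^2}.$$ The minimal surface equation is $$\mathrm{div}_{\mathbb{R}^2}\Big(\frac{\lambda\alpha}{W}\partial_x+\frac{\lambda\beta}{W}\partial_y\Big)=0;$$ it expresses that the graph $\{(x,y,u(x,y))\}$ is minimal in $\widetilde{PSL_2(\mathbb{R})}=\mathbb{H}^2\times\mathbb{R}$ with metric $\lambda^2(dx^2+dy^2)+(-\frac{\lambda_y}{\lambda}dx+\frac{\lambda_x}{\lambda}dy+dz)^2$. *)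

theory Defs
  imports "HOL-Analysis.Analysis"
begin

definition pdx :: "(real \<times> real \<Rightarrow> real) \<Rightarrow> real \<times> real \<Rightarrow> real"
  where "pdx f p = frechet_derivative f (at p) (1, 0)"

definition pdy :: "(real \<times> real \<Rightarrow> real) \<Rightarrow> real \<times> real \<Rightarrow> real"
  where "pdy f p = frechet_derivative f (at p) (0, 1)"

text \<open>Meant for open \<open>S\<close>: only then does differentiability within \<open>S\<close> agree with the
  two-sided derivatives in \<open>pdx\<close> and \<open>pdy\<close>.\<close>

primrec Ck_on :: "nat \<Rightarrow> (real \<times> real \<Rightarrow> real) \<Rightarrow> (real \<times> real) set \<Rightarrow> bool"
  where
    "Ck_on 0 f S \<longleftrightarrow> continuous_on S f"
  | "Ck_on (Suc k) f S \<longleftrightarrow> f differentiable_on S \<and> Ck_on k (pdx f) S \<and> Ck_on k (pdy f) S"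

definition smooth_fun_on :: "(real \<times> real \<Rightarrow> real) \<Rightarrow> (real \<times> real) set \<Rightarrow> bool"
  where "smooth_fun_on f S \<longleftrightarrow> (\<forall>k. Ck_on k f S)"

definition half_plane :: "(real \<times> real) set"
  where "half_plane = {p. snd p > 0}"

text \<open>The open set \<open>D\<close> with the conformal metric \<open>lam\<^sup>2 (dx\<^sup>2 + dy\<^sup>2)\<close> is the hyperbolic plane of
  curvature -1 written in a global conformal chart: some smooth bijection \<open>\<phi>\<close> of \<open>D\<close> onto the
  half-plane pulls the metric \<open>(dx\<^sup>2 + dy\<^sup>2) / y\<^sup>2\<close> back to it. The inverse of \<open>\<phi>\<close> is
  smooth as well, because \<open>lam > 0\<close> makes the differential of \<open>\<phi>\<close> invertible.\<close>

definition hyperbolic_coordinates :: "(real \<times> real) set \<Rightarrow> (real \<times> real \<Rightarrow> real) \<Rightarrow> bool"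
  where "hyperbolic_coordinates D lam \<longleftrightarrow>
    open D \<and> smooth_fun_on lam D \<and> (\<forall>p\<in>D. lam p > 0) \<and>
    (\<exists>\<phi>. bij_betw \<phi> D half_plane \<and>
         smooth_fun_on (\<lambda>p. fst (\<phi> p)) D \<and> smooth_fun_on (\<lambda>p. snd (\<phi> p)) D \<and>
         (\<forall>p\<in>D. \<forall>v. norm (frechet_derivative \<phi> (at p) v) / snd (\<phi> p) = lam p * norm v))"

text \<open>Only curves that are \<open>C\<^sup>1\<close> up to the endpoints are admitted. Library
  piecewise \<open>C\<^sup>1\<close> curves may have unbounded speed near a break point; their speed may then fail
  to be integrable, and \<open>integral\<close> would give them length 0.\<close>

definition metric_length :: "(real \<times> real \<Rightarrow> real) \<Rightarrow> (real \<Rightarrow> real \<times> real) \<Rightarrow> real"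
  where "metric_length lam \<gamma> =
    integral {0..1} (\<lambda>t. lam (\<gamma> t) * norm (vector_derivative \<gamma> (at t)))"

definition metric_dist ::
    "(real \<times> real) set \<Rightarrow> (real \<times> real \<Rightarrow> real) \<Rightarrow> real \<times> real \<Rightarrow> real \<times> real \<Rightarrow> real"
  where "metric_dist D lam p q =
    Inf {metric_length lam \<gamma> | \<gamma>. \<gamma> C1_differentiable_on {0..1} \<and> path_image \<gamma> \<subseteq> D \<and>
                                  pathstart \<gamma> = p \<and> pathfinish \<gamma> = q}"

definition metric_bounded ::
    "(real \<times> real) set \<Rightarrow> (real \<times> real \<Rightarrow> real) \<Rightarrow> (real \<times> real) set \<Rightarrow> bool"
  where "metric_bounded D lam \<Omega> \<longleftrightarrow> (\<exists>R. \<forall>p\<in>\<Omega>. \<forall>q\<in>\<Omega>. metric_dist D lam p q \<le> R)"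

text \<open>The boundary is taken in the hyperbolic plane, that is, relative to \<open>D\<close>.\<close>

definition dist_to_boundary ::
    "(real \<times> real) set \<Rightarrow> (real \<times> real \<Rightarrow> real) \<Rightarrow> (real \<times> real) set \<Rightarrow> real \<times> real \<Rightarrow> real"
  where "dist_to_boundary D lam \<Omega> p = (INF q\<in>D \<inter> frontier \<Omega>. metric_dist D lam p q)"

definition gr_alpha ::
    "(real \<times> real \<Rightarrow> real) \<Rightarrow> (real \<times> real \<Rightarrow> real) \<Rightarrow> real \<times> real \<Rightarrow> real"
  where "gr_alpha lam u p = pdy lam p / (lam p)\<^sup>2 - pdx u p / lam p"

definition gr_beta ::
    "(real \<times> real \<Rightarrow> real) \<Rightarrow> (real \<times> real \<Rightarrow> real) \<Rightarrow> real \<times> real \<Rightarrow> real"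
  where "gr_beta lam u p = - pdx lam p / (lam p)\<^sup>2 - pdy u p / lam p"

definition gr_W ::
    "(real \<times> real \<Rightarrow> real) \<Rightarrow> (real \<times> real \<Rightarrow> real) \<Rightarrow> real \<times> real \<Rightarrow> real"
  where "gr_W lam u p = sqrt (1 + (gr_alpha lam u p)\<^sup>2 + (gr_beta lam u p)\<^sup>2)"

definition minimal_surface_solution ::
    "(real \<times> real \<Rightarrow> real) \<Rightarrow> (real \<times> real) set \<Rightarrow> (real \<times> real \<Rightarrow> real) \<Rightarrow> bool"
  where "minimal_surface_solution lam \<Omega> u \<longleftrightarrow>
    Ck_on 2 u \<Omega> \<and>
    (\<forall>p\<in>\<Omega>. pdx (\<lambda>q. lam q * gr_alpha lam u q / gr_W lam u q) p +
            pdy (\<lambda>q. lam q * gr_beta lam u q / gr_W lam u q) p = 0)"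

text \<open>Two-sided bounds: \<open>m\<close> is a positive lower bound of \<open>lam\<close>, and \<open>M k\<close> bounds
  all partial derivatives of \<open>lam\<close> of order \<open>k\<close>, so \<open>M 0\<close> is an upper bound of \<open>lam\<close>.\<close>

definition bounds_on ::
    "(real \<times> real \<Rightarrow> real) \<Rightarrow> (real \<times> real) set \<Rightarrow> real \<Rightarrow> (nat \<Rightarrow> real) \<Rightarrow> bool"
  where "bounds_on lam \<Omega> m M \<longleftrightarrow>
    m > 0 \<and> (\<forall>p\<in>\<Omega>. m \<le> lam p) \<and>
    (\<forall>i j. \<forall>p\<in>\<Omega>. \<bar>(pdx ^^ i) ((pdy ^^ j) lam) p\<bar> \<le> M (i + j))"

end

theory Submission
  imports Defs
begin

text \<open>
  With \<open>L = ln \<lambda>\<close> and \<open>q = (u\<^sub>x - L\<^sub>y, u\<^sub>y + L\<^sub>x)\<close> one has \<open>(\<alpha>, \<beta>) = - q / \<lambda>\<close>, and the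
  equation reads \<open>div (q / W) = 0\<close>, that is, \<open>A\<^sub>i\<^sub>j u\<^sub>i\<^sub>j + B = 0\<close> with
  \<open>A = (\<lambda>\<^sup>2 + |q|\<^sup>2) I - q q\<^sup>T\<close>. As in Korevaar's proof of the interior gradient bound for minimal
  graphs, take a ball of radius \<open>r\<close> about \<open>p\<close> inside \<open>\<Omega>\<close>, put
  \<open>\<phi> = 1 - |x - p|\<^sup>2 / r\<^sup>2 - u / (2 (u(p) + 1))\<close> and maximise \<open>|q| (exp (K \<phi>) - 1)\<close> over it.
  Non-negativity of \<open>u\<close> keeps the maximum inside, and there the equation differentiated in the
  direction of \<open>q\<close> is violated once \<open>K\<close> and \<open>|q|\<close> are large, because \<open>\<phi>\<close> has slope
  comparable to \<open>|q|\<close> in that direction. As \<open>u\<close> is only twice differentiable, the differentiated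
  equation is replaced by a statement on difference quotients at nearby maxima. Curvature plays no
  role in the estimate; the hyperbolic chart is only needed to find the ball, by completeness.
\<close>

section \<open>Smooth functions of two variables and their directional derivatives\<close>

text \<open>Why the exponential works: at the maximum, the component of q along its direction there
  is touched from above by a multiple of 1 / (exp (K \<phi>) - 1). The two first-order conditions
  and the equation determine all three second derivatives of u at that point, so the second-order
  condition becomes one inequality between real numbers. In it the terms quadratic in the
  logarithmic slope of the barrier carry a factor lam^2 + |q|^2. Everything but lam^2 cancels
  against the derivatives of the coefficients A, so these terms are of lower order in |q|. On the
  good side a term remains with at least one more factor K than the errors, multiplied by the
  squared slope of \<phi>. The -1 makes the maximised function nonpositive where \<phi> <= 0. The
  factor 1 / (2 (u(p) + 1)) gives \<phi>(p) >= 1/2, hence a lower bound of the weight at p, and it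
  fixes the size of the slope of \<phi> along q. K and the threshold for |q| are chosen before lam,
  u and the domain, because the constant must be uniform in them.\<close>

definition dd :: "real \<times> real \<Rightarrow> (real \<times> real \<Rightarrow> real) \<Rightarrow> real \<times> real \<Rightarrow> real"
  where "dd e f p = frechet_derivative f (at p) e"

lemma pdx_eq_dd: "pdx f = dd (1, 0) f"
  by (rule ext) (simp only: pdx_def dd_def)

lemma pdy_eq_dd: "pdy f = dd (0, 1) f"
  by (rule ext) (simp only: pdy_def dd_def)

lemma dd_eqI: "(f has_derivative f') (at p) \<Longrightarrow> dd e f p = f' e"
  unfolding dd_def by (metis frechet_derivative_at)

lemma has_derivative_dd:
  "f differentiable at p \<Longrightarrow> (f has_derivative (\<lambda>h. dd h f p)) (at p)"
  unfolding dd_def frechet_derivative_works .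

lemma dd_linear:
  assumes "f differentiable at p"
  shows "linear (\<lambda>h. dd h f p)"
  by (rule has_derivative_linear[OF has_derivative_dd[OF assms]])

lemma dd_combination:
  assumes "f differentiable at p"
  shows "dd (a *\<^sub>R e1 + b *\<^sub>R e2) f p = a * dd e1 f p + b * dd e2 f p"
  using linear_add[OF dd_linear[OF assms], of "a *\<^sub>R e1" "b *\<^sub>R e2"]
    linear_scale[OF dd_linear[OF assms], of a e1] linear_scale[OF dd_linear[OF assms], of b e2] by simp

lemma dd_pd:
  assumes "f differentiable at p"
  shows "dd e f p = fst e * pdx f p + snd e * pdy f p"
proof -
  have "dd (fst e *\<^sub>R (1, 0) + snd e *\<^sub>R (0, 1)) f p = fst e * pdx f p + snd e * pdy f p"
    unfolding dd_combination[OF assms] by (simp add: pdx_eq_dd pdy_eq_dd)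
  then show ?thesis by simp
qed

lemma has_derivative_pd:
  assumes "f differentiable at p"
  shows "(f has_derivative (\<lambda>h. fst h * pdx f p + snd h * pdy f p)) (at p)"
  using has_derivative_dd[OF assms] dd_pd[OF assms] by simp

text \<open>No differentiability is assumed: \<open>frechet_derivative\<close> is chosen among the
  derivatives at the point, and both functions have the same ones.\<close>

lemma dd_cong:
  assumes "open S" "p \<in> S" "\<And>x. x \<in> S \<Longrightarrow> f x = g x"
  shows "dd e f p = dd e g p"
proof -
  have "(f has_derivative f') (at p) \<longleftrightarrow> (g has_derivative f') (at p)" for f'
    using has_derivative_transform_within_open[of f f' p UNIV S g]
      has_derivative_transform_within_open[of g f' p UNIV S f] assms by auto
  then show ?thesis unfolding dd_def frechet_derivative_def by simp
qed

section \<open>Closure properties of the classes \<open>Ck_on\<close>\<close>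

lemma Ck_on_Suc_iff:
  assumes "open S"
  shows "Ck_on (Suc k) f S \<longleftrightarrow>
    (\<forall>p\<in>S. f differentiable at p) \<and> Ck_on k (pdx f) S \<and> Ck_on k (pdy f) S"
  using assms by (simp add: differentiable_on_def at_within_open_NO_MATCH)

lemma Ck_on_differentiable:
  assumes "Ck_on (Suc k) f S" "open S" "p \<in> S"
  shows "f differentiable at p"
  using assms(1,3) unfolding Ck_on_Suc_iff[OF assms(2)] by simp

lemma Ck_on_cong:
  assumes "open S" "\<And>x. x \<in> S \<Longrightarrow> f x = g x" "Ck_on k f S"
  shows "Ck_on k g S"
  using assms(2,3)
proof (induction k arbitrary: f g)
  case 0
  then show ?case by (simp cong: continuous_on_cong)
next
  case (Suc k)
  have d: "g differentiable at p" if "p \<in> S" for p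
    using has_derivative_transform_within_open[of f _ p UNIV S g] Suc.prems(1) assms(1) that
      has_derivative_dd[OF Ck_on_differentiable[OF Suc.prems(2) assms(1) that]]
    by (intro differentiableI) simp
  have "Ck_on k (pdx g) S"
    by (rule Suc.IH[of "pdx f"]) (use Suc.prems dd_cong[OF assms(1), of _ f g] in \<open>simp_all add: pdx_eq_dd\<close>)
  moreover have "Ck_on k (pdy g) S"
    by (rule Suc.IH[of "pdy f"]) (use Suc.prems dd_cong[OF assms(1), of _ f g] in \<open>simp_all add: pdy_eq_dd\<close>)
  ultimately show ?case using d unfolding Ck_on_Suc_iff[OF assms(1)] by simp
qed

text \<open>The formulas \<open>fx\<close> and \<open>fy\<close> have to be the partials on
  \<open>S\<close> only, so each calculus rule below can supply closed expressions in place of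
  \<open>pdx f\<close> and \<open>pdy f\<close>.\<close>

lemma Ck_on_SucI:
  assumes "open S"
    and "\<And>p. p \<in> S \<Longrightarrow> (f has_derivative (\<lambda>h. fst h * fx p + snd h * fy p)) (at p)"
    and "Ck_on k fx S" "Ck_on k fy S"
  shows "Ck_on (Suc k) f S"
proof -
  have "pdx f p = fx p" "pdy f p = fy p" if "p \<in> S" for p
    using dd_eqI[OF assms(2)[OF that]] by (simp_all add: pdx_eq_dd pdy_eq_dd)
  then have "Ck_on k (pdx f) S" "Ck_on k (pdy f) S"
    using Ck_on_cong[OF assms(1) _ assms(3), of "pdx f"]
      Ck_on_cong[OF assms(1) _ assms(4), of "pdy f"] by simp_all
  then show ?thesis
    unfolding Ck_on_Suc_iff[OF assms(1)] using differentiableI[OF assms(2)] by simp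
qed

lemma Ck_on_SucD: "Ck_on (Suc k) f S \<Longrightarrow> Ck_on k f S"
proof (induction k arbitrary: f)
  case 0
  then show ?case by (simp add: differentiable_imp_continuous_on)
next
  case (Suc k)
  then show ?case using Ck_on.simps(2) by metis
qed

lemma Ck_on_le: "Ck_on k f S \<Longrightarrow> j \<le> k \<Longrightarrow> Ck_on j f S"
  by (induction k) (auto simp: le_Suc_eq dest: Ck_on_SucD simp del: Ck_on.simps)

lemma Ck_on_continuous_on: "Ck_on k f S \<Longrightarrow> continuous_on S f"
  using Ck_on_le[of k f S 0] by simp

lemma Ck_on_subset: "Ck_on k f S \<Longrightarrow> T \<subseteq> S \<Longrightarrow> Ck_on k f T"
  by (induction k arbitrary: f) (auto intro: continuous_on_subset differentiable_on_subset)

lemma Ck_on_const: "open S \<Longrightarrow> Ck_on k (\<lambda>_. c) S"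
proof (induction k arbitrary: c)
  case (Suc k)
  show ?case
    by (rule Ck_on_SucI[OF Suc.prems _ Suc.IH Suc.IH, of _ 0 0]) (simp_all add: Suc.prems)
qed simp

lemma Ck_on_fst:
  assumes "open S"
  shows "Ck_on k fst S"
proof (cases k)
  case (Suc j)
  show ?thesis
    unfolding Suc using has_derivative_fst[OF has_derivative_ident]
    by (intro Ck_on_SucI[OF assms _ Ck_on_const Ck_on_const, of _ 1 0]) (simp_all add: assms)
qed (simp add: continuous_on_fst)

lemma Ck_on_snd:
  assumes "open S"
  shows "Ck_on k snd S"
proof (cases k)
  case (Suc j)
  show ?thesis
    unfolding Suc using has_derivative_snd[OF has_derivative_ident]
    by (intro Ck_on_SucI[OF assms _ Ck_on_const Ck_on_const, of _ 0 1]) (simp_all add: assms)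
qed (simp add: continuous_on_snd)

lemma Ck_on_add:
  assumes "open S"
  shows "Ck_on k f S \<Longrightarrow> Ck_on k g S \<Longrightarrow> Ck_on k (\<lambda>x. f x + g x) S"
proof (induction k arbitrary: f g)
  case (Suc k)
  note D = Suc.prems[unfolded Ck_on_Suc_iff[OF assms]]
  show ?case
  proof (rule Ck_on_SucI[OF assms, where fx = "\<lambda>p. pdx f p + pdx g p" and fy = "\<lambda>p. pdy f p + pdy g p"])
    show "((\<lambda>x. f x + g x) has_derivative
        (\<lambda>h. fst h * (pdx f p + pdx g p) + snd h * (pdy f p + pdy g p))) (at p)" if "p \<in> S" for p
      using has_derivative_add[OF has_derivative_pd has_derivative_pd, of f p g] D that
      by (simp add: algebra_simps)
    show "Ck_on k (\<lambda>p. pdx f p + pdx g p) S" "Ck_on k (\<lambda>p. pdy f p + pdy g p) S"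
      by (rule Suc.IH; insert D, simp)+
  qed
qed (simp add: continuous_on_add)

lemma Ck_on_mult:
  assumes "open S"
  shows "Ck_on k f S \<Longrightarrow> Ck_on k g S \<Longrightarrow> Ck_on k (\<lambda>x. f x * g x) S"
proof (induction k arbitrary: f g)
  case (Suc k)
  note D = Suc.prems[unfolded Ck_on_Suc_iff[OF assms]]
  note C = Suc.prems[THEN Ck_on_SucD]
  show ?case
  proof (rule Ck_on_SucI[OF assms, where fx = "\<lambda>p. f p * pdx g p + pdx f p * g p"
        and fy = "\<lambda>p. f p * pdy g p + pdy f p * g p"])
    show "((\<lambda>x. f x * g x) has_derivative (\<lambda>h. fst h * (f p * pdx g p + pdx f p * g p)
        + snd h * (f p * pdy g p + pdy f p * g p))) (at p)" if "p \<in> S" for p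
      using has_derivative_mult[OF has_derivative_pd has_derivative_pd, of f p g] D that
      by (simp add: algebra_simps)
    show "Ck_on k (\<lambda>p. f p * pdx g p + pdx f p * g p) S"
      "Ck_on k (\<lambda>p. f p * pdy g p + pdy f p * g p) S"
      by (rule Ck_on_add[OF assms]; rule Suc.IH; insert D C, simp)+
  qed
qed (simp add: continuous_on_mult)

lemma Ck_on_uminus: "open S \<Longrightarrow> Ck_on k f S \<Longrightarrow> Ck_on k (\<lambda>x. - f x) S"
  using Ck_on_mult[OF _ Ck_on_const[where c = "-1"]] by simp

lemma Ck_on_diff: "open S \<Longrightarrow> Ck_on k f S \<Longrightarrow> Ck_on k g S \<Longrightarrow> Ck_on k (\<lambda>x. f x - g x) S"
  using Ck_on_add[OF _ _ Ck_on_uminus, of S k f g] by simp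

lemma Ck_on_power:
  assumes "open S" "Ck_on k f S"
  shows "Ck_on k (\<lambda>x. f x ^ n) S"
proof (induction n)
  case 0
  show ?case using Ck_on_const[OF assms(1), of k 1] by simp
next
  case (Suc n)
  show ?case using Ck_on_mult[OF assms Suc] by simp
qed

lemma Ck_on_exp:
  assumes "open S"
  shows "Ck_on k f S \<Longrightarrow> Ck_on k (\<lambda>x. exp (f x)) S"
proof (induction k arbitrary: f)
  case (Suc k)
  note D = Suc.prems[unfolded Ck_on_Suc_iff[OF assms]]
  note C = Suc.prems[THEN Ck_on_SucD]
  show ?case
  proof (rule Ck_on_SucI[OF assms, where fx = "\<lambda>p. exp (f p) * pdx f p" and fy = "\<lambda>p. exp (f p) * pdy f p"])
    show "((\<lambda>x. exp (f x)) has_derivative (\<lambda>h. fst h * (exp (f p) * pdx f p)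
        + snd h * (exp (f p) * pdy f p))) (at p)" if "p \<in> S" for p
      using has_derivative_exp[OF has_derivative_pd, of f p] D that
      by (simp add: algebra_simps)
    show "Ck_on k (\<lambda>p. exp (f p) * pdx f p) S" "Ck_on k (\<lambda>p. exp (f p) * pdy f p) S"
      by (rule Ck_on_mult[OF assms]; (rule Suc.IH)?; insert D C, simp)+
  qed
qed (simp add: continuous_on_exp)

lemma Ck_on_inverse:
  assumes "open S" "\<And>x. x \<in> S \<Longrightarrow> f x \<noteq> 0"
  shows "Ck_on k f S \<Longrightarrow> Ck_on k (\<lambda>x. inverse (f x)) S"
proof (induction k)
  case 0
  then show ?case using assms by (simp add: continuous_on_inverse)
next
  case (Suc k)
  note D = Suc.prems[unfolded Ck_on_Suc_iff[OF assms(1)]]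
  \<comment> \<open>The partials of 1/f are built from 1/f and the partials of f, so the induction
    hypothesis is needed for the same f only, one order lower.\<close>
  note I = Suc.IH[OF Suc.prems[THEN Ck_on_SucD]]
  show ?case
  proof (rule Ck_on_SucI[OF assms(1), where fx = "\<lambda>p. - (inverse (f p) * pdx f p * inverse (f p))"
        and fy = "\<lambda>p. - (inverse (f p) * pdy f p * inverse (f p))"])
    show "((\<lambda>x. inverse (f x)) has_derivative
        (\<lambda>h. fst h * (- (inverse (f p) * pdx f p * inverse (f p)))
        + snd h * (- (inverse (f p) * pdy f p * inverse (f p))))) (at p)" if "p \<in> S" for p
      using Deriv.has_derivative_inverse[OF assms(2)[OF that] has_derivative_pd[of f p]] D that
      by (simp add: algebra_simps)
    show "Ck_on k (\<lambda>p. - (inverse (f p) * pdx f p * inverse (f p))) S"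
      "Ck_on k (\<lambda>p. - (inverse (f p) * pdy f p * inverse (f p))) S"
      by (rule Ck_on_uminus[OF assms(1)]; rule Ck_on_mult[OF assms(1)];
          (rule Ck_on_mult[OF assms(1)])?; insert D I, simp)+
  qed
qed

lemma Ck_on_ln:
  assumes "open S" "\<And>x. x \<in> S \<Longrightarrow> f x > 0" "Ck_on k f S"
  shows "Ck_on k (\<lambda>x. ln (f x)) S"
proof (cases k)
  case 0
  then show ?thesis using assms(2,3) by (simp add: continuous_on_ln less_imp_neq[symmetric])
next
  case (Suc j)
  note D = assms(3)[unfolded Suc Ck_on_Suc_iff[OF assms(1)]]
  note C = assms(3)[unfolded Suc, THEN Ck_on_SucD]
  have "f x \<noteq> 0" if "x \<in> S" for x using assms(2)[OF that] by simp
  note I = Ck_on_inverse[OF assms(1) this C]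
  show ?thesis unfolding Suc
  proof (rule Ck_on_SucI[OF assms(1), where fx = "\<lambda>p. inverse (f p) * pdx f p"
        and fy = "\<lambda>p. inverse (f p) * pdy f p"])
    show "((\<lambda>x. ln (f x)) has_derivative
        (\<lambda>h. fst h * (inverse (f p) * pdx f p) + snd h * (inverse (f p) * pdy f p))) (at p)"
      if "p \<in> S" for p
      using has_derivative_ln[OF assms(2)[OF that] has_derivative_pd[of f p]] D that
      by (simp add: algebra_simps)
    show "Ck_on j (\<lambda>p. inverse (f p) * pdx f p) S" "Ck_on j (\<lambda>p. inverse (f p) * pdy f p) S"
      by (rule Ck_on_mult[OF assms(1)]; insert D I, simp)+
  qed
qed

lemma Ck_on_dd:
  assumes "open S" "Ck_on (Suc k) f S"
  shows "Ck_on k (dd e f) S"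
proof -
  have "Ck_on k (\<lambda>p. fst e * pdx f p + snd e * pdy f p) S"
    using assms(2) unfolding Ck_on_Suc_iff[OF assms(1)]
    by (intro Ck_on_add[OF assms(1)] Ck_on_mult[OF assms(1)] Ck_on_const[OF assms(1)]; blast)
  then show ?thesis
    by (rule Ck_on_cong[OF assms(1), rotated]) (simp add: dd_pd Ck_on_differentiable[OF assms(2,1)])
qed

section \<open>Restriction to lines and symmetry of second derivatives\<close>

lemma DERIV_line:
  assumes "f differentiable at (p + t *\<^sub>R e)"
  shows "((\<lambda>t. f (p + t *\<^sub>R e)) has_real_derivative dd e f (p + t *\<^sub>R e)) (at t)"
proof -
  have "((\<lambda>t. f (p + t *\<^sub>R e)) has_derivative (\<lambda>h. dd (h *\<^sub>R e) f (p + t *\<^sub>R e))) (at t)"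
    by (rule has_derivative_compose[of "\<lambda>t. p + t *\<^sub>R e" "\<lambda>h. h *\<^sub>R e" t UNIV f, OF _ has_derivative_dd[OF assms]])
      (auto intro!: derivative_eq_intros)
  moreover have "dd (h *\<^sub>R e) f (p + t *\<^sub>R e) = dd e f (p + t *\<^sub>R e) * h" for h
    using linear_scale[OF dd_linear[OF assms], of h e] by simp
  ultimately show ?thesis by (simp add: has_field_derivative_def)
qed

text \<open>Both iterated derivatives are limits of the same second difference quotient.\<close>

lemma dd_commute:
  assumes S: "open S" and p: "p \<in> S" and C: "Ck_on 2 f S"
  shows "dd a (dd b f) p = dd b (dd a f) p"
proof -
  have D1: "f differentiable at x" if "x \<in> S" for x
    using Ck_on_differentiable[of 1 f S x] C S that by (simp only: numeral_2_eq_2 One_nat_def)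
  have C1: "Ck_on (Suc 0) (dd e f) S" for e
    using Ck_on_dd[OF S, of 1 f e] C by (simp only: numeral_2_eq_2 One_nat_def)
  have D2: "dd e f differentiable at x" if "x \<in> S" for x e
    using Ck_on_differentiable[OF C1 S that] .
  have C2: "continuous_on S (dd e' (dd e f))" for e e'
    using Ck_on_dd[OF S C1] by simp
  have key: "\<bar>dd a (dd b f) p - dd b (dd a f) p\<bar> \<le> 2 * \<epsilon>" if \<epsilon>: "\<epsilon> > 0" for \<epsilon>
  proof -
    obtain \<delta>1 where \<delta>1: "\<delta>1 > 0" "\<And>x. x \<in> S \<Longrightarrow> dist x p < \<delta>1 \<Longrightarrow> dist (dd a (dd b f) x) (dd a (dd b f) p) < \<epsilon>"
      using C2[of a b] p \<epsilon> unfolding continuous_on_iff by metis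
    obtain \<delta>2 where \<delta>2: "\<delta>2 > 0" "\<And>x. x \<in> S \<Longrightarrow> dist x p < \<delta>2 \<Longrightarrow> dist (dd b (dd a f) x) (dd b (dd a f) p) < \<epsilon>"
      using C2[of b a] p \<epsilon> unfolding continuous_on_iff by metis
    obtain \<delta>3 where \<delta>3: "\<delta>3 > 0" "ball p \<delta>3 \<subseteq> S" using S p open_contains_ball by blast
    define \<delta> where "\<delta> = min \<delta>1 (min \<delta>2 \<delta>3)"
    have \<delta>: "\<delta> > 0" using \<delta>1 \<delta>2 \<delta>3 by (simp add: \<delta>_def)
    \<comment> \<open>With this denominator the parallelogram spanned by
      \<open>h *\<^sub>R a\<close> and \<open>h *\<^sub>R b\<close> stays inside the ball on which
      both iterated derivatives vary by less than \<epsilon>.\<close>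
    define h where "h = \<delta> / (2 * (norm a + norm b + 1))"
    have N: "norm a + norm b + 1 > 0" by (simp add: add_nonneg_pos)
    have h: "h > 0" using \<delta> N by (simp add: h_def)
    have near: "dist (p + s *\<^sub>R a + t *\<^sub>R b) p < \<delta>" if "0 \<le> s" "s \<le> h" "0 \<le> t" "t \<le> h" for s t
    proof -
      have "dist (p + s *\<^sub>R a + t *\<^sub>R b) p = norm (s *\<^sub>R a + t *\<^sub>R b)" by (simp add: dist_norm)
      also have "\<dots> \<le> s * norm a + t * norm b"
        using norm_triangle_ineq[of "s *\<^sub>R a" "t *\<^sub>R b"] that by simp
      also have "\<dots> \<le> h * norm a + h * norm b" using that by (intro add_mono mult_right_mono) auto
      also have "\<dots> < h * (2 * (norm a + norm b + 1))"
        using h norm_ge_zero[of a] norm_ge_zero[of b]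
        by (simp add: algebra_simps add_nonneg_pos add_strict_increasing)
      also have "\<dots> = \<delta>" using N by (simp add: h_def)
      finally show ?thesis .
    qed
    have inS: "p + s *\<^sub>R a + t *\<^sub>R b \<in> S" if "0 \<le> s" "s \<le> h" "0 \<le> t" "t \<le> h" for s t
      using near[OF that] \<delta>3 by (auto simp: \<delta>_def dist_commute)
    \<comment> \<open>Two applications of the mean value theorem: along \<open>x\<close> to the
      increment of f in direction \<open>y\<close>, then along \<open>y\<close> to
      \<open>dd x f\<close>. Membership in \<open>S\<close> is a premise because the claim is used
      with both orders of \<open>a\<close> and \<open>b\<close>.\<close>
    have diff_step: "\<exists>s t. 0 \<le> s \<and> s \<le> h \<and> 0 \<le> t \<and> t \<le> h \<and>
        f (p + h *\<^sub>R x + h *\<^sub>R y) - f (p + h *\<^sub>R x) - f (p + h *\<^sub>R y) + f p = h * h * dd y (dd x f) (p + s *\<^sub>R x + t *\<^sub>R y)"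
      if inS0: "\<And>s t. 0 \<le> s \<Longrightarrow> s \<le> h \<Longrightarrow> 0 \<le> t \<Longrightarrow> t \<le> h \<Longrightarrow> p + s *\<^sub>R x + t *\<^sub>R y \<in> S" for x y
    proof -
      define G where "G s = f ((p + h *\<^sub>R y) + s *\<^sub>R x) - f (p + s *\<^sub>R x)" for s
      have i1: "(p + h *\<^sub>R y) + s *\<^sub>R x \<in> S" if "0 \<le> s" "s \<le> h" for s
        using inS0[of s h] that h by (simp add: algebra_simps)
      have i2: "p + s *\<^sub>R x \<in> S" if "0 \<le> s" "s \<le> h" for s
        using inS0[of s 0] that h by simp
      have "\<exists>z>0. z < h \<and> G h - G 0 = (h - 0) * (dd x f ((p + h *\<^sub>R y) + z *\<^sub>R x) - dd x f (p + z *\<^sub>R x))"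
        unfolding G_def
        by (rule MVT2[OF h]) (auto intro!: derivative_intros DERIV_line D1 i1 i2)
      then obtain s where s: "0 < s" "s < h"
        and G: "G h - G 0 = h * (dd x f ((p + h *\<^sub>R y) + s *\<^sub>R x) - dd x f (p + s *\<^sub>R x))" by auto
      have "\<exists>z>0. z < h \<and> dd x f ((p + s *\<^sub>R x) + h *\<^sub>R y) - dd x f ((p + s *\<^sub>R x) + 0 *\<^sub>R y)
          = (h - 0) * dd y (dd x f) ((p + s *\<^sub>R x) + z *\<^sub>R y)"
        by (rule MVT2[OF h]) (use s in \<open>auto intro!: DERIV_line D2 inS0\<close>)
      then obtain t where t: "0 < t" "t < h"
        and "dd x f ((p + s *\<^sub>R x) + h *\<^sub>R y) - dd x f (p + s *\<^sub>R x) = h * dd y (dd x f) ((p + s *\<^sub>R x) + t *\<^sub>R y)"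
        by auto
      then have "G h - G 0 = h * h * dd y (dd x f) (p + s *\<^sub>R x + t *\<^sub>R y)"
        using G by (simp add: algebra_simps)
      moreover have "G h - G 0 = f (p + h *\<^sub>R x + h *\<^sub>R y) - f (p + h *\<^sub>R x) - f (p + h *\<^sub>R y) + f p"
        by (simp add: G_def algebra_simps)
      ultimately show ?thesis using s t by (metis less_imp_le)
    qed
    obtain s t where st: "0 \<le> s" "s \<le> h" "0 \<le> t" "t \<le> h" and e1:
      "f (p + h *\<^sub>R a + h *\<^sub>R b) - f (p + h *\<^sub>R a) - f (p + h *\<^sub>R b) + f p = h * h * dd b (dd a f) (p + s *\<^sub>R a + t *\<^sub>R b)"
      using diff_step[OF inS] by auto
    have inS': "p + s *\<^sub>R b + t *\<^sub>R a \<in> S" if "0 \<le> s" "s \<le> h" "0 \<le> t" "t \<le> h" for s t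
      using inS[OF that(3,4,1,2)] by (simp add: algebra_simps)
    obtain s' t' where st': "0 \<le> s'" "s' \<le> h" "0 \<le> t'" "t' \<le> h" and e2:
      "f (p + h *\<^sub>R b + h *\<^sub>R a) - f (p + h *\<^sub>R b) - f (p + h *\<^sub>R a) + f p = h * h * dd a (dd b f) (p + s' *\<^sub>R b + t' *\<^sub>R a)"
      using diff_step[OF inS'] by auto
    have "h * h * dd b (dd a f) (p + s *\<^sub>R a + t *\<^sub>R b) = h * h * dd a (dd b f) (p + t' *\<^sub>R a + s' *\<^sub>R b)"
      using e1 e2 by (simp add: algebra_simps)
    then have eq: "dd b (dd a f) (p + s *\<^sub>R a + t *\<^sub>R b) = dd a (dd b f) (p + t' *\<^sub>R a + s' *\<^sub>R b)"
      using h by simp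
    have "\<bar>dd b (dd a f) (p + s *\<^sub>R a + t *\<^sub>R b) - dd b (dd a f) p\<bar> < \<epsilon>"
      using \<delta>2(2)[OF inS[OF st]] near[OF st] by (auto simp: \<delta>_def dist_real_def)
    moreover have "\<bar>dd a (dd b f) (p + t' *\<^sub>R a + s' *\<^sub>R b) - dd a (dd b f) p\<bar> < \<epsilon>"
      using \<delta>1(2)[OF inS[OF st'(3,4,1,2)]] near[OF st'(3,4,1,2)] by (auto simp: \<delta>_def dist_real_def)
    ultimately show ?thesis using eq by linarith
  qed
  show ?thesis
  proof (rule ccontr)
    assume "\<not> ?thesis"
    then show False using key[of "\<bar>dd a (dd b f) p - dd b (dd a f) p\<bar> / 4"] by auto
  qed
qed

section \<open>Touching from above\<close>

lemma second_derivative_local_max: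
  fixes g g' :: "real \<Rightarrow> real"
  assumes \<delta>: "\<delta> > 0"
    and g: "\<And>t. \<bar>t\<bar> < \<delta> \<Longrightarrow> (g has_real_derivative g' t) (at t)"
    and g': "(g' has_real_derivative c) (at 0)"
    and max: "\<And>t. \<bar>t\<bar> < \<delta> \<Longrightarrow> g t \<le> g 0"
  shows "c \<le> 0"
proof (rule ccontr)
  assume "\<not> c \<le> 0"
  then obtain d where d: "d > 0" "\<And>h. h > 0 \<Longrightarrow> h < d \<Longrightarrow> g' 0 < g' (0 + h)"
    using DERIV_pos_inc_right[OF g'] by auto
  have "g' 0 = 0"
    by (rule DERIV_local_max[OF g \<delta>]) (use \<delta> max in auto)
  define t where "t = min d \<delta> / 2"
  have t: "0 < t" "t < d" "t < \<delta>" using d \<delta> by (auto simp: t_def)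
  obtain s where s: "0 < s" "s < t" "g t - g 0 = (t - 0) * g' s"
    using MVT2[OF t(1), of g g'] g t by auto
  have "g' s > 0" using d(2)[of s] s t \<open>g' 0 = 0\<close> by simp
  then have "g t > g 0" using s t by (simp add: algebra_simps zero_less_mult_iff)
  then show False using max[of t] t by simp
qed

text \<open>Completing the square: a11 times the trace equals the quadratic form at (a11, a12) plus
  (a11 a22 - a12^2) h22, and both summands are nonpositive.\<close>

lemma trace_le_0:
  fixes a11 a12 a22 h11 h12 h22 :: real
  assumes a: "a11 > 0" "a12\<^sup>2 \<le> a11 * a22"
    and h: "\<And>\<alpha> \<beta>. \<alpha>\<^sup>2 * h11 + 2 * \<alpha> * \<beta> * h12 + \<beta>\<^sup>2 * h22 \<le> 0"
  shows "a11 * h11 + 2 * a12 * h12 + a22 * h22 \<le> 0"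
proof -
  have "(a11 * a22 - a12\<^sup>2) * h22 \<le> 0"
    using h[of 0 1] a(2) by (simp add: mult_nonneg_nonpos)
  then have "a11 * (a11 * h11 + 2 * a12 * h12 + a22 * h22) \<le> 0"
    using h[of a11 a12] by (simp add: algebra_simps power2_eq_square)
  then show ?thesis using a(1) by (simp add: mult_le_0_iff)
qed

lemma dd_add_scaled:
  assumes "f differentiable at p" "g differentiable at p"
  shows "dd e (\<lambda>x. a * f x + b * g x) p = a * dd e f p + b * dd e g p"
  by (rule dd_eqI[OF has_derivative_add[OF has_derivative_mult_right has_derivative_mult_right]])
    (rule has_derivative_dd assms)+

lemma dd_dd_combination:
  assumes S: "open S" "p \<in> S" and C: "Ck_on 2 f S"
  shows "dd (a *\<^sub>R e1 + b *\<^sub>R e2) (dd (a *\<^sub>R e1 + b *\<^sub>R e2) f) p =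
    a\<^sup>2 * dd e1 (dd e1 f) p + 2 * a * b * dd e1 (dd e2 f) p + b\<^sup>2 * dd e2 (dd e2 f) p"
proof -
  have C': "Ck_on (Suc (Suc 0)) f S" using C by (simp only: numeral_2_eq_2)
  have D: "dd e f differentiable at p" for e
    by (rule Ck_on_differentiable[OF Ck_on_dd[OF S(1) C'] S])
  let ?d = "a *\<^sub>R e1 + b *\<^sub>R e2"
  have "dd ?d (dd ?d f) p = dd ?d (\<lambda>x. a * dd e1 f x + b * dd e2 f x) p"
    by (rule dd_cong[OF S]) (rule dd_combination[OF Ck_on_differentiable[OF C' S(1)]])
  also have "\<dots> = a * dd ?d (dd e1 f) p + b * dd ?d (dd e2 f) p"
    by (rule dd_add_scaled[OF D D])
  also have "\<dots> = a * (a * dd e1 (dd e1 f) p + b * dd e2 (dd e1 f) p)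
      + b * (a * dd e1 (dd e2 f) p + b * dd e2 (dd e2 f) p)"
    by (simp only: dd_combination[OF D])
  finally show ?thesis
    by (simp add: dd_commute[OF S C, of e2 e1] power2_eq_square algebra_simps)
qed

text \<open>The base point moves with n, so differentiability at p alone would not suffice. Each
  quotient is a derivative at an intermediate point, and continuity of \<open>dd e f\<close> gives
  the limit.\<close>

lemma difference_quotient_tendsto:
  assumes S: "open S" "p \<in> S" and C: "Ck_on 1 f S"
    and X: "X \<longlonglongrightarrow> p" and h: "h \<longlonglongrightarrow> 0" "\<And>n. h n > 0"
  shows "(\<lambda>n. (f (X n + h n *\<^sub>R e) - f (X n)) / h n) \<longlonglongrightarrow> dd e f p"
proof (rule LIMSEQ_I)
  fix \<epsilon> :: real assume \<epsilon>: "\<epsilon> > 0"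
  have C': "Ck_on (Suc 0) f S" using C by (simp only: One_nat_def)
  have "continuous_on S (dd e f)"
    by (rule Ck_on_continuous_on[OF Ck_on_dd[OF S(1) C']])
  then obtain \<delta>1 where \<delta>1: "\<delta>1 > 0" "\<And>x. x \<in> S \<Longrightarrow> dist x p < \<delta>1 \<Longrightarrow> dist (dd e f x) (dd e f p) < \<epsilon>"
    using S(2) \<epsilon> unfolding continuous_on_iff by metis
  obtain \<delta>2 where \<delta>2: "\<delta>2 > 0" "ball p \<delta>2 \<subseteq> S" using S open_contains_ball by metis
  define \<delta> where "\<delta> = min \<delta>1 \<delta>2"
  have \<delta>: "\<delta> > 0" using \<delta>1 \<delta>2 by (simp add: \<delta>_def)
  have "(\<lambda>n. X n + h n *\<^sub>R e) \<longlonglongrightarrow> p + 0 *\<^sub>R e"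
    by (intro tendsto_intros X h)
  then have "\<forall>\<^sub>F n in sequentially. dist (X n + h n *\<^sub>R e) p < \<delta>"
    using \<delta> by (simp add: tendsto_iff)
  moreover have "\<forall>\<^sub>F n in sequentially. dist (X n) p < \<delta>"
    using X \<delta> by (simp add: tendsto_iff)
  ultimately have "\<forall>\<^sub>F n in sequentially. norm ((f (X n + h n *\<^sub>R e) - f (X n)) / h n - dd e f p) < \<epsilon>"
  proof eventually_elim
    case (elim n)
    have seg: "X n + t *\<^sub>R e \<in> ball p \<delta>" if "0 \<le> t" "t \<le> h n" for t
    proof -
      have "(1 - t / h n) *\<^sub>R X n + (t / h n) *\<^sub>R (X n + h n *\<^sub>R e) \<in> ball p \<delta>"
        by (rule convexD_alt[OF convex_ball]) (use elim that h(2)[of n] in \<open>auto simp: dist_commute\<close>)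
      also have "(1 - t / h n) *\<^sub>R X n + (t / h n) *\<^sub>R (X n + h n *\<^sub>R e) = X n + t *\<^sub>R e"
        using h(2)[of n] by (simp add: algebra_simps)
      finally show ?thesis .
    qed
    have segS: "X n + t *\<^sub>R e \<in> S" if "0 \<le> t" "t \<le> h n" for t
      using seg[OF that] \<delta>2 by (auto simp: \<delta>_def)
    have "\<exists>z>0. z < h n \<and> f (X n + h n *\<^sub>R e) - f (X n + 0 *\<^sub>R e) = (h n - 0) * dd e f (X n + z *\<^sub>R e)"
      by (rule MVT2[OF h(2)]) (intro DERIV_line Ck_on_differentiable[OF C' S(1)] segS)
    then obtain z where z: "0 < z" "z < h n"
      and "f (X n + h n *\<^sub>R e) - f (X n + 0 *\<^sub>R e) = (h n - 0) * dd e f (X n + z *\<^sub>R e)" by auto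
    then have "(f (X n + h n *\<^sub>R e) - f (X n)) / h n = dd e f (X n + z *\<^sub>R e)"
      using h(2)[of n] by simp
    moreover have "dist (dd e f (X n + z *\<^sub>R e)) (dd e f p) < \<epsilon>"
      by (rule \<delta>1(2)) (use segS[of z] seg[of z] z in \<open>auto simp: \<delta>_def dist_commute\<close>)
    ultimately show ?case by (simp add: dist_norm)
  qed
  then show "\<exists>no. \<forall>n\<ge>no. norm ((f (X n + h n *\<^sub>R e) - f (X n)) / h n - dd e f p) < \<epsilon>"
    by (simp add: eventually_sequentially)
qed

lemma dd_shift:
  assumes "f differentiable at (p + a)"
  shows "dd e (\<lambda>x. f (x + a)) p = dd e f (p + a)" "(\<lambda>x. f (x + a)) differentiable at p"
proof -
  have "((\<lambda>x. f (x + a)) has_derivative (\<lambda>h. dd h f (p + a))) (at p)"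
    by (rule has_derivative_compose[of "\<lambda>x. x + a" "\<lambda>h. h" p UNIV f, OF _ has_derivative_dd[OF assms]])
      (auto intro!: derivative_eq_intros)
  then show "dd e (\<lambda>x. f (x + a)) p = dd e f (p + a)" "(\<lambda>x. f (x + a)) differentiable at p"
    by (rule dd_eqI, rule differentiableI)
qed

lemma Hessian_local_max:
  assumes S: "open S" "p \<in> S" and C: "Ck_on 2 f S"
    and max: "\<And>x. x \<in> S \<Longrightarrow> f x \<le> f p"
  shows "dd d (dd d f) p \<le> 0"
proof -
  have C': "Ck_on (Suc (Suc 0)) f S" using C by (simp only: numeral_2_eq_2)
  obtain r where r: "r > 0" "ball p r \<subseteq> S" using S open_contains_ball by metis
  define \<delta> where "\<delta> = r / (norm d + 1)"
  have \<delta>: "\<delta> > 0" using r by (simp add: \<delta>_def add_nonneg_pos)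
  have inS: "p + t *\<^sub>R d \<in> S" if "\<bar>t\<bar> < \<delta>" for t
  proof -
    have "norm (t *\<^sub>R d) \<le> \<bar>t\<bar> * (norm d + 1)" by (simp add: mult_left_mono)
    also have "\<dots> < \<delta> * (norm d + 1)" using that by (intro mult_strict_right_mono) (auto simp: add_nonneg_pos)
    also have "\<dots> = r" by (simp add: \<delta>_def add_nonneg_eq_0_iff)
    finally have "p + t *\<^sub>R d \<in> ball p r" by (simp add: dist_norm)
    then show ?thesis using r by blast
  qed
  have D: "f differentiable at x" "dd d f differentiable at x" if "x \<in> S" for x
    using Ck_on_differentiable[OF C' S(1) that]
      Ck_on_differentiable[OF Ck_on_dd[OF S(1) C'] S(1) that] by simp_all
  show ?thesis
  proof (rule second_derivative_local_max[OF \<delta>])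
    show "((\<lambda>t. f (p + t *\<^sub>R d)) has_real_derivative dd d f (p + t *\<^sub>R d)) (at t)" if "\<bar>t\<bar> < \<delta>" for t
      by (rule DERIV_line[OF D(1)[OF inS[OF that]]])
    show "((\<lambda>t. dd d f (p + t *\<^sub>R d)) has_real_derivative dd d (dd d f) p) (at 0)"
      using DERIV_line[of "dd d f" p 0 d] D(2)[OF S(2)] by simp
    show "f (p + t *\<^sub>R d) \<le> f (p + 0 *\<^sub>R d)" if "\<bar>t\<bar> < \<delta>" for t
      using max[OF inS[OF that]] by simp
  qed
qed

lemma Ck_on_shift:
  assumes S: "open S"
  shows "Ck_on k f ((\<lambda>x. x + a) ` S) \<Longrightarrow> Ck_on k (\<lambda>x. f (x + a)) S"
proof (induction k arbitrary: f)
  case 0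
  then show ?case
    using continuous_on_compose[of S "\<lambda>x. x + a" f] by (simp add: o_def continuous_on_add)
next
  case (Suc k)
  have O: "open ((\<lambda>x. x + a) ` S)" using open_translation[OF S, of a] by (simp add: add.commute)
  note D = Ck_on_differentiable[OF Suc.prems O]
  show ?case
  proof (rule Ck_on_SucI[OF S, where fx = "\<lambda>x. pdx f (x + a)" and fy = "\<lambda>x. pdy f (x + a)"])
    show "((\<lambda>x. f (x + a)) has_derivative (\<lambda>h. fst h * pdx f (p + a) + snd h * pdy f (p + a))) (at p)"
      if "p \<in> S" for p
    proof -
      have d: "f differentiable at (p + a)" using D that by simp
      then show ?thesis
        using has_derivative_pd[OF dd_shift(2)[OF d]] by (simp add: pdx_eq_dd pdy_eq_dd dd_shift(1)[OF d])
    qed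
    show "Ck_on k (\<lambda>x. pdx f (x + a)) S" "Ck_on k (\<lambda>x. pdy f (x + a)) S"
      by (rule Suc.IH; insert Suc.prems[unfolded Ck_on_Suc_iff[OF O]], simp)+
  qed
qed

lemma dd_difference:
  assumes "f differentiable at (x + a)" "f differentiable at x" "g differentiable at x"
  shows "dd e (\<lambda>x. f (x + a) - f x - c * g x) x = dd e f (x + a) - dd e f x - c * dd e g x"
proof -
  have "((\<lambda>x. f (x + a)) has_derivative (\<lambda>h. dd h f (x + a))) (at x)"
    using has_derivative_dd[OF dd_shift(2)[OF assms(1)]] by (simp add: dd_shift(1)[OF assms(1)])
  from dd_eqI[OF has_derivative_diff[OF has_derivative_diff[OF this has_derivative_dd[OF assms(2)]]
        has_derivative_mult_right[OF has_derivative_dd[OF assms(3)]]]]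
  show ?thesis .
qed

lemma tendsto_of_continuous_on:
  fixes f :: "real \<times> real \<Rightarrow> real"
  assumes "open S" "p \<in> S" "continuous_on S f" "Y \<longlonglongrightarrow> p"
  shows "(\<lambda>n. f (Y n)) \<longlonglongrightarrow> f p"
  using assms by (metis continuous_on_eq_continuous_at isCont_tendsto_compose)

text \<open>The differentiated equation is used without third derivatives of \<open>u\<close>: the difference
  quotients of \<open>u\<close> are twice differentiable, and their maxima against \<open>z\<close> converge to \<open>p\<close>.\<close>

lemma touching_strict:
  fixes e1 e2 p :: "real \<times> real"
  assumes S: "open S" "p \<in> S"
    and u: "Ck_on 2 u S" and z: "Ck_on 2 z S"
    and A: "Ck_on 1 A11 S" "Ck_on 1 A12 S" "Ck_on 1 A22 S" "Ck_on 1 B S"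
    and eq: "\<And>x. x \<in> S \<Longrightarrow> A11 x * dd e1 (dd e1 u) x + 2 * A12 x * dd e1 (dd e2 u) x
      + A22 x * dd e2 (dd e2 u) x + B x = 0"
    and psd: "\<And>x. x \<in> S \<Longrightarrow> A11 x > 0" "\<And>x. x \<in> S \<Longrightarrow> (A12 x)\<^sup>2 \<le> A11 x * A22 x"
    and touch: "dd e1 u p = z p" "\<And>x. x \<in> S \<Longrightarrow> x \<noteq> p \<Longrightarrow> dd e1 u x < z x"
  shows "- (dd e1 A11 p * dd e1 (dd e1 u) p + 2 * dd e1 A12 p * dd e1 (dd e2 u) p
      + dd e1 A22 p * dd e2 (dd e2 u) p + dd e1 B p)
    \<le> A11 p * dd e1 (dd e1 z) p + 2 * A12 p * dd e1 (dd e2 z) p + A22 p * dd e2 (dd e2 z) p"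
proof -
  have u': "Ck_on (Suc (Suc 0)) u S" and z': "Ck_on (Suc (Suc 0)) z S"
    using u z by (simp_all only: numeral_2_eq_2)
  have u1: "Ck_on 1 u S" using Ck_on_le[OF u, of 1] by simp
  have Du: "u differentiable at x" and Dz: "z differentiable at x" if "x \<in> S" for x
    using Ck_on_differentiable[OF u' S(1) that] Ck_on_differentiable[OF z' S(1) that] by simp_all
  have Ddu: "dd e u differentiable at x" and Ddz: "dd e z differentiable at x" if "x \<in> S" for e x
    using Ck_on_differentiable[OF Ck_on_dd[OF S(1) u'] S(1) that]
      Ck_on_differentiable[OF Ck_on_dd[OF S(1) z'] S(1) that] by simp_all
  have Cu: "continuous_on S (dd e (dd e' u))" and Cz: "continuous_on S (dd e (dd e' z))" for e e'
    using Ck_on_continuous_on[OF Ck_on_dd[OF S(1) Ck_on_dd[OF S(1) u']]]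
      Ck_on_continuous_on[OF Ck_on_dd[OF S(1) Ck_on_dd[OF S(1) z']]] by simp_all
  obtain r0 where r0: "r0 > 0" "ball p r0 \<subseteq> S" using S open_contains_ball by metis
  \<comment> \<open>Three nested radii: maxima are taken over radius \<rho>, the functions
    \<open>w n\<close> are C^2 on radius 2 \<rho>, and shifts shorter than \<rho> stay within 3
    \<rho> = \<open>r0\<close>.\<close>
  define \<rho> where "\<rho> = r0 / 3"
  have \<rho>: "\<rho> > 0" using r0 by (simp add: \<rho>_def)
  define h where "h n = \<rho> / ((norm e1 + 1) * real (Suc n))" for n
  have hpos: "h n > 0" for n using \<rho> by (simp add: h_def add_nonneg_pos)
  have hlim: "h \<longlonglongrightarrow> 0"
  proof -
    have "(\<lambda>n. (\<rho> / (norm e1 + 1)) * inverse (real (Suc n))) \<longlonglongrightarrow> (\<rho> / (norm e1 + 1)) * 0"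
      by (intro tendsto_intros LIMSEQ_inverse_real_of_nat)
    moreover have "h = (\<lambda>n. (\<rho> / (norm e1 + 1)) * inverse (real (Suc n)))"
      by (rule ext) (simp add: h_def divide_inverse)
    ultimately show ?thesis by simp
  qed
  have hsmall: "norm (h n *\<^sub>R e1) < \<rho>" for n
  proof -
    have N: "norm e1 + 1 > 0" by (simp add: add_nonneg_pos)
    have "norm (h n *\<^sub>R e1) < h n * (norm e1 + 1)"
      using hpos[of n] by (simp add: algebra_simps)
    also have "h n * (norm e1 + 1) = \<rho> / real (Suc n)" using N by (simp add: h_def)
    also have "\<dots> \<le> \<rho> / 1" using \<rho> by (intro divide_left_mono) auto
    finally show ?thesis by simp
  qed
  define T where "T = ball p (2 * \<rho>)"
  have TS: "x \<in> S" if "x \<in> T" for x using that r0 \<rho> by (auto simp: T_def \<rho>_def)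
  have shiftS: "x + h n *\<^sub>R e1 \<in> S" if "x \<in> T" for x n
  proof -
    have "dist p (x + h n *\<^sub>R e1) \<le> dist p x + dist x (x + h n *\<^sub>R e1)" by (rule dist_triangle)
    also have "\<dots> < 2 * \<rho> + \<rho>"
      using that hsmall[of n] by (intro add_strict_mono) (auto simp: T_def dist_norm)
    finally have "x + h n *\<^sub>R e1 \<in> ball p r0" by (simp add: \<rho>_def)
    then show ?thesis using r0 by blast
  qed
  have T: "open T" "p \<in> T" using \<rho> by (simp_all add: T_def)
  \<comment> \<open>This is \<open>h n\<close> times (difference quotient of u minus z). It is C^2
    although \<open>dd e1 u - z\<close> is only C^1, so a Hessian is available at its
    maxima.\<close>
  define w where "w n x = u (x + h n *\<^sub>R e1) - u x - h n * z x" for n x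
  have wC: "Ck_on 2 (w n) T" for n
  proof -
    have "Ck_on 2 (\<lambda>x. u (x + h n *\<^sub>R e1)) T"
      by (rule Ck_on_shift[OF T(1)], rule Ck_on_subset[OF u]) (use shiftS in auto)
    moreover have "Ck_on 2 u T" "Ck_on 2 z T"
      by (rule Ck_on_subset[OF u], rule subsetI, erule TS) (rule Ck_on_subset[OF z], rule subsetI, erule TS)
    ultimately show ?thesis
      unfolding w_def by (intro Ck_on_diff[OF T(1)] Ck_on_mult[OF T(1)] Ck_on_const[OF T(1)])
  qed
  have w1: "dd e (w n) x = dd e u (x + h n *\<^sub>R e1) - dd e u x - h n * dd e z x" if "x \<in> T" for n x e
    unfolding w_def by (rule dd_difference[OF Du[OF shiftS[OF that]] Du[OF TS[OF that]] Dz[OF TS[OF that]]])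
  have w2: "dd e (dd e' (w n)) x = dd e (dd e' u) (x + h n *\<^sub>R e1) - dd e (dd e' u) x - h n * dd e (dd e' z) x"
    if "x \<in> T" for n x e e'
  proof -
    have "dd e (dd e' (w n)) x
        = dd e (\<lambda>x. dd e' u (x + h n *\<^sub>R e1) - dd e' u x - h n * dd e' z x) x"
      by (rule dd_cong[OF T(1) that]) (rule w1)
    also have "\<dots> = dd e (dd e' u) (x + h n *\<^sub>R e1) - dd e (dd e' u) x - h n * dd e (dd e' z) x"
      by (rule dd_difference[OF Ddu[OF shiftS[OF that]] Ddu[OF TS[OF that]] Ddz[OF TS[OF that]]])
    finally show ?thesis .
  qed
  have KT: "cball p \<rho> \<subseteq> T" using \<rho> by (auto simp: T_def)
  have "\<exists>x\<in>cball p \<rho>. \<forall>y\<in>cball p \<rho>. w n y \<le> w n x" for n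
    by (rule continuous_attains_sup)
      (use \<rho> continuous_on_subset[OF Ck_on_continuous_on[OF wC[of n]] KT] in auto)
  then obtain X where X: "\<And>n. X n \<in> cball p \<rho>" "\<And>n y. y \<in> cball p \<rho> \<Longrightarrow> w n y \<le> w n (X n)"
    by metis
  obtain l r where l: "l \<in> cball p \<rho>" and r: "strict_mono r" and lim: "(X \<circ> r) \<longlonglongrightarrow> l"
    using compact_cball[of p \<rho>] X(1) unfolding compact_def by metis
  define Y where "Y = X \<circ> r"
  define k where "k = h \<circ> r"
  have Yl: "Y \<longlonglongrightarrow> l" using lim by (simp add: Y_def)
  have klim: "k \<longlonglongrightarrow> 0" unfolding k_def by (rule LIMSEQ_subseq_LIMSEQ[OF hlim r])
  have kpos: "k n > 0" for n by (simp add: k_def hpos)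
  have lS: "l \<in> S" by (rule TS, rule subsetD[OF KT l])
  \<comment> \<open>Dividing maximality of \<open>w\<close> by the step and passing to the limit
    shows that \<open>dd e1 u - z\<close> is at least as large at \<open>l\<close> as at
    \<open>p\<close>, where it is 0. Strict touching leaves only \<open>l = p\<close>. Hence the
    maxima are eventually interior.\<close>
  have "l = p"
  proof (rule ccontr)
    assume "l \<noteq> p"
    have "(\<lambda>n. (u (Y n + k n *\<^sub>R e1) - u (Y n)) / k n - z (Y n)) \<longlonglongrightarrow> dd e1 u l - z l"
      by (intro tendsto_diff difference_quotient_tendsto[OF S(1) lS u1 Yl klim kpos]
          tendsto_of_continuous_on[OF S(1) lS Ck_on_continuous_on[OF z] Yl])
    moreover have "(\<lambda>n. (u (p + k n *\<^sub>R e1) - u p) / k n - z p) \<longlonglongrightarrow> dd e1 u p - z p"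
      by (intro tendsto_diff tendsto_const difference_quotient_tendsto[OF S u1 tendsto_const klim kpos])
    moreover have "(u (p + k n *\<^sub>R e1) - u p) / k n - z p \<le> (u (Y n + k n *\<^sub>R e1) - u (Y n)) / k n - z (Y n)" for n
    proof -
      have "w (r n) p \<le> w (r n) (X (r n))" using X(2)[of p] \<rho> by simp
      then have "(u (p + k n *\<^sub>R e1) - u p - k n * z p) / k n \<le> (u (Y n + k n *\<^sub>R e1) - u (Y n) - k n * z (Y n)) / k n"
        using kpos[of n] by (intro divide_right_mono) (auto simp: w_def Y_def k_def)
      then show ?thesis using kpos[of n] by (simp add: diff_divide_distrib)
    qed
    ultimately have "dd e1 u p - z p \<le> dd e1 u l - z l"
      by (intro LIMSEQ_le) auto
    then show False using touch(1) touch(2)[OF lS \<open>l \<noteq> p\<close>] by simp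
  qed
  then have Yp: "Y \<longlonglongrightarrow> p" using Yl by simp
  have Ykp: "(\<lambda>n. Y n + k n *\<^sub>R e1) \<longlonglongrightarrow> p"
    using tendsto_add[OF Yp tendsto_scaleR[OF klim tendsto_const[of e1]]] by simp
  define Q where "Q f n = (f (Y n + k n *\<^sub>R e1) - f (Y n)) / k n" for f :: "real \<times> real \<Rightarrow> real" and n
  have Qlim: "Q f \<longlonglongrightarrow> dd e1 f p" if "Ck_on 1 f S" for f
    unfolding Q_def by (rule difference_quotient_tendsto[OF S that Yp klim kpos])
  let ?L = "\<lambda>n. - (Q A11 n * dd e1 (dd e1 u) (Y n + k n *\<^sub>R e1) + 2 * Q A12 n * dd e1 (dd e2 u) (Y n + k n *\<^sub>R e1)
      + Q A22 n * dd e2 (dd e2 u) (Y n + k n *\<^sub>R e1) + Q B n)"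
  let ?R = "\<lambda>n. A11 (Y n) * dd e1 (dd e1 z) (Y n) + 2 * A12 (Y n) * dd e1 (dd e2 z) (Y n)
      + A22 (Y n) * dd e2 (dd e2 z) (Y n)"
  have "?L \<longlonglongrightarrow> - (dd e1 A11 p * dd e1 (dd e1 u) p + 2 * dd e1 A12 p * dd e1 (dd e2 u) p
      + dd e1 A22 p * dd e2 (dd e2 u) p + dd e1 B p)"
    by (intro tendsto_minus tendsto_add tendsto_mult tendsto_const Qlim A
        tendsto_of_continuous_on[OF S Cu Ykp])
  moreover have "?R \<longlonglongrightarrow> A11 p * dd e1 (dd e1 z) p + 2 * A12 p * dd e1 (dd e2 z) p
      + A22 p * dd e2 (dd e2 z) p"
    by (intro tendsto_add tendsto_mult tendsto_const tendsto_of_continuous_on[OF S _ Yp] Cz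
        Ck_on_continuous_on[OF A(1)] Ck_on_continuous_on[OF A(2)] Ck_on_continuous_on[OF A(3)])
  moreover have "\<forall>\<^sub>F n in sequentially. ?L n \<le> ?R n"
  proof -
    have "\<forall>\<^sub>F n in sequentially. dist (Y n) p < \<rho>" using Yp \<rho> by (simp add: tendsto_iff)
    then show ?thesis
    proof eventually_elim
      case (elim n)
      have YB: "Y n \<in> ball p \<rho>" using elim by (simp add: dist_commute)
      have YT: "Y n \<in> T" by (rule subsetD[OF KT]) (use YB in simp)
      have YS: "Y n \<in> S" using TS[OF YT] .
      have Y': "Y n + k n *\<^sub>R e1 \<in> S" using shiftS[OF YT, of "r n"] by (simp add: k_def)
      let ?w = "w (r n)"
      have C: "Ck_on 2 ?w (ball p \<rho>)" by (rule Ck_on_subset[OF wC subset_trans[OF ball_subset_cball KT]])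
      have "dd d (dd d ?w) (Y n) \<le> 0" for d
        by (rule Hessian_local_max[OF open_ball YB C]) (use X(2) in \<open>auto simp: Y_def\<close>)
      then have "\<alpha>\<^sup>2 * dd e1 (dd e1 ?w) (Y n) + 2 * \<alpha> * \<beta> * dd e1 (dd e2 ?w) (Y n)
          + \<beta>\<^sup>2 * dd e2 (dd e2 ?w) (Y n) \<le> 0" for \<alpha> \<beta>
        using dd_dd_combination[OF open_ball YB C, of \<alpha> e1 \<beta> e2] by metis
      then have tr: "A11 (Y n) * dd e1 (dd e1 ?w) (Y n) + 2 * A12 (Y n) * dd e1 (dd e2 ?w) (Y n)
          + A22 (Y n) * dd e2 (dd e2 ?w) (Y n) \<le> 0"
        by (rule trace_le_0[OF psd(1)[OF YS] psd(2)[OF YS]])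
      have wn: "dd e (dd e' ?w) (Y n) = dd e (dd e' u) (Y n + k n *\<^sub>R e1) - dd e (dd e' u) (Y n)
          - k n * dd e (dd e' z) (Y n)" for e e'
        using w2[OF YT, of e e' "r n"] by (simp add: k_def)
      \<comment> \<open>The equation at \<open>Y n\<close> is subtracted from the one at
        \<open>Y n + k n *\<^sub>R e1\<close>. The increment of a product is split so that the
        second derivatives of u stay at the shifted point, multiplied by increments of the
        coefficients. The Hessian inequality \<open>tr\<close> bounds the rest.\<close>
      have "k n * ?L n \<le> k n * ?R n"
      proof -
        have q: "k n * Q f n = f (Y n + k n *\<^sub>R e1) - f (Y n)" for f
          using kpos[of n] by (simp add: Q_def)
        have "k n * ?L n = - ((k n * Q A11 n) * dd e1 (dd e1 u) (Y n + k n *\<^sub>R e1) + 2 * (k n * Q A12 n) * dd e1 (dd e2 u) (Y n + k n *\<^sub>R e1)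
          + (k n * Q A22 n) * dd e2 (dd e2 u) (Y n + k n *\<^sub>R e1) + (k n * Q B n))"
          by (simp add: algebra_simps)
        then show ?thesis unfolding q using tr[unfolded wn] eq[OF YS] eq[OF Y']
          by (simp add: algebra_simps)
      qed
      then show ?case using kpos[of n] by simp
    qed
  qed
  ultimately show ?thesis
    by (intro tendsto_le[OF sequentially_bot])
qed

text \<open>Adding \<delta> |x - p|^2 to z makes the touching strict and changes the right-hand side
  by a fixed multiple of \<delta>, which is then sent to 0.\<close>

lemma touching:
  fixes e1 e2 p :: "real \<times> real"
  assumes S: "open S" "p \<in> S"
    and u: "Ck_on 2 u S" and z: "Ck_on 2 z S"
    and A: "Ck_on 1 A11 S" "Ck_on 1 A12 S" "Ck_on 1 A22 S" "Ck_on 1 B S"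
    and eq: "\<And>x. x \<in> S \<Longrightarrow> A11 x * dd e1 (dd e1 u) x + 2 * A12 x * dd e1 (dd e2 u) x
      + A22 x * dd e2 (dd e2 u) x + B x = 0"
    and psd: "\<And>x. x \<in> S \<Longrightarrow> A11 x > 0" "\<And>x. x \<in> S \<Longrightarrow> (A12 x)\<^sup>2 \<le> A11 x * A22 x"
    and touch: "dd e1 u p = z p" "\<And>x. x \<in> S \<Longrightarrow> dd e1 u x \<le> z x"
  shows "- (dd e1 A11 p * dd e1 (dd e1 u) p + 2 * dd e1 A12 p * dd e1 (dd e2 u) p
      + dd e1 A22 p * dd e2 (dd e2 u) p + dd e1 B p)
    \<le> A11 p * dd e1 (dd e1 z) p + 2 * A12 p * dd e1 (dd e2 z) p + A22 p * dd e2 (dd e2 z) p"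
    (is "?L \<le> ?R")
proof -
  define q where "q x = (fst x - fst p)\<^sup>2 + (snd x - snd p)\<^sup>2" for x :: "real \<times> real"
  have qC: "Ck_on k q S" for k
    unfolding q_def by (intro Ck_on_add Ck_on_power Ck_on_diff Ck_on_fst Ck_on_snd Ck_on_const S)
  have q1: "dd e q x = 2 * (fst x - fst p) * fst e + 2 * (snd x - snd p) * snd e" for e x
    unfolding q_def by (rule dd_eqI) (auto intro!: derivative_eq_intros simp: fun_eq_iff algebra_simps)
  have q2: "dd e (dd e' q) x = 2 * fst e * fst e' + 2 * snd e * snd e'" for e e' x
    unfolding q1[abs_def] by (rule dd_eqI) (auto intro!: derivative_eq_intros simp: fun_eq_iff algebra_simps)
  have z': "Ck_on (Suc (Suc 0)) z S" using z by (simp only: numeral_2_eq_2)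
  have Dz: "z differentiable at x" "dd e z differentiable at x" if "x \<in> S" for x e
    using Ck_on_differentiable[OF z' S(1) that]
      Ck_on_differentiable[OF Ck_on_dd[OF S(1) z'] S(1) that] by simp_all
  have Dq: "q differentiable at x" "dd e q differentiable at x" if "x \<in> S" for x e
    using Ck_on_differentiable[OF qC S(1) that]
      Ck_on_differentiable[OF Ck_on_dd[OF S(1) qC] S(1) that] by simp_all
  let ?c = "A11 p * dd e1 (dd e1 q) p + 2 * A12 p * dd e1 (dd e2 q) p + A22 p * dd e2 (dd e2 q) p"
  have step: "?L \<le> ?R + \<delta> * ?c" if "\<delta> > 0" for \<delta>
  proof -
    define z2 where "z2 x = 1 * z x + \<delta> * q x" for x
    have z2C: "Ck_on 2 z2 S"
      unfolding z2_def by (intro Ck_on_add Ck_on_mult Ck_on_const z qC S)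
    have d2: "dd e (dd e' z2) p = dd e (dd e' z) p + \<delta> * dd e (dd e' q) p" for e e'
    proof -
      have "dd e (dd e' z2) p = dd e (\<lambda>x. 1 * dd e' z x + \<delta> * dd e' q x) p"
        unfolding z2_def by (rule dd_cong[OF S]) (rule dd_add_scaled[OF Dz(1) Dq(1)])
      then show ?thesis using dd_add_scaled[OF Dz(2)[OF S(2)] Dq(2)[OF S(2)], of e 1 e' \<delta> e'] by simp
    qed
    have "dd e1 u x < z2 x" if "x \<in> S" "x \<noteq> p" for x
    proof -
      have "q x > 0" using that(2) unfolding q_def by (simp add: prod_eq_iff sum_power2_gt_zero_iff)
      then have "\<delta> * q x > 0" using \<open>\<delta> > 0\<close> by simp
      then show ?thesis using touch(2)[OF that(1)] by (simp add: z2_def)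
    qed
    moreover have "dd e1 u p = z2 p" using touch(1) by (simp add: z2_def q_def)
    ultimately have "?L \<le> A11 p * dd e1 (dd e1 z2) p + 2 * A12 p * dd e1 (dd e2 z2) p + A22 p * dd e2 (dd e2 z2) p"
      by (intro touching_strict[OF S u z2C A eq psd])
    then show ?thesis unfolding d2 by (simp add: algebra_simps)
  qed
  show ?thesis
  proof (rule field_le_epsilon)
    fix e :: real assume "e > 0"
    define \<delta> where "\<delta> = e / (\<bar>?c\<bar> + 1)"
    have "\<delta> > 0" using \<open>e > 0\<close> by (simp add: \<delta>_def)
    have "\<delta> * ?c \<le> \<delta> * (\<bar>?c\<bar> + 1)" using \<open>\<delta> > 0\<close> by (intro mult_left_mono) auto
    also have "\<dots> = e" by (simp add: \<delta>_def)
    finally show "?L \<le> ?R + e" using step[OF \<open>\<delta> > 0\<close>] by linarith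
  qed
qed

section \<open>The inequality at a steep maximum\<close>

lemma abs_mult_le:
  fixes x y :: real
  shows "\<bar>x\<bar> \<le> A \<Longrightarrow> \<bar>y\<bar> \<le> B \<Longrightarrow> \<bar>x * y\<bar> \<le> A * B"
  by (simp add: abs_mult mult_mono')

text \<open>Here \<open>X\<close> and \<open>Y\<close> are the derivatives of the first component of
  q along and across q. The inequality is multiplied by w = l^2 + v^2 so that the equation can
  eliminate \<open>u22\<close>. The terms quadratic in \<tau> are then 2 \<tau>^2 v^3 w Q from the
  barrier and -2 \<tau>^2 v^5 Q from the derivatives of the coefficients, and their sum is only 2
  \<tau>^2 v^3 l^2 Q. This cancellation makes the estimate possible.\<close>

lemma curvature_inequality:
  fixes l v K \<tau> c \<rho> s1 s2 L1 L2 L11 L12 L22 L112 L222 u11 u12 u22 :: real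
  defines "w \<equiv> l\<^sup>2 + v\<^sup>2"
  defines "\<phi>1 \<equiv> s1 - c * v"
  defines "\<phi>2 \<equiv> s2"
  defines "X \<equiv> - (v\<^sup>2 * \<tau>) * \<phi>1"
  defines "Y \<equiv> - (v\<^sup>2 * \<tau>) * \<phi>2"
  defines "Q \<equiv> l\<^sup>2 * \<phi>1\<^sup>2 + w * \<phi>2\<^sup>2"
  defines "\<kappa> \<equiv> L11 + L22"
  assumes l: "l > 0"
    and u11: "u11 = X + L12" and u12: "u12 = Y + L22"
    and eq: "l\<^sup>2 * u11 + w * u22 + v^3 * L1 + v\<^sup>2 * L12 = 0"
    and ineq: "- (2 * l\<^sup>2 * L1 * u11 + 2 * (- (v * (u12 + L11))) * u12
        + (2 * l\<^sup>2 * L1 + 2 * v * X) * u22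
        + (2 * v * X * L12 + v\<^sup>2 * L112 + v * (u12 + L11) * (L22 - L11) + 2 * v * X * (v * L1)
           + v\<^sup>2 * (X * L1 + v * L11 + (u12 + L11) * L2)))
      \<le> l\<^sup>2 * (- (v\<^sup>2 * \<tau>) * (- \<rho> - c * u11) + (2 * \<tau>\<^sup>2 * v^3 - K * \<tau> * v\<^sup>2) * \<phi>1\<^sup>2 + L112)
        + w * (- (v\<^sup>2 * \<tau>) * (- \<rho> - c * u22) + (2 * \<tau>\<^sup>2 * v^3 - K * \<tau> * v\<^sup>2) * \<phi>2\<^sup>2 + L222)"
  shows "w * (K * \<tau> * v\<^sup>2 * Q) \<le> 2 * \<tau>\<^sup>2 * v^3 * l\<^sup>2 * Q
      + \<tau> * v\<^sup>2 * (w * \<rho> * (l\<^sup>2 + w) - w * c * v\<^sup>2 * L12 - w * v\<^sup>2 * s1 * L1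
          - 4 * l\<^sup>2 * v\<^sup>2 * \<phi>1 * L1 + 3 * w * v * \<kappa> * s2 - w * v\<^sup>2 * s2 * L2)
      + (w * (l\<^sup>2 * L112 + w * L222) - 2 * l\<^sup>2 * v^3 * L1\<^sup>2
          + w * (v\<^sup>2 * L112 + v^3 * L11 + v\<^sup>2 * \<kappa> * L2 - v * \<kappa>\<^sup>2))"
proof -
  have w: "w > 0" using l by (simp add: w_def add_pos_nonneg)
  have t1: "w * u22 = - (l\<^sup>2 * X + w * L12 + v^3 * L1)"
    using eq unfolding u11 by (simp add: w_def algebra_simps)
  let ?P = "2 * l\<^sup>2 * L1 * u11 + 2 * (- (v * (u12 + L11))) * u12
        + (2 * v * X * L12 + v\<^sup>2 * L112 + v * (u12 + L11) * (L22 - L11) + 2 * v * X * (v * L1)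
           + v\<^sup>2 * (X * L1 + v * L11 + (u12 + L11) * L2))"
  let ?R = "l\<^sup>2 * (v\<^sup>2 * \<tau> * (\<rho> + c * u11) + L112) + v\<^sup>2 * \<tau> * (w * \<rho> + c * (w * u22)) + w * L222"
  have "w * (K * \<tau> * v\<^sup>2 * Q) \<le> w * (2 * \<tau>\<^sup>2 * v^3 * Q + ?R + ?P + (2 * l\<^sup>2 * L1 + 2 * v * X) * u22)"
    using ineq w by (intro mult_left_mono) (simp_all add: Q_def algebra_simps)
  also have "\<dots> = w * (2 * \<tau>\<^sup>2 * v^3 * Q) + w * ?R + w * ?P + (2 * l\<^sup>2 * L1 + 2 * v * X) * (w * u22)"
    by (simp add: algebra_simps)
  also have "\<dots> = 2 * \<tau>\<^sup>2 * v^3 * l\<^sup>2 * Q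
      + \<tau> * v\<^sup>2 * (w * \<rho> * (l\<^sup>2 + w) - w * c * v\<^sup>2 * L12 - w * v\<^sup>2 * s1 * L1
          - 4 * l\<^sup>2 * v\<^sup>2 * \<phi>1 * L1 + 3 * w * v * \<kappa> * s2 - w * v\<^sup>2 * s2 * L2)
      + (w * (l\<^sup>2 * L112 + w * L222) - 2 * l\<^sup>2 * v^3 * L1\<^sup>2
          + w * (v\<^sup>2 * L112 + v^3 * L11 + v\<^sup>2 * \<kappa> * L2 - v * \<kappa>\<^sup>2))"
    unfolding t1 unfolding u11 u12 Q_def X_def Y_def \<phi>1_def \<phi>2_def \<kappa>_def w_def
    by (simp add: algebra_simps power2_eq_square power3_eq_cube)
  finally show ?thesis by simp
qed

text \<open>The hypotheses describe the situation at a maximum of \<open>|q| (exp (K \<phi>) - 1)\<close> with maximal value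
  \<open>1 / a\<close>, in the frame with first vector \<open>q / |q|\<close>: \<open>l = \<lambda>\<close>, \<open>v = |q|\<close>, \<open>\<phi>\<^sub>1 = s1 - c v\<close>,
  \<open>\<phi>\<^sub>2 = s2\<close>, \<open>\<phi>\<^sub>1\<^sub>1 = - \<rho> - c u11\<close>, \<open>\<phi>\<^sub>2\<^sub>2 = - \<rho> - c u22\<close>, and indexed \<open>L\<close> are derivatives of
  \<open>ln \<lambda>\<close>. The last three are the two first-order conditions and the equation; the conclusion
  contradicts the second-order condition.\<close>

definition excludes_steep_maximum :: "real \<Rightarrow> real \<Rightarrow> real \<Rightarrow> real \<Rightarrow> real \<Rightarrow> real \<Rightarrow> real \<Rightarrow> real \<Rightarrow> bool"
  where "excludes_steep_maximum m M N N1 R c K v0 \<longleftrightarrow>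
    (\<forall>l v a \<rho> s1 s2 L1 L2 L11 L12 L22 L112 L222 u11 u12 u22 \<tau>.
    m \<le> l \<longrightarrow> l \<le> M \<longrightarrow> v0 \<le> v \<longrightarrow> 0 < a \<longrightarrow> a \<le> 1 \<longrightarrow> 0 \<le> \<rho> \<longrightarrow> \<rho> \<le> R \<longrightarrow>
    \<bar>s1\<bar> \<le> N1 \<longrightarrow> \<bar>s2\<bar> \<le> N1 \<longrightarrow> \<bar>L1\<bar> \<le> N \<longrightarrow> \<bar>L2\<bar> \<le> N \<longrightarrow> \<bar>L11\<bar> \<le> N \<longrightarrow> \<bar>L12\<bar> \<le> N \<longrightarrow>
    \<bar>L22\<bar> \<le> N \<longrightarrow> \<bar>L112\<bar> \<le> N \<longrightarrow> \<bar>L222\<bar> \<le> N \<longrightarrow> \<tau> = K * (1 / v + a) \<longrightarrow>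
    u11 = - (v\<^sup>2 * \<tau>) * (s1 - c * v) + L12 \<longrightarrow> u12 = - (v\<^sup>2 * \<tau>) * s2 + L22 \<longrightarrow>
    l\<^sup>2 * u11 + (l\<^sup>2 + v\<^sup>2) * u22 + v^3 * L1 + v\<^sup>2 * L12 = 0 \<longrightarrow>
    l\<^sup>2 * (- (v\<^sup>2 * \<tau>) * (- \<rho> - c * u11) + (2 * \<tau>\<^sup>2 * v^3 - K * \<tau> * v\<^sup>2) * (s1 - c * v)\<^sup>2 + L112)
      + (l\<^sup>2 + v\<^sup>2) * (- (v\<^sup>2 * \<tau>) * (- \<rho> - c * u22) + (2 * \<tau>\<^sup>2 * v^3 - K * \<tau> * v\<^sup>2) * s2\<^sup>2 + L222)
    < - (2 * l\<^sup>2 * L1 * u11 + 2 * (- (v * (u12 + L11))) * u12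
        + (2 * l\<^sup>2 * L1 + 2 * v * (- (v\<^sup>2 * \<tau>) * (s1 - c * v))) * u22
        + (2 * v * (- (v\<^sup>2 * \<tau>) * (s1 - c * v)) * L12 + v\<^sup>2 * L112 + v * (u12 + L11) * (L22 - L11)
           + 2 * v * (- (v\<^sup>2 * \<tau>) * (s1 - c * v)) * (v * L1)
           + v\<^sup>2 * (- (v\<^sup>2 * \<tau>) * (s1 - c * v) * L1 + v * L11 + (u12 + L11) * L2))))"

text \<open>In \<open>curvature_inequality\<close> the left side has size K \<tau> v^2 w Q. For
  steep v the quadratic term costs at most half of it, and the other errors are at most 2 G \<tau>
  v^4 w. What is left is K Q <= 4 G v^2. Since Q grows at least like v^2, a large K is
  contradictory.\<close>

lemma gradient_constants:
  fixes m M N N1 R c :: real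
  assumes "m > 0" "M > 0" "N \<ge> 0" "N1 \<ge> 0" "R \<ge> 0" "c > 0" "c \<le> 1"
  shows "\<exists>K v0. K \<ge> 1 \<and> v0 \<ge> 1 \<and> excludes_steep_maximum m M N N1 R c K v0"
proof -
  \<comment> \<open>\<open>G\<close> dominates the coefficients of both error groups: those
    multiplied by \<tau> v^2, measured in units of w v^2 (\<open>E1\<close>), and those without
    \<tau>, measured in units of w v^3 (\<open>E2\<close>).\<close>
  define G where "G = 3 * R + N + 2 * N1 * N + 4 * M\<^sup>2 * ((1 + N1) * N) + 6 * N * N1 + 10 * N + 6 * N\<^sup>2"
  have G: "G \<ge> 0" using assms by (simp add: G_def)
  define K where "K = 16 * G / (m\<^sup>2 * c\<^sup>2) + 1"
  \<comment> \<open>The summands serve in turn: powers of v are ordered and v is positive; l <= v,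
    hence w <= 2 v^2; the quadratic term is absorbed; c v dominates the part \<open>s1\<close> of
    the slope of the cutoff.\<close>
  define v0 where "v0 = 1 + M + 8 * M\<^sup>2 + 2 * N1 / c"
  have K: "K \<ge> 1" using G by (simp add: K_def)
  have v0: "v0 \<ge> 1" using assms by (simp add: v0_def)
  show ?thesis
  proof (rule exI[of _ K], rule exI[of _ v0], unfold excludes_steep_maximum_def, intro conjI K v0 allI impI, goal_cases)
    case (1 l v a \<rho> s1 s2 L1 L2 L11 L12 L22 L112 L222 u11 u12 u22 \<tau>)
    note H = this
    have v: "v \<ge> 1" "v \<ge> M" "v \<ge> 8 * M\<^sup>2" "v \<ge> 2 * N1 / c"
    proof -
      have "0 \<le> 2 * N1 / c" "0 \<le> 8 * M\<^sup>2" using assms by simp_all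
      then show "v \<ge> 1" "v \<ge> M" "v \<ge> 8 * M\<^sup>2" "v \<ge> 2 * N1 / c"
        using H(3) assms(2) unfolding v0_def by linarith+
    qed
    define w where "w = l\<^sup>2 + v\<^sup>2"
    define \<phi> where "\<phi> = s1 - c * v"
    define Q where "Q = l\<^sup>2 * \<phi>\<^sup>2 + w * s2\<^sup>2"
    define \<kappa> where "\<kappa> = L11 + L22"
    have l: "l > 0" using H(1) assms(1) by simp
    have \<tau>: "\<tau> > 0" using H(4,17) K v by (simp add: add_pos_pos)
    have l2: "l\<^sup>2 \<le> M\<^sup>2" using H(2) l by (intro power_mono) auto
    have l2v: "l\<^sup>2 \<le> v\<^sup>2" using H(2) l v by (intro power_mono) auto
    have vv: "v \<le> v\<^sup>2" "v\<^sup>2 \<le> v^3"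
      using v(1) power_increasing[of 1 2 v] power_increasing[of 2 3 v] by simp_all
    have w: "w > 0" "v\<^sup>2 \<le> w" "w \<le> 2 * v\<^sup>2" using l l2v v by (simp_all add: w_def add_pos_nonneg)
    have \<kappa>: "\<bar>\<kappa>\<bar> \<le> 2 * N" using H(12,14) unfolding \<kappa>_def by linarith
    have cv: "c * v \<le> v" using assms v by (simp add: mult_left_le_one_le)
    have N1v: "N1 \<le> N1 * v" using assms(4) v by (simp add: mult_le_cancel_left1)
    have \<phi>: "\<bar>\<phi>\<bar> \<le> (1 + N1) * v\<^sup>2"
    proof -
      have "\<bar>\<phi>\<bar> \<le> \<bar>s1\<bar> + \<bar>c * v\<bar>" unfolding \<phi>_def by (rule abs_triangle_ineq4)
      also have "\<bar>c * v\<bar> = c * v" using assms(6) v by simp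
      also have "\<bar>s1\<bar> + c * v \<le> N1 * v + v" using H(8) cv N1v by linarith
      also have "\<dots> = (1 + N1) * v" by (simp add: algebra_simps)
      also have "\<dots> \<le> (1 + N1) * v\<^sup>2" using assms(4) vv by (intro mult_left_mono) auto
      finally show ?thesis .
    qed
    have w0: "\<bar>w\<bar> \<le> w" and v0': "\<bar>v\<bar> \<le> v\<^sup>2" and v2: "\<bar>v\<^sup>2\<bar> \<le> v\<^sup>2" "\<bar>v\<^sup>2\<bar> \<le> v^3" "\<bar>v^3\<bar> \<le> v^3" "\<bar>v\<^sup>2\<bar> \<le> w"
      and c1: "\<bar>c\<bar> \<le> 1" and lM: "\<bar>l\<^sup>2\<bar> \<le> M\<^sup>2" "\<bar>l\<^sup>2\<bar> \<le> v^3" "\<bar>w\<bar> \<le> 2 * v^3"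
      and \<rho>1: "\<bar>\<rho>\<bar> \<le> R" and lw: "\<bar>l\<^sup>2 + w\<bar> \<le> 3 * v\<^sup>2"
      using w v vv l2 l2v assms H(6,7) by auto
    have "w * \<rho> * (l\<^sup>2 + w) \<le> w * R * (3 * v\<^sup>2)"
      using abs_mult_le[OF abs_mult_le[OF w0 \<rho>1] lw] by linarith
    moreover have "\<bar>w * c * v\<^sup>2 * L12\<bar> \<le> w * 1 * v\<^sup>2 * N"
      by (intro abs_mult_le w0 c1 v2 H)
    moreover have "\<bar>w * v\<^sup>2 * s1 * L1\<bar> \<le> w * v\<^sup>2 * N1 * N"
      by (intro abs_mult_le w0 v2 H)
    moreover have "\<bar>l\<^sup>2 * v\<^sup>2 * \<phi> * L1\<bar> \<le> M\<^sup>2 * w * ((1 + N1) * v\<^sup>2) * N"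
      by (intro abs_mult_le lM v2 \<phi> H)
    moreover have "\<bar>w * v * \<kappa> * s2\<bar> \<le> w * v\<^sup>2 * (2 * N) * N1"
      by (intro abs_mult_le w0 v0' \<kappa> H)
    moreover have "\<bar>w * v\<^sup>2 * s2 * L2\<bar> \<le> w * v\<^sup>2 * N1 * N"
      by (intro abs_mult_le w0 v2 H)
    ultimately have E1: "w * \<rho> * (l\<^sup>2 + w) - w * c * v\<^sup>2 * L12 - w * v\<^sup>2 * s1 * L1
        - 4 * l\<^sup>2 * v\<^sup>2 * \<phi> * L1 + 3 * w * v * \<kappa> * s2 - w * v\<^sup>2 * s2 * L2
        \<le> w * v\<^sup>2 * (3 * R + N + 2 * N1 * N + 4 * M\<^sup>2 * ((1 + N1) * N) + 6 * N * N1)"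
      by (simp add: algebra_simps)
    also have "\<dots> \<le> w * v\<^sup>2 * G"
      using w assms by (intro mult_left_mono) (simp_all add: G_def)
    finally have E1: "w * \<rho> * (l\<^sup>2 + w) - w * c * v\<^sup>2 * L12 - w * v\<^sup>2 * s1 * L1
        - 4 * l\<^sup>2 * v\<^sup>2 * \<phi> * L1 + 3 * w * v * \<kappa> * s2 - w * v\<^sup>2 * s2 * L2 \<le> w * v\<^sup>2 * G" .
    have "\<bar>w * (l\<^sup>2 * L112)\<bar> \<le> w * (v^3 * N)" by (intro abs_mult_le w0 lM H)
    moreover have "\<bar>w * (w * L222)\<bar> \<le> w * (2 * v^3 * N)" by (intro abs_mult_le w0 lM H)
    moreover have "\<bar>w * (v\<^sup>2 * L112)\<bar> \<le> w * (v^3 * N)" by (intro abs_mult_le w0 v2 H)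
    moreover have "\<bar>w * (v^3 * L11)\<bar> \<le> w * (v^3 * N)" by (intro abs_mult_le w0 v2 H)
    moreover have "\<bar>w * (v\<^sup>2 * \<kappa> * L2)\<bar> \<le> w * (v^3 * (2 * N) * N)" by (intro abs_mult_le w0 v2 \<kappa> H)
    moreover have "0 \<le> l\<^sup>2 * v^3 * L1\<^sup>2" using v by simp
    moreover have "0 \<le> w * (v * \<kappa>\<^sup>2)" using w v by simp
    ultimately have "w * (l\<^sup>2 * L112 + w * L222) - 2 * l\<^sup>2 * v^3 * L1\<^sup>2
          + w * (v\<^sup>2 * L112 + v^3 * L11 + v\<^sup>2 * \<kappa> * L2 - v * \<kappa>\<^sup>2) \<le> w * v^3 * (5 * N + 2 * N\<^sup>2)"
      by (simp add: algebra_simps power2_eq_square)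
    also have "\<dots> \<le> w * v^3 * G"
      using w v assms by (intro mult_left_mono) (simp_all add: G_def)
    finally have E2: "w * (l\<^sup>2 * L112 + w * L222) - 2 * l\<^sup>2 * v^3 * L1\<^sup>2
          + w * (v\<^sup>2 * L112 + v^3 * L11 + v\<^sup>2 * \<kappa> * L2 - v * \<kappa>\<^sup>2) \<le> w * v^3 * G" .
    have av: "a * v \<le> v" using H(4,5) v by (simp add: mult_left_le_one_le)
    have \<tau>v: "\<tau> * v = K * (1 + a * v)" using v by (simp add: H(17) field_simps)
    \<comment> \<open>Errors without a factor \<tau> are of order w v^3; this bound turns them into
      errors of order \<tau> v^2 (w v^2), like the others.\<close>
    have \<tau>v2: "\<tau> * v\<^sup>2 \<ge> v"
    proof -
      have "1 * v \<le> (K * (1 + a * v)) * v"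
        using K H(4) v by (intro mult_right_mono mult_ge1_I) auto
      also have "\<dots> = \<tau> * v\<^sup>2" by (simp add: \<tau>v[symmetric] power2_eq_square)
      finally show ?thesis by simp
    qed
    \<comment> \<open>This uses a <= 1, through a v <= v, and v >= 8 M^2. The outcome
      \<open>t\<close> keeps the term quadratic in \<tau> below half of the left side.\<close>
    have "\<tau> * v * l\<^sup>2 \<le> (K * (2 * v)) * M\<^sup>2"
    proof -
      have "1 + a * v \<le> 2 * v" using av v(1) by linarith
      then have "K * (1 + a * v) \<le> K * (2 * v)" using K by (intro mult_left_mono) auto
      then show ?thesis unfolding \<tau>v by (rule mult_mono[OF _ l2]) (use K v in simp_all)
    qed
    also have "\<dots> \<le> K * v\<^sup>2 / 4"
    proof -
      have "v * (8 * M\<^sup>2) \<le> v * v" using v by (intro mult_left_mono) auto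
      then have "K * (v * (8 * M\<^sup>2)) \<le> K * (v * v)" by (rule mult_left_mono) (use K in simp)
      then show ?thesis by (simp add: power2_eq_square algebra_simps)
    qed
    also have "\<dots> \<le> K * w / 4" using K w by simp
    finally have t: "\<tau> * v * l\<^sup>2 \<le> K * w / 4" .
    have Q: "Q \<ge> 0" using w by (simp add: Q_def)
    show ?case
    proof (rule ccontr)
      assume "\<not> ?case"
      then have "w * (K * \<tau> * v\<^sup>2 * Q) \<le> 2 * \<tau>\<^sup>2 * v^3 * l\<^sup>2 * Q
        + \<tau> * v\<^sup>2 * (w * \<rho> * (l\<^sup>2 + w) - w * c * v\<^sup>2 * L12 - w * v\<^sup>2 * s1 * L1
            - 4 * l\<^sup>2 * v\<^sup>2 * \<phi> * L1 + 3 * w * v * \<kappa> * s2 - w * v\<^sup>2 * s2 * L2)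
        + (w * (l\<^sup>2 * L112 + w * L222) - 2 * l\<^sup>2 * v^3 * L1\<^sup>2
            + w * (v\<^sup>2 * L112 + v^3 * L11 + v\<^sup>2 * \<kappa> * L2 - v * \<kappa>\<^sup>2))"
        unfolding w_def \<phi>_def Q_def \<kappa>_def
        by (intro curvature_inequality[OF l H(18,19,20)]) (simp only: not_less)
      also have "\<dots> \<le> 2 * \<tau>\<^sup>2 * v^3 * l\<^sup>2 * Q + \<tau> * v\<^sup>2 * (w * v\<^sup>2 * G) + w * v^3 * G"
        using E1 E2 \<tau> by (intro add_mono mult_left_mono order_refl) auto
      also have "w * v^3 * G \<le> \<tau> * v\<^sup>2 * (w * v\<^sup>2 * G)"
      proof -
        have "v * (w * v\<^sup>2 * G) \<le> \<tau> * v\<^sup>2 * (w * v\<^sup>2 * G)"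
          by (rule mult_right_mono[OF \<tau>v2]) (use w G in simp)
        then show ?thesis by (simp add: power2_eq_square power3_eq_cube algebra_simps)
      qed
      also have "2 * \<tau>\<^sup>2 * v^3 * l\<^sup>2 * Q = 2 * (\<tau> * v\<^sup>2 * Q) * (\<tau> * v * l\<^sup>2)"
        by (simp add: power2_eq_square power3_eq_cube algebra_simps)
      also have "\<dots> \<le> 2 * (\<tau> * v\<^sup>2 * Q) * (K * w / 4)"
        by (rule mult_left_mono[OF t]) (use \<tau> Q in simp)
      finally have "(w * \<tau> * v\<^sup>2) * (K * Q) \<le> (w * \<tau> * v\<^sup>2) * (4 * G * v\<^sup>2)"
        by (simp add: algebra_simps)
      then have KQ: "K * Q \<le> 4 * G * v\<^sup>2"
        using w \<tau> v by (simp add: mult_le_cancel_left_pos)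
      \<comment> \<open>The slope of the cutoff along q has absolute value at least c v / 2, so Q >=
        m^2 c^2 v^2 / 4. Together with \<open>KQ\<close> this gives K m^2 c^2 <= 16 G, against the
        definition of \<open>K\<close>.\<close>
      have "2 * N1 \<le> c * v" using v(4) assms(6) by (simp add: field_simps)
      then have "c * v / 2 \<le> - \<phi>" using H(8) by (simp add: \<phi>_def)
      then have "(c * v / 2)\<^sup>2 \<le> (- \<phi>)\<^sup>2" using assms(6) v by (intro power_mono) auto
      moreover have "m\<^sup>2 \<le> l\<^sup>2" using H(1) assms(1) by (intro power_mono) auto
      ultimately have "m\<^sup>2 * (c * v / 2)\<^sup>2 \<le> l\<^sup>2 * (- \<phi>)\<^sup>2" by (intro mult_mono) auto
      also have "l\<^sup>2 * (- \<phi>)\<^sup>2 = l\<^sup>2 * \<phi>\<^sup>2" by simp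
      also have "\<dots> \<le> Q" using w by (simp add: Q_def)
      finally have "K * (m\<^sup>2 * (c * v / 2)\<^sup>2) \<le> K * Q" by (rule mult_left_mono) (use K in simp)
      with KQ have "v\<^sup>2 * (K * (m\<^sup>2 * c\<^sup>2)) \<le> v\<^sup>2 * (16 * G)"
        by (simp add: power_mult_distrib power_divide algebra_simps)
      then have "K * (m\<^sup>2 * c\<^sup>2) \<le> 16 * G" using v by (simp add: mult_le_cancel_left_pos)
      moreover have "K * (m\<^sup>2 * c\<^sup>2) = 16 * G + m\<^sup>2 * c\<^sup>2"
        using assms(1,6) by (simp add: K_def distrib_right)
      ultimately show False using assms(1,6) by (simp add: mult_le_0_iff)
    qed
  qed
qed

section \<open>The equation in an orthonormal frame\<close>

text \<open>The numerator is kept apart from \<open>f1\<close> and \<open>f2\<close>, so that one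
  rule differentiates both components of the flux q / W.\<close>

lemma has_derivative_flux:
  fixes g f1 f2 lam :: "real \<times> real \<Rightarrow> real"
  assumes g: "g differentiable at p" and f: "f1 differentiable at p" "f2 differentiable at p"
    and lam: "lam differentiable at p" "lam p > 0"
  defines "W \<equiv> \<lambda>x. sqrt (1 + ((f1 x)\<^sup>2 + (f2 x)\<^sup>2) / (lam x)\<^sup>2)"
  shows "((\<lambda>x. g x / W x) has_derivative (\<lambda>h. dd h g p / W p
      - g p * (f1 p * dd h f1 p + f2 p * dd h f2 p - ((f1 p)\<^sup>2 + (f2 p)\<^sup>2) * dd h lam p / lam p)
        / ((lam p)\<^sup>2 * W p ^ 3))) (at p)"
proof -
  define F where "F x = 1 + ((f1 x)\<^sup>2 + (f2 x)\<^sup>2) / (lam x)\<^sup>2" for x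
  have WF: "W = (\<lambda>x. sqrt (F x))" by (rule ext) (simp add: W_def F_def)
  have Fp: "F p > 0" by (simp add: F_def add_pos_nonneg)
  note d = g[THEN has_derivative_dd] f(1)[THEN has_derivative_dd] f(2)[THEN has_derivative_dd]
    lam(1)[THEN has_derivative_dd]
  have sq: "((\<lambda>x. (f x)\<^sup>2) has_derivative (\<lambda>h. 2 * f p * dd h f p)) (at p)"
    if "(f has_derivative (\<lambda>h. dd h f p)) (at p)" for f
    using has_derivative_power[OF that, of 2] by (simp add: algebra_simps)
  have "(F has_derivative (\<lambda>h. 0 + ((2 * f1 p * dd h f1 p + 2 * f2 p * dd h f2 p) * (lam p)\<^sup>2
      - ((f1 p)\<^sup>2 + (f2 p)\<^sup>2) * (2 * lam p * dd h lam p)) / ((lam p)\<^sup>2 * (lam p)\<^sup>2))) (at p)"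
    unfolding F_def using lam(2)
    by (intro has_derivative_add has_derivative_const has_derivative_divide' sq d) simp
  moreover have "(\<lambda>h. 0 + ((2 * f1 p * dd h f1 p + 2 * f2 p * dd h f2 p) * (lam p)\<^sup>2
      - ((f1 p)\<^sup>2 + (f2 p)\<^sup>2) * (2 * lam p * dd h lam p)) / ((lam p)\<^sup>2 * (lam p)\<^sup>2))
    = (\<lambda>h. 2 * (f1 p * dd h f1 p + f2 p * dd h f2 p - ((f1 p)\<^sup>2 + (f2 p)\<^sup>2) * dd h lam p / lam p) / (lam p)\<^sup>2)"
    using lam(2) by (intro ext) (simp add: field_simps power2_eq_square)
  ultimately have dF: "(F has_derivative (\<lambda>h. 2 * (f1 p * dd h f1 p + f2 p * dd h f2 p
      - ((f1 p)\<^sup>2 + (f2 p)\<^sup>2) * dd h lam p / lam p) / (lam p)\<^sup>2)) (at p)" by simp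
  define E where "E h = f1 p * dd h f1 p + f2 p * dd h f2 p - ((f1 p)\<^sup>2 + (f2 p)\<^sup>2) * dd h lam p / lam p" for h
  have dF': "(F has_derivative (\<lambda>h. 2 * E h / (lam p)\<^sup>2)) (at p)" using dF by (simp add: E_def)
  have dW: "(W has_derivative (\<lambda>h. 2 * E h / (lam p)\<^sup>2 * (inverse (W p) / 2))) (at p)"
    unfolding WF by (rule has_derivative_real_sqrt[OF Fp dF'])
  have Wp: "W p > 0" using Fp by (simp add: WF)
  have dq: "((\<lambda>x. g x / W x) has_derivative
      (\<lambda>h. (dd h g p * W p - g p * (2 * E h / (lam p)\<^sup>2 * (inverse (W p) / 2))) / (W p * W p))) (at p)"
    using Wp by (intro has_derivative_divide' d dW) simp
  have "(\<lambda>h. (dd h g p * W p - g p * (2 * E h / (lam p)\<^sup>2 * (inverse (W p) / 2))) / (W p * W p))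
      = (\<lambda>h. dd h g p / W p - g p * E h / ((lam p)\<^sup>2 * W p ^ 3))"
    using Wp lam(2) by (intro ext) (simp add: field_simps power2_eq_square power3_eq_cube)
  with dq show ?thesis by (simp add: E_def)
qed

text \<open>Multiplying the expanded divergence by lam^2 W^3 and using lam^2 W^2 = lam^2 + |q|^2
  removes the square root. The last summand stems from differentiating lam inside W.\<close>

lemma flux_divergence:
  fixes q1 q2 lam :: "real \<times> real \<Rightarrow> real"
  assumes q: "q1 differentiable at p" "q2 differentiable at p"
    and lam: "lam differentiable at p" "lam p > 0"
  defines "W \<equiv> \<lambda>x. sqrt (1 + ((q1 x)\<^sup>2 + (q2 x)\<^sup>2) / (lam x)\<^sup>2)"
  assumes div: "dd e1 (\<lambda>x. q1 x / W x) p + dd e2 (\<lambda>x. q2 x / W x) p = 0"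
  shows "((lam p)\<^sup>2 + (q1 p)\<^sup>2 + (q2 p)\<^sup>2) * (dd e1 q1 p + dd e2 q2 p)
    - ((q1 p)\<^sup>2 * dd e1 q1 p + q1 p * q2 p * (dd e1 q2 p + dd e2 q1 p) + (q2 p)\<^sup>2 * dd e2 q2 p)
    + ((q1 p)\<^sup>2 + (q2 p)\<^sup>2) * (q1 p * (dd e1 lam p / lam p) + q2 p * (dd e2 lam p / lam p)) = 0"
proof -
  define E where "E h = q1 p * dd h q1 p + q2 p * dd h q2 p - ((q1 p)\<^sup>2 + (q2 p)\<^sup>2) * dd h lam p / lam p" for h
  have Wp: "W p > 0" by (simp add: W_def add_pos_nonneg)
  have W2: "(lam p)\<^sup>2 * (W p)\<^sup>2 = (lam p)\<^sup>2 + (q1 p)\<^sup>2 + (q2 p)\<^sup>2"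
    using lam(2) by (simp add: W_def add_nonneg_nonneg field_simps)
  have "dd e1 (\<lambda>x. q1 x / W x) p = dd e1 q1 p / W p - q1 p * E e1 / ((lam p)\<^sup>2 * W p ^ 3)"
    using dd_eqI[OF has_derivative_flux[OF q(1) q lam], of e1] by (simp only: W_def E_def)
  moreover have "dd e2 (\<lambda>x. q2 x / W x) p = dd e2 q2 p / W p - q2 p * E e2 / ((lam p)\<^sup>2 * W p ^ 3)"
    using dd_eqI[OF has_derivative_flux[OF q(2) q lam], of e2] by (simp only: W_def E_def)
  ultimately have sum0: "dd e1 q1 p / W p - q1 p * E e1 / ((lam p)\<^sup>2 * W p ^ 3)
      + (dd e2 q2 p / W p - q2 p * E e2 / ((lam p)\<^sup>2 * W p ^ 3)) = 0" using div by simp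
  have "((lam p)\<^sup>2 * (W p)\<^sup>2) * (dd e1 q1 p + dd e2 q2 p) - q1 p * E e1 - q2 p * E e2 = 0"
  proof -
    have "(l\<^sup>2 * w\<^sup>2) * (a + a') - b - b' = (l\<^sup>2 * w ^ 3) * (a / w - b / (l\<^sup>2 * w ^ 3) + (a' / w - b' / (l\<^sup>2 * w ^ 3)))"
      if "l > 0" "w > 0" for l w a a' b b' :: real
      using that by (simp add: power2_eq_square power3_eq_cube distrib_left right_diff_distrib)
    from this[OF lam(2) Wp, of "dd e1 q1 p" "dd e2 q2 p" "q1 p * E e1" "q2 p * E e2"]
    show ?thesis by (simp only: sum0 mult_zero_right)
  qed
  then show ?thesis unfolding W2 E_def
    by (simp add: algebra_simps power2_eq_square add_divide_distrib)
qed

text \<open>The components of \<open>q\<close> in the orthonormal frame \<open>e1, e2\<close>.\<close>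

definition slope1 :: "(real \<times> real \<Rightarrow> real) \<Rightarrow> (real \<times> real \<Rightarrow> real) \<Rightarrow> real \<times> real \<Rightarrow> real \<times> real \<Rightarrow> real \<times> real \<Rightarrow> real"
  where "slope1 lam u e1 e2 x = dd e1 u x - dd e2 (\<lambda>x. ln (lam x)) x"

definition slope2 :: "(real \<times> real \<Rightarrow> real) \<Rightarrow> (real \<times> real \<Rightarrow> real) \<Rightarrow> real \<times> real \<Rightarrow> real \<times> real \<Rightarrow> real \<times> real \<Rightarrow> real"
  where "slope2 lam u e1 e2 x = dd e2 u x + dd e1 (\<lambda>x. ln (lam x)) x"

lemma dd_ln:
  assumes "lam differentiable at x" "lam x > 0"
  shows "dd e (\<lambda>x. ln (lam x)) x = dd e lam x / lam x" "(\<lambda>x. ln (lam x)) differentiable at x"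
proof -
  have "((\<lambda>x. ln (lam x)) has_derivative (\<lambda>h. dd h lam x * inverse (lam x))) (at x)"
    using has_derivative_ln[OF assms(2) has_derivative_dd[OF assms(1)]] by (simp add: mult_ac)
  from dd_eqI[OF this] differentiableI[OF this]
  show "dd e (\<lambda>x. ln (lam x)) x = dd e lam x / lam x" "(\<lambda>x. ln (lam x)) differentiable at x"
    by (simp_all add: divide_inverse)
qed

text \<open>With J the quarter turn, q is grad u + J grad L. Rotations of the plane commute with J,
  so the components of q have the same formula in every positively oriented orthonormal
  frame.\<close>

lemma slope_rotate:
  assumes u: "u differentiable at x" and L: "(\<lambda>x. ln (lam x)) differentiable at x"
  shows "slope1 lam u (c, s) (- s, c) x = c * slope1 lam u (1, 0) (0, 1) x + s * slope2 lam u (1, 0) (0, 1) x"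
    and "slope2 lam u (c, s) (- s, c) x = - s * slope1 lam u (1, 0) (0, 1) x + c * slope2 lam u (1, 0) (0, 1) x"
  unfolding slope1_def slope2_def dd_pd[OF u] dd_pd[OF L] by (simp_all add: algebra_simps)

lemma gr_slope:
  assumes "lam differentiable at x" "lam x > 0"
  shows "gr_alpha lam u x = - slope1 lam u (1, 0) (0, 1) x / lam x"
    and "gr_beta lam u x = - slope2 lam u (1, 0) (0, 1) x / lam x"
  unfolding gr_alpha_def gr_beta_def slope1_def slope2_def dd_ln[OF assms] pdx_eq_dd pdy_eq_dd
  using assms(2) by (simp_all add: field_simps power2_eq_square)

lemma gr_W_slope:
  assumes "lam differentiable at x" "lam x > 0"
  shows "gr_W lam u x = sqrt (1 + ((slope1 lam u (1, 0) (0, 1) x)\<^sup>2 + (slope2 lam u (1, 0) (0, 1) x)\<^sup>2) / (lam x)\<^sup>2)"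
  unfolding gr_W_def gr_slope[OF assms] by (simp add: power_divide add_divide_distrib add.assoc)

lemma frame_norm:
  fixes c s a b :: real
  assumes "c\<^sup>2 + s\<^sup>2 = 1"
  shows "(c * a + s * b)\<^sup>2 + (- s * a + c * b)\<^sup>2 = a\<^sup>2 + b\<^sup>2"
proof -
  have "(c * a + s * b)\<^sup>2 + (- s * a + c * b)\<^sup>2 = (c\<^sup>2 + s\<^sup>2) * (a\<^sup>2 + b\<^sup>2)"
    by (simp add: power2_eq_square algebra_simps)
  then show ?thesis using assms by simp
qed

lemma Ck_on_slope:
  assumes "open S" "Ck_on (Suc k) u S" "Ck_on (Suc k) (\<lambda>x. ln (lam x)) S"
  shows "Ck_on k (slope1 lam u e1 e2) S" "Ck_on k (slope2 lam u e1 e2) S"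
  unfolding slope1_def[abs_def] slope2_def[abs_def]
  by (intro Ck_on_diff Ck_on_add Ck_on_dd assms)+

text \<open>The frame is constant but otherwise arbitrary. It will be aligned with q at one point
  only, while the equation is differentiated there; terms with \<open>Q2\<close> must therefore be
  kept even though \<open>Q2\<close> vanishes at that point. J grad L is divergence free, so second
  derivatives of L enter only through the quadratic form in q.\<close>

lemma frame_equation:
  assumes cs: "c\<^sup>2 + s\<^sup>2 = 1" and S: "open \<Omega>" "p \<in> \<Omega>"
    and lamC: "Ck_on 4 lam \<Omega>" and lam0: "\<And>x. x \<in> \<Omega> \<Longrightarrow> lam x > 0"
    and sol: "minimal_surface_solution lam \<Omega> u"
  defines "e1 \<equiv> (c, s)" and "e2 \<equiv> (- s, c)"
  defines "L \<equiv> \<lambda>x. ln (lam x)"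
  defines "Q1 \<equiv> slope1 lam u e1 e2 p" and "Q2 \<equiv> slope2 lam u e1 e2 p"
  shows "((lam p)\<^sup>2 + Q2\<^sup>2) * dd e1 (dd e1 u) p + 2 * (- (Q1 * Q2)) * dd e1 (dd e2 u) p
    + ((lam p)\<^sup>2 + Q1\<^sup>2) * dd e2 (dd e2 u) p
    + ((Q1\<^sup>2 - Q2\<^sup>2) * dd e1 (dd e2 L) p + Q1 * Q2 * (dd e2 (dd e2 L) p - dd e1 (dd e1 L) p)
      + (Q1\<^sup>2 + Q2\<^sup>2) * (Q1 * dd e1 L p + Q2 * dd e2 L p)) = 0"
proof -
  have lam1: "Ck_on (Suc 0) lam \<Omega>" by (rule Ck_on_le[OF lamC]) simp
  have Dlam: "lam differentiable at x" if "x \<in> \<Omega>" for x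
    by (rule Ck_on_differentiable[OF lam1 S(1) that])
  have LC: "Ck_on 4 L \<Omega>" unfolding L_def by (rule Ck_on_ln[OF S(1) lam0 lamC])
  have L2: "Ck_on (Suc (Suc 0)) L \<Omega>" by (rule Ck_on_le[OF LC]) simp
  have u2: "Ck_on (Suc (Suc 0)) u \<Omega>"
    using sol unfolding minimal_surface_solution_def by (simp only: numeral_2_eq_2)
  have Du: "u differentiable at x" and DL: "L differentiable at x" if "x \<in> \<Omega>" for x
    using Ck_on_differentiable[OF u2 S(1) that] Ck_on_differentiable[OF L2 S(1) that] by simp_all
  have Ddu: "dd e u differentiable at x" and DdL: "dd e L differentiable at x" if "x \<in> \<Omega>" for x e
    using Ck_on_differentiable[OF Ck_on_dd[OF S(1) u2] S(1) that]
      Ck_on_differentiable[OF Ck_on_dd[OF S(1) L2] S(1) that] by simp_all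
  note Cq = Ck_on_slope[OF S(1) u2 L2[unfolded L_def]]
  have Dq: "slope1 lam u a b differentiable at x" "slope2 lam u a b differentiable at x" if "x \<in> \<Omega>" for x a b
    using Ck_on_differentiable[OF Cq(1) S(1) that] Ck_on_differentiable[OF Cq(2) S(1) that] by simp_all
  define X where "X = slope1 lam u (1, 0) (0, 1)"
  define Y where "Y = slope2 lam u (1, 0) (0, 1)"
  define W where "W x = sqrt (1 + ((X x)\<^sup>2 + (Y x)\<^sup>2) / (lam x)\<^sup>2)" for x
  have DXW: "(\<lambda>x. X x / W x) differentiable at p" and DYW: "(\<lambda>x. Y x / W x) differentiable at p"
    unfolding W_def X_def Y_def
    by (rule differentiableI, rule has_derivative_flux; intro Dq Dlam lam0 S(2))+
  \<comment> \<open>The zero summand only gives the right-hand side the shape expected by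
    \<open>dd_add_scaled\<close>, which then extracts the sign in (\<alpha>, \<beta>) = - q /
    lam.\<close>
  have "pdx (\<lambda>x. lam x * gr_alpha lam u x / gr_W lam u x) p = dd (1, 0) (\<lambda>x. 0 * 0 + (-1) * (X x / W x)) p"
    unfolding pdx_eq_dd
    by (rule dd_cong[OF S]) (use lam0 in \<open>simp add: gr_slope[OF Dlam] gr_W_slope[OF Dlam] W_def X_def Y_def less_imp_neq[symmetric]\<close>)
  also have "\<dots> = - pdx (\<lambda>x. X x / W x) p"
    using dd_add_scaled[OF differentiable_const DXW, of "(1,0)" 0 0 "-1"] by (simp add: pdx_eq_dd)
  finally have x1: "pdx (\<lambda>x. lam x * gr_alpha lam u x / gr_W lam u x) p = - pdx (\<lambda>x. X x / W x) p" .
  have "pdy (\<lambda>x. lam x * gr_beta lam u x / gr_W lam u x) p = dd (0, 1) (\<lambda>x. 0 * 0 + (-1) * (Y x / W x)) p"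
    unfolding pdy_eq_dd
    by (rule dd_cong[OF S]) (use lam0 in \<open>simp add: gr_slope[OF Dlam] gr_W_slope[OF Dlam] W_def X_def Y_def less_imp_neq[symmetric]\<close>)
  also have "\<dots> = - pdy (\<lambda>x. Y x / W x) p"
    using dd_add_scaled[OF differentiable_const DYW, of "(0,1)" 0 0 "-1"] by (simp add: pdy_eq_dd)
  finally have "pdy (\<lambda>x. lam x * gr_beta lam u x / gr_W lam u x) p = - pdy (\<lambda>x. Y x / W x) p" .
  with x1 have div0: "pdx (\<lambda>x. X x / W x) p + pdy (\<lambda>x. Y x / W x) p = 0"
    using sol S(2) unfolding minimal_surface_solution_def by fastforce
  let ?q1 = "slope1 lam u e1 e2" and ?q2 = "slope2 lam u e1 e2"
  have fr: "?q1 x = c * X x + s * Y x" "?q2 x = - s * X x + c * Y x" if "x \<in> \<Omega>" for x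
    using slope_rotate[OF Du[OF that] DL[OF that, unfolded L_def], of c s]
    by (simp_all add: e1_def e2_def X_def Y_def)
  define V where "V x = sqrt (1 + ((?q1 x)\<^sup>2 + (?q2 x)\<^sup>2) / (lam x)\<^sup>2)" for x
  have VW: "V x = W x" if "x \<in> \<Omega>" for x
    unfolding V_def W_def fr[OF that] frame_norm[OF cs] ..
  have "dd e1 (\<lambda>x. ?q1 x / V x) p = dd e1 (\<lambda>x. c * (X x / W x) + s * (Y x / W x)) p"
    by (rule dd_cong[OF S]) (simp add: fr VW add_divide_distrib)
  then have d1: "dd e1 (\<lambda>x. ?q1 x / V x) p = c * dd e1 (\<lambda>x. X x / W x) p + s * dd e1 (\<lambda>x. Y x / W x) p"
    by (simp only: dd_add_scaled[OF DXW DYW])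
  have "dd e2 (\<lambda>x. ?q2 x / V x) p = dd e2 (\<lambda>x. - s * (X x / W x) + c * (Y x / W x)) p"
    by (rule dd_cong[OF S]) (simp add: fr VW add_divide_distrib diff_divide_distrib)
  then have d2: "dd e2 (\<lambda>x. ?q2 x / V x) p = - s * dd e2 (\<lambda>x. X x / W x) p + c * dd e2 (\<lambda>x. Y x / W x) p"
    by (simp only: dd_add_scaled[OF DXW DYW])
  \<comment> \<open>Rotation invariance of the divergence: the mixed terms cancel and the pure ones
    carry the factor c^2 + s^2.\<close>
  have "dd e1 (\<lambda>x. ?q1 x / V x) p + dd e2 (\<lambda>x. ?q2 x / V x) p
      = (c\<^sup>2 + s\<^sup>2) * (pdx (\<lambda>x. X x / W x) p + pdy (\<lambda>x. Y x / W x) p)"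
    unfolding d1 d2 unfolding dd_pd[OF DXW] dd_pd[OF DYW] e1_def e2_def
    by (simp add: power2_eq_square algebra_simps)
  then have "dd e1 (\<lambda>x. ?q1 x / V x) p + dd e2 (\<lambda>x. ?q2 x / V x) p = 0" using div0 by simp
  note main = flux_divergence[OF Dq(1)[OF S(2)] Dq(2)[OF S(2)] Dlam[OF S(2)] lam0[OF S(2)] this[unfolded V_def]]
  have Dln: "dd e lam p / lam p = dd e L p" for e
    unfolding L_def dd_ln(1)[OF Dlam[OF S(2)] lam0[OF S(2)]] ..
  have dq1: "dd e ?q1 p = dd e (dd e1 u) p - dd e (dd e2 L) p" for e
    unfolding slope1_def[abs_def] L_def[symmetric]
    by (rule dd_eqI[OF has_derivative_diff]) (rule has_derivative_dd Ddu DdL S)+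
  have dq2: "dd e ?q2 p = dd e (dd e2 u) p + dd e (dd e1 L) p" for e
    unfolding slope2_def[abs_def] L_def[symmetric]
    by (rule dd_eqI[OF has_derivative_add]) (rule has_derivative_dd Ddu DdL S)+
  have cu: "dd e2 (dd e1 u) p = dd e1 (dd e2 u) p" and cL: "dd e2 (dd e1 L) p = dd e1 (dd e2 L) p"
    using dd_commute[OF S] u2 L2 by (simp_all only: numeral_2_eq_2)
  show ?thesis
    using main unfolding Dln dq1 dq2 cu cL Q1_def[symmetric] Q2_def[symmetric]
    by (simp add: algebra_simps power2_eq_square)
qed

section \<open>The cutoff function\<close>

lemma dd_mult:
  assumes "f differentiable at x" "g differentiable at x"
  shows "dd e (\<lambda>y. f y * g y) x = f x * dd e g x + dd e f x * g x"
  by (rule dd_eqI[OF has_derivative_mult]) (rule has_derivative_dd assms)+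

lemma dd_add:
  assumes "f differentiable at x" "g differentiable at x"
  shows "dd e (\<lambda>y. f y + g y) x = dd e f x + dd e g x"
  by (rule dd_eqI[OF has_derivative_add]) (rule has_derivative_dd assms)+

lemma dd_diff:
  assumes "f differentiable at x" "g differentiable at x"
  shows "dd e (\<lambda>y. f y - g y) x = dd e f x - dd e g x"
  by (rule dd_eqI[OF has_derivative_diff]) (rule has_derivative_dd assms)+

lemma dd_uminus:
  assumes "f differentiable at x"
  shows "dd e (\<lambda>y. - f y) x = - dd e f x"
  by (rule dd_eqI[OF has_derivative_minus]) (rule has_derivative_dd assms)+

lemma dd_power2:
  assumes "f differentiable at x"
  shows "dd e (\<lambda>y. (f y)\<^sup>2) x = 2 * f x * dd e f x"
  using dd_mult[OF assms assms, of e] by (simp add: power2_eq_square)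

text \<open>As a function of \<phi>, z solves the autonomous equation z' = - K (z + a z^2), because
  a exp (K \<phi>) z = 1 + a z. Its derivatives are thus expressed by z itself, and no exponential
  is left when the value of z at the touching point is inserted.\<close>

lemma reciprocal_barrier:
  assumes T: "open T" "x \<in> T" and \<phi>: "Ck_on 2 \<phi> T"
    and k: "\<And>y. y \<in> T \<Longrightarrow> a * (exp (K * \<phi> y) - 1) > 0"
  defines "z \<equiv> \<lambda>y. inverse (a * (exp (K * \<phi> y) - 1))"
  shows "Ck_on 2 z T"
    and "dd e z x = - (K * (z x + a * (z x)\<^sup>2)) * dd e \<phi> x"
    and "dd e (dd e' z) x = K\<^sup>2 * (z x + a * (z x)\<^sup>2) * (1 + 2 * a * z x) * dd e \<phi> x * dd e' \<phi> x
      - K * (z x + a * (z x)\<^sup>2) * dd e (dd e' \<phi>) x"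
proof -
  have \<phi>2: "Ck_on (Suc (Suc 0)) \<phi> T" using \<phi> by (simp only: numeral_2_eq_2)
  have D\<phi>: "\<phi> differentiable at y" if "y \<in> T" for y
    by (rule Ck_on_differentiable[OF \<phi>2 T(1) that])
  have Dd\<phi>: "dd e \<phi> differentiable at y" if "y \<in> T" for y e
    by (rule Ck_on_differentiable[OF Ck_on_dd[OF T(1) \<phi>2] T(1) that])
  have kne: "a * (exp (K * \<phi> y) - 1) \<noteq> 0" if "y \<in> T" for y
    by (rule less_imp_neq[OF k[OF that], symmetric])
  show zC: "Ck_on 2 z T" unfolding z_def
    by (rule Ck_on_inverse[OF T(1) kne], assumption)
      (intro Ck_on_mult Ck_on_diff Ck_on_const Ck_on_exp \<phi> T(1))
  have z2: "Ck_on (Suc (Suc 0)) z T" using zC by (simp only: numeral_2_eq_2)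
  have Dz: "z differentiable at y" if "y \<in> T" for y
    by (rule Ck_on_differentiable[OF z2 T(1) that])
  have d1: "dd e z y = - (K * (z y + a * (z y)\<^sup>2)) * dd e \<phi> y" if "y \<in> T" for e y
  proof -
    have "((\<lambda>y. K * \<phi> y) has_derivative (\<lambda>h. K * dd h \<phi> y)) (at y)"
      by (rule has_derivative_mult_right[OF has_derivative_dd[OF D\<phi>[OF that]]])
    from has_derivative_mult_right[OF has_derivative_diff[OF has_derivative_exp[OF this] has_derivative_const[of 1]], of a]
    have "((\<lambda>y. a * (exp (K * \<phi> y) - 1)) has_derivative
        (\<lambda>h. a * (K * dd h \<phi> y * exp (K * \<phi> y) - 0))) (at y)" .
    from dd_eqI[OF Deriv.has_derivative_inverse[OF kne[OF that] this], of e]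
    have "dd e z y = - (z y * (a * (K * dd e \<phi> y * exp (K * \<phi> y) - 0)) * z y)"
      unfolding z_def .
    then have "dd e z y = - (a * exp (K * \<phi> y) * z y) * (K * z y * dd e \<phi> y)"
      by (simp add: algebra_simps)
    also have "a * exp (K * \<phi> y) * z y = 1 + a * z y"
      using kne[OF that] unfolding z_def by (simp add: field_simps)
    finally show ?thesis by (simp add: power2_eq_square algebra_simps)
  qed
  show "dd e z x = - (K * (z x + a * (z x)\<^sup>2)) * dd e \<phi> x" by (rule d1[OF T(2)])
  have "dd e (dd e' z) x = dd e (\<lambda>y. (- K * z y + (- K * a) * (z y)\<^sup>2) * dd e' \<phi> y) x"
    by (rule dd_cong[OF T]) (simp add: d1 algebra_simps)
  also have "\<dots> = (- K * z x + (- K * a) * (z x)\<^sup>2) * dd e (dd e' \<phi>) x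
      + dd e (\<lambda>y. - K * z y + (- K * a) * (z y)\<^sup>2) x * dd e' \<phi> x"
    by (rule dd_mult[OF _ Dd\<phi>[OF T(2)]])
      (intro differentiable_add differentiable_mult differentiable_power differentiable_const Dz T(2))
  also have "dd e (\<lambda>y. - K * z y + (- K * a) * (z y)\<^sup>2) x = - K * dd e z x + (- K * a) * (2 * z x * dd e z x)"
    by (subst dd_add_scaled[OF Dz[OF T(2)] differentiable_power[OF Dz[OF T(2)]]])
      (simp only: dd_power2[OF Dz[OF T(2)]])
  finally show "dd e (dd e' z) x = K\<^sup>2 * (z x + a * (z x)\<^sup>2) * (1 + 2 * a * z x) * dd e \<phi> x * dd e' \<phi> x
      - K * (z x + a * (z x)\<^sup>2) * dd e (dd e' \<phi>) x"
    unfolding d1[OF T(2)] by (simp add: power2_eq_square algebra_simps)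
qed

lemma cutoff_derivatives:
  fixes p :: "real \<times> real" and r b :: real
  assumes T: "open T" "x \<in> T" and u: "Ck_on 2 u T"
  defines "\<phi> \<equiv> \<lambda>y. 1 - ((fst y - fst p)\<^sup>2 + (snd y - snd p)\<^sup>2) / r\<^sup>2 - b * u y"
  shows "Ck_on 2 \<phi> T"
    and "dd e \<phi> x = - (2 * ((fst x - fst p) * fst e + (snd x - snd p) * snd e) / r\<^sup>2) - b * dd e u x"
    and "dd e (dd e' \<phi>) x = - (2 * (fst e * fst e' + snd e * snd e') / r\<^sup>2) - b * dd e (dd e' u) x"
proof -
  have u2: "Ck_on (Suc (Suc 0)) u T" using u by (simp only: numeral_2_eq_2)
  have Du: "u differentiable at y" if "y \<in> T" for y
    by (rule Ck_on_differentiable[OF u2 T(1) that])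
  have Ddu: "dd e u differentiable at y" if "y \<in> T" for y e
    by (rule Ck_on_differentiable[OF Ck_on_dd[OF T(1) u2] T(1) that])
  show "Ck_on 2 \<phi> T"
    unfolding \<phi>_def divide_inverse
    by (intro Ck_on_diff Ck_on_mult Ck_on_const Ck_on_add Ck_on_power Ck_on_fst Ck_on_snd u T(1))
  have d1: "dd e \<phi> y = - (2 * ((fst y - fst p) * fst e + (snd y - snd p) * snd e) / r\<^sup>2) - b * dd e u y"
    if "y \<in> T" for e y
  proof -
    have "((\<lambda>y. 1 - ((fst y - fst p)\<^sup>2 + (snd y - snd p)\<^sup>2) / r\<^sup>2) has_derivative
        (\<lambda>h. - (2 * ((fst y - fst p) * fst h + (snd y - snd p) * snd h) / r\<^sup>2))) (at y)"
      unfolding divide_inverse by (auto intro!: derivative_eq_intros simp: fun_eq_iff algebra_simps)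
    from dd_eqI[OF has_derivative_diff[OF this has_derivative_mult_right[OF has_derivative_dd[OF Du[OF that]]]]]
    show ?thesis unfolding \<phi>_def .
  qed
  show "dd e \<phi> x = - (2 * ((fst x - fst p) * fst e + (snd x - snd p) * snd e) / r\<^sup>2) - b * dd e u x"
    by (rule d1[OF T(2)])
  have "dd e (dd e' \<phi>) x = dd e (\<lambda>y. - (2 * ((fst y - fst p) * fst e' + (snd y - snd p) * snd e') / r\<^sup>2) - b * dd e' u y) x"
    by (rule dd_cong[OF T]) (rule d1)
  also have "\<dots> = - (2 * (fst e * fst e' + snd e * snd e') / r\<^sup>2) - b * dd e (dd e' u) x"
  proof (rule dd_eqI[OF has_derivative_diff[OF _ has_derivative_mult_right[OF has_derivative_dd[OF Ddu[OF T(2)]]]]])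
    show "((\<lambda>y. - (2 * ((fst y - fst p) * fst e' + (snd y - snd p) * snd e') / r\<^sup>2)) has_derivative
        (\<lambda>h. - (2 * (fst h * fst e' + snd h * snd e') / r\<^sup>2))) (at x)"
      unfolding divide_inverse by (auto intro!: derivative_eq_intros simp: fun_eq_iff algebra_simps)
  qed
  finally show "dd e (dd e' \<phi>) x = - (2 * (fst e * fst e' + snd e * snd e') / r\<^sup>2) - b * dd e (dd e' u) x" .
qed

section \<open>The steep maximum and the resulting bound on |q|\<close>

lemma dd_eq_at_touching:
  assumes T: "open T" "x \<in> T" and D: "f differentiable at x" "g differentiable at x"
    and le: "\<And>y. y \<in> T \<Longrightarrow> f y \<le> g y" "f x = g x"
  shows "dd e f x = dd e g x"
proof -
  have "(\<lambda>h. dd h f x - dd h g x) = (\<lambda>h. 0)"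
    by (rule differential_zero_maxmin[OF T(2,1) has_derivative_diff[OF has_derivative_dd[OF D(1)] has_derivative_dd[OF D(2)]]])
      (use le in \<open>simp add: diff_le_0_iff_le\<close>)
  from fun_cong[OF this, of e] show ?thesis by simp
qed

text \<open>Maximality of |q| (exp (K \<phi>) - 1) with value 1 / a means that the reciprocal
  barrier touches |q| from above at \<open>x\<close>. All data are reduced to numbers at
  \<open>x\<close>, where \<open>touching\<close> yields the inequality that
  \<open>excludes_steep_maximum\<close> rules out.\<close>

lemma steep_maximum_bound:
  fixes p x :: "real \<times> real" and r b a K m M N v0 :: real
  assumes \<Omega>: "open \<Omega>" and lamC: "Ck_on 4 lam \<Omega>" and lam0: "\<And>y. y \<in> \<Omega> \<Longrightarrow> lam y > 0"
    and sol: "minimal_surface_solution lam \<Omega> u"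
    and excl: "excludes_steep_maximum m M N (2 / r + N) (2 / r\<^sup>2) b K v0"
    and r: "r > 0" and b: "0 < b" "b \<le> 1"
    and T: "open T" "x \<in> T" "T \<subseteq> \<Omega>" and xp: "dist x p \<le> r"
    and lamb: "m \<le> lam x" "lam x \<le> M"
    and LN: "\<And>e. norm e \<le> 1 \<Longrightarrow> \<bar>dd e (\<lambda>x. ln (lam x)) x\<bar> \<le> N"
      "\<And>e e'. norm e \<le> 1 \<Longrightarrow> norm e' \<le> 1 \<Longrightarrow> \<bar>dd e (dd e' (\<lambda>x. ln (lam x))) x\<bar> \<le> N"
      "\<And>e e' e''. norm e \<le> 1 \<Longrightarrow> norm e' \<le> 1 \<Longrightarrow> norm e'' \<le> 1 \<Longrightarrow>
        \<bar>dd e (dd e' (dd e'' (\<lambda>x. ln (lam x)))) x\<bar> \<le> N"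
    and a: "0 < a" "a \<le> 1"
  defines "\<phi> \<equiv> \<lambda>y. 1 - ((fst y - fst p)\<^sup>2 + (snd y - snd p)\<^sup>2) / r\<^sup>2 - b * u y"
  defines "X \<equiv> slope1 lam u (1, 0) (0, 1)" and "Y \<equiv> slope2 lam u (1, 0) (0, 1)"
  assumes kpos: "\<And>y. y \<in> T \<Longrightarrow> a * (exp (K * \<phi> y) - 1) > 0"
    and max: "\<And>y. y \<in> T \<Longrightarrow> sqrt ((X y)\<^sup>2 + (Y y)\<^sup>2) \<le> inverse (a * (exp (K * \<phi> y) - 1))"
      "sqrt ((X x)\<^sup>2 + (Y x)\<^sup>2) = inverse (a * (exp (K * \<phi> x) - 1))"
  shows "sqrt ((X x)\<^sup>2 + (Y x)\<^sup>2) < v0"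
proof (rule ccontr)
  define L where "L = (\<lambda>x. ln (lam x))"
  define z0 where "z0 y = inverse (a * (exp (K * \<phi> y) - 1))" for y
  define v where "v = sqrt ((X x)\<^sup>2 + (Y x)\<^sup>2)"
  assume "\<not> sqrt ((X x)\<^sup>2 + (Y x)\<^sup>2) < v0"
  then have vv0: "v0 \<le> v" by (simp add: v_def)
  have z0x: "z0 x = v" using max(2) by (simp add: z0_def v_def)
  have v: "v > 0" using kpos[OF T(2)] z0x by (simp only: z0_def positive_imp_inverse_positive flip: z0x)
  have v2: "v\<^sup>2 = (X x)\<^sup>2 + (Y x)\<^sup>2" by (simp add: v_def)
  \<comment> \<open>The frame is aligned with q at \<open>x\<close> and then held fixed, so
    \<open>Q1\<close> equals |q| and \<open>Q2\<close> vanishes at \<open>x\<close>.\<close>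
  define c where "c = X x / v"
  define s where "s = Y x / v"
  have cs: "c\<^sup>2 + s\<^sup>2 = 1" 
    unfolding c_def s_def power_divide add_divide_distrib[symmetric] v2[symmetric] using v by simp
  define e1 where "e1 = (c, s)"
  define e2 where "e2 = (- s, c)"
  have ne: "norm e1 \<le> 1" "norm e2 \<le> 1" using cs by (simp_all add: e1_def e2_def norm_Pair add.commute)
  have x\<Omega>: "x \<in> \<Omega>" using T by (metis subsetD)
  have T\<Omega>: "y \<in> \<Omega>" if "y \<in> T" for y using T(3) that by (metis subsetD)
  have lamT: "Ck_on 4 lam T" by (rule Ck_on_subset[OF lamC T(3)])
  have LT: "Ck_on 4 L T" unfolding L_def by (rule Ck_on_ln[OF T(1) lam0[OF T\<Omega>] lamT])
  have LT': "Ck_on j L T" if "j \<le> 4" for j by (rule Ck_on_le[OF LT that])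
  have L4: "Ck_on (Suc (Suc (Suc (Suc 0)))) L T" by (rule LT') simp
  have u2: "Ck_on 2 u T"
    using sol unfolding minimal_surface_solution_def by (metis Ck_on_subset T(3))
  have uT: "Ck_on (Suc (Suc 0)) u T" using u2 by (simp only: numeral_2_eq_2)
  have lamT1: "Ck_on 1 lam T" by (rule Ck_on_le[OF lamT]) simp
  have Dlam: "lam differentiable at y" if "y \<in> T" for y
    by (rule Ck_on_differentiable[OF Ck_on_le[OF lamT, of "Suc 0"] T(1) that]) simp
  have Du: "u differentiable at y" and DL: "L differentiable at y" if "y \<in> T" for y
    using Ck_on_differentiable[OF uT T(1) that] Ck_on_differentiable[OF L4 T(1) that] by simp_all
  have Ddu: "dd e u differentiable at y" and DdL: "dd e L differentiable at y" if "y \<in> T" for y e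
    using Ck_on_differentiable[OF Ck_on_dd[OF T(1) uT] T(1) that]
      Ck_on_differentiable[OF Ck_on_dd[OF T(1) L4] T(1) that] by simp_all
  have DddL: "dd e (dd e' L) differentiable at y" if "y \<in> T" for y e e'
    by (rule Ck_on_differentiable[OF Ck_on_dd[OF T(1) Ck_on_dd[OF T(1) L4]] T(1) that])
  define Q1 where "Q1 = slope1 lam u e1 e2"
  define Q2 where "Q2 = slope2 lam u e1 e2"
  have Q1': "Q1 = (\<lambda>y. dd e1 u y - dd e2 L y)" and Q2': "Q2 = (\<lambda>y. dd e2 u y + dd e1 L y)"
    by (simp_all add: Q1_def Q2_def slope1_def[abs_def] slope2_def[abs_def] L_def)
  have fr: "Q1 y = c * X y + s * Y y" "Q2 y = - s * X y + c * Y y" if "y \<in> T" for y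
    using slope_rotate[OF Du[OF that] DL[OF that, unfolded L_def], of c s]
    by (simp_all add: e1_def e2_def X_def Y_def Q1_def Q2_def)
  have Q1x: "Q1 x = v"
  proof -
    have "Q1 x = ((X x)\<^sup>2 + (Y x)\<^sup>2) / v"
      unfolding fr(1)[OF T(2)] by (simp add: c_def s_def power2_eq_square add_divide_distrib)
    also have "\<dots> = v" using v unfolding v2[symmetric] by (simp add: power2_eq_square)
    finally show ?thesis .
  qed
  have Q2x: "Q2 x = 0" unfolding fr(2)[OF T(2)] by (simp add: c_def s_def)
  \<comment> \<open>The norm is replaced by a component in a fixed direction: \<open>Q1\<close> lies
    below |q| everywhere and agrees with it at \<open>x\<close>, so the barrier touches
    \<open>Q1\<close> too. Unlike |q|, \<open>Q1\<close> is linear in the gradient of u, as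
    \<open>touching\<close> requires.\<close>
  have Q1le: "Q1 y \<le> z0 y" if "y \<in> T" for y
  proof -
    have "(Q1 y)\<^sup>2 + (Q2 y)\<^sup>2 = (X y)\<^sup>2 + (Y y)\<^sup>2" unfolding fr[OF that] by (rule frame_norm[OF cs])
    then have "(Q1 y)\<^sup>2 \<le> (X y)\<^sup>2 + (Y y)\<^sup>2" using zero_le_power2[of "Q2 y"] by linarith
    then have "Q1 y \<le> sqrt ((X y)\<^sup>2 + (Y y)\<^sup>2)" by (rule real_le_rsqrt)
    also have "\<dots> \<le> z0 y" unfolding z0_def by (rule max(1)[OF that])
    finally show ?thesis .
  qed
  note cut = cutoff_derivatives[OF T(1,2) u2, where p = p and r = r and b = b, folded \<phi>_def]
  have z0': "z0 = (\<lambda>y. inverse (a * (exp (K * \<phi> y) - 1)))" by (rule ext) (rule z0_def)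
  have z0C: "Ck_on 2 z0 T"
    unfolding z0' by (rule reciprocal_barrier(1)[OF T(1,2) cut(1) kpos])
  have bar1: "dd e z0 x = - (K * (z0 x + a * (z0 x)\<^sup>2)) * dd e \<phi> x" for e
    unfolding z0' by (rule reciprocal_barrier(2)[OF T(1,2) cut(1) kpos])
  have bar2: "dd e (dd e' z0) x = K\<^sup>2 * (z0 x + a * (z0 x)\<^sup>2) * (1 + 2 * a * z0 x) * dd e \<phi> x * dd e' \<phi> x
      - K * (z0 x + a * (z0 x)\<^sup>2) * dd e (dd e' \<phi>) x" for e e'
    unfolding z0' by (rule reciprocal_barrier(3)[OF T(1,2) cut(1) kpos])
  have z02: "Ck_on (Suc (Suc 0)) z0 T" using z0C by (simp only: numeral_2_eq_2)
  have Dz0: "z0 differentiable at y" and Ddz0: "dd e z0 differentiable at y" if "y \<in> T" for y e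
    using Ck_on_differentiable[OF z02 T(1) that]
      Ck_on_differentiable[OF Ck_on_dd[OF T(1) z02] T(1) that] by simp_all
  \<comment> \<open>Moving the L-term of \<open>Q1\<close> to the other side leaves a pure
    derivative of u to be touched.\<close>
  define z where "z y = z0 y + dd e2 L y" for y
  have zC: "Ck_on 2 z T" unfolding z_def
    by (intro Ck_on_add z0C T(1) Ck_on_dd) (rule LT', simp)
  have z1: "dd e z y = dd e z0 y + dd e (dd e2 L) y" if "y \<in> T" for y e
    unfolding z_def by (rule dd_add[OF Dz0[OF that] DdL[OF that]])
  have z2: "dd e (dd e' z) x = dd e (dd e' z0) x + dd e (dd e' (dd e2 L)) x" for e e'
  proof -
    have "dd e (dd e' z) x = dd e (\<lambda>y. dd e' z0 y + dd e' (dd e2 L) y) x"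
      by (rule dd_cong[OF T(1,2)]) (rule z1)
    then show ?thesis by (simp only: dd_add[OF Ddz0[OF T(2)] DddL[OF T(2)]])
  qed
  have touch: "dd e1 u y \<le> z y" if "y \<in> T" for y
    using Q1le[OF that] by (simp add: Q1' z_def)
  have touchx: "dd e1 u x = z x" using Q1x z0x by (simp add: Q1' z_def)
  \<comment> \<open>First-order conditions at the touching point. In the directions
    \<open>e1\<close> and \<open>e2\<close> they give \<open>u11\<close> and \<open>u12\<close>; the
    equation will supply \<open>u22\<close>.\<close>
  have grad: "dd e (dd e1 u) x = dd e z0 x + dd e (dd e2 L) x" for e
    unfolding z1[OF T(2), symmetric]
  proof (rule dd_eq_at_touching[OF T(1,2) Ddu[OF T(2)] _ touch touchx])
    show "z differentiable at x"
      unfolding z_def by (intro differentiable_add Dz0 DdL T(2))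
  qed
  define L1 where "L1 = dd e1 L x"
  define L2 where "L2 = dd e2 L x"
  define L11 where "L11 = dd e1 (dd e1 L) x"
  define L12 where "L12 = dd e1 (dd e2 L) x"
  define L22 where "L22 = dd e2 (dd e2 L) x"
  define L112 where "L112 = dd e1 (dd e1 (dd e2 L)) x"
  define L222 where "L222 = dd e2 (dd e2 (dd e2 L)) x"
  define u11 where "u11 = dd e1 (dd e1 u) x"
  define u12 where "u12 = dd e1 (dd e2 u) x"
  define u22 where "u22 = dd e2 (dd e2 u) x"
  define l where "l = lam x"
  define \<tau> where "\<tau> = K * (1 / v + a)"
  define \<rho> where "\<rho> = 2 / r\<^sup>2"
  define i1 where "i1 = 2 * ((fst x - fst p) * fst e1 + (snd x - snd p) * snd e1) / r\<^sup>2"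
  define i2 where "i2 = 2 * ((fst x - fst p) * fst e2 + (snd x - snd p) * snd e2) / r\<^sup>2"
  define s1 where "s1 = - i1 - b * L2"
  define s2 where "s2 = - i2 + b * L1"
  have i_le: "\<bar>2 * ((fst x - fst p) * fst e + (snd x - snd p) * snd e) / r\<^sup>2\<bar> \<le> 2 / r" if "norm e \<le> 1" for e
  proof -
    have "\<bar>(fst x - fst p) * fst e + (snd x - snd p) * snd e\<bar> = \<bar>inner (x - p) e\<bar>"
      by (simp add: inner_prod_def)
    also have "\<dots> \<le> norm (x - p) * norm e" by (rule Cauchy_Schwarz_ineq2)
    also have "\<dots> \<le> r * 1" using xp that r by (intro mult_mono) (auto simp: dist_norm)
    finally have "2 * \<bar>(fst x - fst p) * fst e + (snd x - snd p) * snd e\<bar> / r\<^sup>2 \<le> 2 * r / r\<^sup>2"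
      by (intro divide_right_mono) auto
    also have "2 * r / r\<^sup>2 = 2 / r" using r by (simp add: power2_eq_square)
    finally show ?thesis by (simp add: abs_mult del: distrib_left_numeral)
  qed
  have bL: "\<bar>b * dd e L x\<bar> \<le> 1 * N" if "norm e \<le> 1" for e
    by (rule abs_mult_le) (use b LN(1)[OF that] in \<open>simp_all add: L_def\<close>)
  have s1: "\<bar>s1\<bar> \<le> 2 / r + N" and s2: "\<bar>s2\<bar> \<le> 2 / r + N"
    using i_le[OF ne(1)] i_le[OF ne(2)] bL[OF ne(1)] bL[OF ne(2)]
    unfolding s1_def s2_def i1_def[symmetric] i2_def[symmetric] L1_def[symmetric] L2_def[symmetric]
    by linarith+
  have u1x: "dd e1 u x = v + L2" using Q1x by (simp add: Q1' L2_def)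
  have u2x: "dd e2 u x = - L1" using Q2x by (simp add: Q2' L1_def)
  have \<phi>1: "dd e1 \<phi> x = s1 - b * v"
    unfolding cut(2)[of e1] u1x i1_def[symmetric] s1_def by (simp add: algebra_simps)
  have \<phi>2: "dd e2 \<phi> x = s2"
    unfolding cut(2)[of e2] u2x i2_def[symmetric] s2_def by (simp add: algebra_simps)
  have e_sq: "fst e1 * fst e1 + snd e1 * snd e1 = 1" "fst e2 * fst e2 + snd e2 * snd e2 = 1"
    using cs by (simp_all add: e1_def e2_def power2_eq_square add.commute)
  have \<phi>11: "dd e1 (dd e1 \<phi>) x = - \<rho> - b * u11" and \<phi>22: "dd e2 (dd e2 \<phi>) x = - \<rho> - b * u22"
    unfolding cut(3) e_sq \<rho>_def u11_def u22_def by simp_all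
  \<comment> \<open>With z = v at \<open>x\<close>, v \<tau> is the factor K (1 + a v) of the
    logarithmic slope of the barrier. The identities translate the formulas of
    \<open>reciprocal_barrier\<close> into the variables of
    \<open>curvature_inequality\<close>.\<close>
  have \<tau>1: "K * (v + a * v\<^sup>2) = v\<^sup>2 * \<tau>"
    using v by (simp add: \<tau>_def field_simps power2_eq_square)
  have \<tau>2: "K\<^sup>2 * (v + a * v\<^sup>2) * (1 + 2 * a * v) = 2 * \<tau>\<^sup>2 * v^3 - K * \<tau> * v\<^sup>2"
    using v by (simp add: \<tau>_def field_simps power2_eq_square power3_eq_cube)
  have z01: "dd e1 z0 x = - (v\<^sup>2 * \<tau>) * (s1 - b * v)" "dd e2 z0 x = - (v\<^sup>2 * \<tau>) * s2"
    using bar1[of e1] bar1[of e2] unfolding z0x \<tau>1 \<phi>1 \<phi>2 .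
  have z011: "dd e1 (dd e1 z0) x = - (v\<^sup>2 * \<tau>) * (- \<rho> - b * u11) + (2 * \<tau>\<^sup>2 * v^3 - K * \<tau> * v\<^sup>2) * (s1 - b * v)\<^sup>2"
    and z022: "dd e2 (dd e2 z0) x = - (v\<^sup>2 * \<tau>) * (- \<rho> - b * u22) + (2 * \<tau>\<^sup>2 * v^3 - K * \<tau> * v\<^sup>2) * s2\<^sup>2"
    using bar2[of e1 e1] bar2[of e2 e2] unfolding z0x \<tau>1 \<tau>2 \<phi>1 \<phi>2 \<phi>11 \<phi>22
    by (simp_all add: power2_eq_square algebra_simps)
  have U11: "u11 = - (v\<^sup>2 * \<tau>) * (s1 - b * v) + L12"
    using grad[of e1] unfolding u11_def L12_def z01 .
  have cu: "dd e2 (dd e1 u) x = u12" unfolding u12_def by (rule dd_commute[OF T(1,2) u2])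
  have U12: "u12 = - (v\<^sup>2 * \<tau>) * s2 + L22"
    using grad[of e2] unfolding cu L22_def z01 .
  have cL: "dd e2 (dd e1 L) x = L12" unfolding L12_def by (rule dd_commute[OF T(1,2)]) (rule LT', simp)
  define A11 where "A11 y = (lam y)\<^sup>2 + (Q2 y)\<^sup>2" for y
  define A12 where "A12 y = - (Q1 y * Q2 y)" for y
  define A22 where "A22 y = (lam y)\<^sup>2 + (Q1 y)\<^sup>2" for y
  define B where "B y = ((Q1 y)\<^sup>2 - (Q2 y)\<^sup>2) * dd e1 (dd e2 L) y
      + Q1 y * Q2 y * (dd e2 (dd e2 L) y - dd e1 (dd e1 L) y)
      + ((Q1 y)\<^sup>2 + (Q2 y)\<^sup>2) * (Q1 y * dd e1 L y + Q2 y * dd e2 L y)" for y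
  have eq: "A11 y * dd e1 (dd e1 u) y + 2 * A12 y * dd e1 (dd e2 u) y + A22 y * dd e2 (dd e2 u) y + B y = 0"
    if "y \<in> T" for y
    using frame_equation[OF cs \<Omega> T\<Omega>[OF that] lamC lam0 sol]
    unfolding A11_def A12_def A22_def B_def Q1_def Q2_def e1_def e2_def L_def .
  have LTC: "Ck_on 2 L T" "Ck_on 3 L T" by (rule LT', simp)+
  have QC: "Ck_on 1 Q1 T" "Ck_on 1 Q2 T"
    unfolding Q1' Q2' using uT LTC(1)
    by (intro Ck_on_diff Ck_on_add T(1) Ck_on_dd; simp only: numeral_2_eq_2 One_nat_def)+
  have ddLC: "Ck_on 1 (dd e L) T" "Ck_on 1 (dd e (dd e' L)) T" for e e'
    using LTC by (intro Ck_on_dd T(1); simp only: numeral_2_eq_2 numeral_3_eq_3 One_nat_def)+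
  have AC: "Ck_on 1 A11 T" "Ck_on 1 A12 T" "Ck_on 1 A22 T" "Ck_on 1 B T"
    unfolding A11_def A12_def A22_def B_def
    by (intro Ck_on_add Ck_on_diff Ck_on_mult Ck_on_uminus Ck_on_power T(1) QC ddLC lamT1)+
  have psd: "A11 y > 0" "(A12 y)\<^sup>2 \<le> A11 y * A22 y" if "y \<in> T" for y
  proof -
    have l0: "lam y > 0" by (rule lam0[OF T\<Omega>[OF that]])
    show "A11 y > 0" using l0 by (simp add: A11_def add_pos_nonneg)
    have "A11 y * A22 y - (A12 y)\<^sup>2 = (lam y)\<^sup>2 * ((lam y)\<^sup>2 + (Q1 y)\<^sup>2 + (Q2 y)\<^sup>2)"
      by (simp add: A11_def A12_def A22_def power2_eq_square algebra_simps)
    also have "\<dots> \<ge> 0" by simp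
    finally show "(A12 y)\<^sup>2 \<le> A11 y * A22 y" by simp
  qed
  note main = touching[OF T(1,2) u2 zC AC eq psd touchx touch]
  have DQ: "Q1 differentiable at x" "Q2 differentiable at x"
    using Ck_on_differentiable[OF QC(1)[unfolded One_nat_def] T(1,2)]
      Ck_on_differentiable[OF QC(2)[unfolded One_nat_def] T(1,2)] by simp_all
  have dQ1: "dd e1 Q1 x = - (v\<^sup>2 * \<tau>) * (s1 - b * v)"
    unfolding Q1' dd_diff[OF Ddu[OF T(2)] DdL[OF T(2)]] using U11
    by (simp add: u11_def[symmetric] L12_def[symmetric])
  have dQ2: "dd e1 Q2 x = u12 + L11"
    unfolding Q2' dd_add[OF Ddu[OF T(2)] DdL[OF T(2)]] by (simp add: u12_def L11_def)
  have dlam: "dd e1 lam x = l * L1"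
    unfolding L1_def L_def dd_ln(1)[OF Dlam[OF T(2)] lam0[OF x\<Omega>]] l_def
    using lam0[OF x\<Omega>] by simp
  note dx = Dlam[OF T(2)] DQ DdL[OF T(2)] DddL[OF T(2)]
  have dA11: "dd e1 A11 x = 2 * l\<^sup>2 * L1"
    unfolding A11_def by (simp add: dd_add dd_power2 dx dlam Q2x l_def[symmetric]) (simp add: power2_eq_square)
  have dA12: "dd e1 A12 x = - (v * (u12 + L11))"
    unfolding A12_def by (simp add: dd_uminus dd_mult dx dQ2 Q2x Q1x)
  have dA22: "dd e1 A22 x = 2 * l\<^sup>2 * L1 + 2 * v * (- (v\<^sup>2 * \<tau>) * (s1 - b * v))"
    unfolding A22_def by (simp add: dd_add dd_power2 dx dlam dQ1 Q1x l_def[symmetric]) (simp add: power2_eq_square)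
  have dB: "dd e1 B x = 2 * v * (- (v\<^sup>2 * \<tau>) * (s1 - b * v)) * L12 + v\<^sup>2 * L112 + v * (u12 + L11) * (L22 - L11)
      + 2 * v * (- (v\<^sup>2 * \<tau>) * (s1 - b * v)) * (v * L1)
      + v\<^sup>2 * (- (v\<^sup>2 * \<tau>) * (s1 - b * v) * L1 + v * L11 + (u12 + L11) * L2)"
    unfolding B_def
    by (simp add: dd_add dd_diff dd_mult dd_power2 dx dQ1 dQ2 Q1x Q2x L1_def[symmetric] L2_def[symmetric]
        L11_def[symmetric] L12_def[symmetric] L22_def[symmetric] L112_def[symmetric])
  have A0: "A11 x = l\<^sup>2" "A12 x = 0" "A22 x = l\<^sup>2 + v\<^sup>2"
    by (simp_all add: A11_def A12_def A22_def Q1x Q2x l_def)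
  have eqx: "l\<^sup>2 * u11 + (l\<^sup>2 + v\<^sup>2) * u22 + v^3 * L1 + v\<^sup>2 * L12 = 0"
    using eq[OF T(2)] unfolding A0 B_def Q1x Q2x u11_def u22_def L1_def L12_def
    by (simp add: power2_eq_square power3_eq_cube algebra_simps)
  have ineq: "- (2 * l\<^sup>2 * L1 * u11 + 2 * (- (v * (u12 + L11))) * u12
      + (2 * l\<^sup>2 * L1 + 2 * v * (- (v\<^sup>2 * \<tau>) * (s1 - b * v))) * u22
      + (2 * v * (- (v\<^sup>2 * \<tau>) * (s1 - b * v)) * L12 + v\<^sup>2 * L112 + v * (u12 + L11) * (L22 - L11)
        + 2 * v * (- (v\<^sup>2 * \<tau>) * (s1 - b * v)) * (v * L1)
        + v\<^sup>2 * (- (v\<^sup>2 * \<tau>) * (s1 - b * v) * L1 + v * L11 + (u12 + L11) * L2)))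
    \<le> l\<^sup>2 * (- (v\<^sup>2 * \<tau>) * (- \<rho> - b * u11) + (2 * \<tau>\<^sup>2 * v^3 - K * \<tau> * v\<^sup>2) * (s1 - b * v)\<^sup>2 + L112)
      + (l\<^sup>2 + v\<^sup>2) * (- (v\<^sup>2 * \<tau>) * (- \<rho> - b * u22) + (2 * \<tau>\<^sup>2 * v^3 - K * \<tau> * v\<^sup>2) * s2\<^sup>2 + L222)"
    using main unfolding dA11 dA12 dA22 dB A0 z2 z011 z022 u11_def[symmetric] u12_def[symmetric]
      u22_def[symmetric] L112_def[symmetric] L222_def[symmetric] by simp
  have LN': "\<bar>L1\<bar> \<le> N" "\<bar>L2\<bar> \<le> N" "\<bar>L11\<bar> \<le> N" "\<bar>L12\<bar> \<le> N" "\<bar>L22\<bar> \<le> N" "\<bar>L112\<bar> \<le> N" "\<bar>L222\<bar> \<le> N"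
    unfolding L1_def L2_def L11_def L12_def L22_def L112_def L222_def L_def
    by (intro LN ne)+
  have "0 \<le> \<rho>" "\<rho> \<le> 2 / r\<^sup>2" by (simp_all add: \<rho>_def)
  from excl[unfolded excludes_steep_maximum_def, rule_format, OF lamb[folded l_def] vv0 a this s1 s2 LN' \<tau>_def U11 U12 eqx]
  show False using ineq by linarith
qed

text \<open>The existential stands before \<open>lam\<close>, \<Omega>, u and p: \<open>K\<close>
  and \<open>v0\<close> come from the bounds alone. The ball need only lie in \<Omega>, so no metric
  enters yet.\<close>

lemma interior_slope_bound:
  fixes m M N r h :: real
  assumes m: "m > 0" "M > 0" and N: "N \<ge> 0" and r: "r > 0" and h: "h \<ge> 0"
  shows "\<exists>C. \<forall>lam \<Omega> u p. open \<Omega> \<longrightarrow> Ck_on 4 lam \<Omega> \<longrightarrow> minimal_surface_solution lam \<Omega> u \<longrightarrow>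
    (\<forall>y\<in>\<Omega>. m \<le> lam y \<and> lam y \<le> M) \<longrightarrow> (\<forall>y\<in>\<Omega>. 0 \<le> u y) \<longrightarrow>
    (\<forall>y\<in>\<Omega>. \<forall>e e' e''. norm e \<le> 1 \<longrightarrow> norm e' \<le> 1 \<longrightarrow> norm e'' \<le> 1 \<longrightarrow>
      \<bar>dd e (\<lambda>x. ln (lam x)) y\<bar> \<le> N \<and> \<bar>dd e (dd e' (\<lambda>x. ln (lam x))) y\<bar> \<le> N \<and>
      \<bar>dd e (dd e' (dd e'' (\<lambda>x. ln (lam x)))) y\<bar> \<le> N) \<longrightarrow>
    cball p r \<subseteq> \<Omega> \<longrightarrow> u p = h \<longrightarrow>
    sqrt ((slope1 lam u (1, 0) (0, 1) p)\<^sup>2 + (slope2 lam u (1, 0) (0, 1) p)\<^sup>2) \<le> C"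
proof -
  \<comment> \<open>Chosen so that b u(p) <= 1/2 and hence \<phi>(p) >= 1/2, which makes the weight
    at \<open>p\<close> at least \<open>g0\<close>; also b <= 1, as
    \<open>gradient_constants\<close> requires.\<close>
  define b where "b = 1 / (2 * (h + 1))"
  have b: "0 < b" "b \<le> 1" using h by (simp_all add: b_def)
  have bh: "b * h \<le> 1 / 2" using h by (simp add: b_def field_simps)
  obtain K v0 where K: "K \<ge> 1" and v0: "v0 \<ge> 1"
    and excl: "excludes_steep_maximum m M N (2 / r + N) (2 / r\<^sup>2) b K v0"
    using gradient_constants[of m M N "2 / r + N" "2 / r\<^sup>2" b] m N r b by auto
  define g0 where "g0 = exp (K / 2) - 1"
  have g0: "g0 > 0" using K by (simp add: g0_def)
  \<comment> \<open>The bound arises from S(p) g0 <= S(p) g(p) <= S(x) g(x) at a maximum x, where S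
    = |q|. The last product is at most 1, or else S(x) < v0 and g(x) <= exp K.\<close>
  show ?thesis
  proof (intro exI[of _ "(1 + v0 * exp K) / g0"] allI impI)
    fix lam u :: "real \<times> real \<Rightarrow> real" and \<Omega> and p :: "real \<times> real"
    assume \<Omega>: "open \<Omega>" and lamC: "Ck_on 4 lam \<Omega>" and sol: "minimal_surface_solution lam \<Omega> u"
      and lamb: "\<forall>y\<in>\<Omega>. m \<le> lam y \<and> lam y \<le> M" and u0: "\<forall>y\<in>\<Omega>. 0 \<le> u y"
      and LN: "\<forall>y\<in>\<Omega>. \<forall>e e' e''. norm e \<le> 1 \<longrightarrow> norm e' \<le> 1 \<longrightarrow> norm e'' \<le> 1 \<longrightarrow>
        \<bar>dd e (\<lambda>x. ln (lam x)) y\<bar> \<le> N \<and> \<bar>dd e (dd e' (\<lambda>x. ln (lam x))) y\<bar> \<le> N \<and>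
        \<bar>dd e (dd e' (dd e'' (\<lambda>x. ln (lam x)))) y\<bar> \<le> N"
      and ball: "cball p r \<subseteq> \<Omega>" and up: "u p = h"
    define X where "X = slope1 lam u (1, 0) (0, 1)"
    define Y where "Y = slope2 lam u (1, 0) (0, 1)"
    define \<phi> where "\<phi> = (\<lambda>y. 1 - ((fst y - fst p)\<^sup>2 + (snd y - snd p)\<^sup>2) / r\<^sup>2 - b * u y)"
    define g where "g y = exp (K * \<phi> y) - 1" for y
    define S where "S y = sqrt ((X y)\<^sup>2 + (Y y)\<^sup>2)" for y
    have lam0: "lam y > 0" if "y \<in> \<Omega>" for y using lamb m that by fastforce
    have u2: "Ck_on (Suc (Suc 0)) u \<Omega>"
      using sol unfolding minimal_surface_solution_def by (simp only: numeral_2_eq_2)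
    have L2: "Ck_on (Suc (Suc 0)) (\<lambda>x. ln (lam x)) \<Omega>"
      by (rule Ck_on_ln[OF \<Omega> lam0 Ck_on_le[OF lamC]]) simp_all
    have SC: "continuous_on \<Omega> S"
      unfolding S_def X_def Y_def
      by (intro continuous_intros Ck_on_continuous_on[OF Ck_on_slope(1)[OF \<Omega> u2 L2]]
          Ck_on_continuous_on[OF Ck_on_slope(2)[OF \<Omega> u2 L2]])
    have \<phi>C: "continuous_on \<Omega> \<phi>"
      unfolding \<phi>_def using r by (intro continuous_intros Ck_on_continuous_on[OF u2]) auto
    have gC: "continuous_on \<Omega> g" unfolding g_def by (intro continuous_intros \<phi>C)
    have "\<exists>x\<in>cball p r. \<forall>y\<in>cball p r. S y * g y \<le> S x * g x"
      by (rule continuous_attains_sup)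
        (use r continuous_on_subset[OF continuous_on_mult[OF SC gC] ball] in auto)
    then obtain x where x: "x \<in> cball p r" and xmax: "\<And>y. y \<in> cball p r \<Longrightarrow> S y * g y \<le> S x * g x"
      by auto
    have pp: "p \<in> cball p r" using r by simp
    have "\<phi> p \<ge> 1 / 2" using bh up by (simp add: \<phi>_def)
    then have "K / 2 \<le> K * \<phi> p" using K by simp
    then have gp: "g0 \<le> g p" by (simp add: g_def g0_def)
    have S0: "S y \<ge> 0" for y by (simp add: S_def)
    have dist2: "(fst y - fst p)\<^sup>2 + (snd y - snd p)\<^sup>2 = (dist y p)\<^sup>2" for y
      by (simp add: dist_prod_def dist_real_def)
    have \<phi>le: "\<phi> y \<le> 1 - (dist y p)\<^sup>2 / r\<^sup>2" if "y \<in> \<Omega>" for y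
      using u0 that b unfolding \<phi>_def dist2 by simp
    have "S x * g x \<le> 1 + v0 * exp K"
    \<comment> \<open>If the maximal value exceeds 1, its reciprocal \<open>a\<close> lies in (0,
      1], as the steepness argument requires. Otherwise the value itself is a sufficient
      bound.\<close>
    proof (cases "S x * g x \<le> 1")
      case True
      have "0 \<le> v0 * exp K" using v0 by simp
      then show ?thesis using True by linarith
    next
      case False
      then have big: "S x * g x > 1" by simp
      then have gx: "g x > 0" using S0[of x] by (metis less_trans mult_nonneg_nonpos not_le zero_less_one)
      define a where "a = 1 / (S x * g x)"
      have a: "0 < a" "a \<le> 1" using big by (simp_all add: a_def)
      define T where "T = {y \<in> ball p r. \<phi> y > 0}"
      have bS: "ball p r \<subseteq> \<Omega>" using ball by (meson ball_subset_cball order_trans)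
      have "T = ball p r \<inter> \<phi> -` {0<..}" by (auto simp: T_def)
      then have T: "open T"
        using continuous_open_preimage[OF continuous_on_subset[OF \<phi>C bS] open_ball open_greaterThan] by simp
      have \<phi>x: "\<phi> x > 0" using gx K by (simp add: g_def zero_less_mult_iff)
      \<comment> \<open>Positivity of \<phi> at the maximum, combined with u >= 0, excludes the
        bounding sphere.\<close>
      have "dist x p < r"
      proof -
        have "(dist x p)\<^sup>2 / r\<^sup>2 < 1" using \<phi>x \<phi>le[of x] x ball by auto
        then have "(dist x p)\<^sup>2 < r\<^sup>2" using r by simp
        then show ?thesis using r by (simp add: power2_less_imp_less)
      qed
      then have xT: "x \<in> T" using \<phi>x by (simp add: T_def dist_commute)
      have T\<Omega>: "T \<subseteq> \<Omega>" using bS by (auto simp: T_def)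
      have kpos: "a * (exp (K * \<phi> y) - 1) > 0" if "y \<in> T" for y
        using that a K by (simp add: T_def)
      have "S x < v0" unfolding S_def X_def Y_def
      proof (rule steep_maximum_bound[OF \<Omega> lamC lam0 sol excl r b T xT T\<Omega> _ _ _ _ _ _ a(1,2)])
        have x\<Omega>: "x \<in> \<Omega>" using xT T\<Omega> by (rule subsetD[rotated])
        show "dist x p \<le> r" using x by (simp add: dist_commute)
        show "m \<le> lam x" "lam x \<le> M" using lamb x\<Omega> by auto
        show "\<bar>dd e (\<lambda>x. ln (lam x)) x\<bar> \<le> N" if "norm e \<le> 1" for e
          by (rule conjunct1[OF LN[rule_format, OF x\<Omega> that that that]])
        show "\<bar>dd e (dd e' (\<lambda>x. ln (lam x))) x\<bar> \<le> N" if "norm e \<le> 1" "norm e' \<le> 1" for e e'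
          by (rule conjunct1[OF conjunct2[OF LN[rule_format, OF x\<Omega> that that(1)]]])
        show "\<bar>dd e (dd e' (dd e'' (\<lambda>x. ln (lam x)))) x\<bar> \<le> N"
          if "norm e \<le> 1" "norm e' \<le> 1" "norm e'' \<le> 1" for e e' e''
          by (rule conjunct2[OF conjunct2[OF LN[rule_format, OF x\<Omega> that]]])
        show "0 < a * (exp (K * (1 - ((fst y - fst p)\<^sup>2 + (snd y - snd p)\<^sup>2) / r\<^sup>2 - b * u y)) - 1)"
          if "y \<in> T" for y using kpos[OF that] by (simp add: \<phi>_def)
        show "sqrt ((slope1 lam u (1, 0) (0, 1) y)\<^sup>2 + (slope2 lam u (1, 0) (0, 1) y)\<^sup>2)
            \<le> inverse (a * (exp (K * (1 - ((fst y - fst p)\<^sup>2 + (snd y - snd p)\<^sup>2) / r\<^sup>2 - b * u y)) - 1))"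
          if "y \<in> T" for y
        proof -
          have gy: "g y > 0" using kpos[OF that] a by (simp add: g_def zero_less_mult_iff)
          have "S y * g y \<le> S x * g x" using xmax that by (auto simp: T_def)
          then have "S y \<le> inverse (a * g y)" using gy by (simp add: a_def field_simps)
          then show ?thesis by (simp add: S_def X_def Y_def g_def \<phi>_def)
        qed
        have "S x = inverse (a * g x)" using gx by (simp add: a_def)
        then show "sqrt ((slope1 lam u (1, 0) (0, 1) x)\<^sup>2 + (slope2 lam u (1, 0) (0, 1) x)\<^sup>2)
            = inverse (a * (exp (K * (1 - ((fst x - fst p)\<^sup>2 + (snd x - snd p)\<^sup>2) / r\<^sup>2 - b * u x)) - 1))"
          by (simp add: S_def X_def Y_def g_def \<phi>_def)
      qed
      moreover have "g x \<le> exp K"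
      proof -
        have "0 \<le> (dist x p)\<^sup>2 / r\<^sup>2" by simp
        then have "\<phi> x \<le> 1" using \<phi>le[OF subsetD[OF T\<Omega> xT]] by linarith
        then have "K * \<phi> x \<le> K" using K by simp
        then have "exp (K * \<phi> x) \<le> exp K" by simp
        then show ?thesis unfolding g_def by linarith
      qed
      ultimately have "S x * g x \<le> v0 * exp K"
        using S0[of x] gx by (intro mult_mono) auto
      then show ?thesis by simp
    qed
    then have "S p * g p \<le> 1 + v0 * exp K" using xmax[OF pp] by simp
    moreover have "S p * g0 \<le> S p * g p" using gp S0[of p] by (intro mult_left_mono)
    ultimately have "S p \<le> (1 + v0 * exp K) / g0" using g0 by (simp add: pos_le_divide_eq)
    then show "sqrt ((slope1 lam u (1, 0) (0, 1) p)\<^sup>2 + (slope2 lam u (1, 0) (0, 1) p)\<^sup>2) \<le> (1 + v0 * exp K) / g0"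
      by (simp add: S_def X_def Y_def)
  qed
qed

section \<open>Derivatives of the logarithm of the conformal factor\<close>

lemma abs_dd_le:
  assumes "f differentiable at x" "norm e \<le> 1" "\<bar>pdx f x\<bar> \<le> B" "\<bar>pdy f x\<bar> \<le> B"
  shows "\<bar>dd e f x\<bar> \<le> 2 * B"
proof -
  have "\<bar>fst e\<bar> \<le> 1" "\<bar>snd e\<bar> \<le> 1"
    using assms(2) norm_fst_le[of "fst e" "snd e"] norm_snd_le[of "snd e" "fst e"] by simp_all
  then have "\<bar>fst e * pdx f x\<bar> \<le> 1 * B" "\<bar>snd e * pdy f x\<bar> \<le> 1 * B"
    using assms by (intro abs_mult_le; simp)+
  then show ?thesis unfolding dd_pd[OF assms(1)] by linarith
qed

text \<open>The hypotheses contain only partials with the x-derivatives outermost, the form in which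
  \<open>bounds_on\<close> supplies them. The remaining order follows from symmetry of second
  derivatives.\<close>

lemma abs_dd_dd_le:
  assumes S: "open S" "x \<in> S" and C: "Ck_on 2 f S" and e: "norm e \<le> 1" "norm e' \<le> 1"
    and B: "\<bar>pdx (pdx f) x\<bar> \<le> B" "\<bar>pdx (pdy f) x\<bar> \<le> B" "\<bar>pdy (pdy f) x\<bar> \<le> B"
  shows "\<bar>dd e (dd e' f) x\<bar> \<le> 4 * B"
proof -
  have C2: "Ck_on (Suc (Suc 0)) f S" using C by (simp only: numeral_2_eq_2)
  have D: "dd a f differentiable at x" for a
    by (rule Ck_on_differentiable[OF Ck_on_dd[OF S(1) C2] S])
  have B': "\<bar>pdy (pdx f) x\<bar> \<le> B"
    using B(2) unfolding pdx_eq_dd pdy_eq_dd dd_commute[OF S C, of "(0, 1)"] .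
  have "\<bar>dd e' (pdx f) x\<bar> \<le> 2 * B" "\<bar>dd e' (pdy f) x\<bar> \<le> 2 * B"
    using abs_dd_le[OF D[of "(1, 0)", folded pdx_eq_dd] e(2) B(1) B']
      abs_dd_le[OF D[of "(0, 1)", folded pdy_eq_dd] e(2) B(2,3)] .
  then have "\<bar>pdx (dd e' f) x\<bar> \<le> 2 * B" "\<bar>pdy (dd e' f) x\<bar> \<le> 2 * B"
    unfolding pdx_eq_dd pdy_eq_dd using dd_commute[OF S C, of e'] by simp_all
  from abs_dd_le[OF D e(1) this] show ?thesis by simp
qed

lemma abs_dd_dd_dd_le:
  assumes S: "open S" "x \<in> S" and C: "Ck_on 3 f S" and e: "norm e \<le> 1" "norm e' \<le> 1" "norm e'' \<le> 1"
    and B: "\<bar>pdx (pdx (pdx f)) x\<bar> \<le> B" "\<bar>pdx (pdx (pdy f)) x\<bar> \<le> B" "\<bar>pdx (pdy (pdy f)) x\<bar> \<le> B"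
      "\<bar>pdy (pdy (pdy f)) x\<bar> \<le> B"
  shows "\<bar>dd e (dd e' (dd e'' f)) x\<bar> \<le> 8 * B"
proof -
  have C3: "Ck_on (Suc (Suc (Suc 0))) f S" using C by (simp only: numeral_3_eq_3)
  have C2: "Ck_on 2 f S" by (rule Ck_on_le[OF C]) simp
  have dC2: "Ck_on 2 (dd a f) S" for a using Ck_on_dd[OF S(1) C3] by (simp only: numeral_2_eq_2)
  have D: "dd a (dd b f) differentiable at x" for a b
    by (rule Ck_on_differentiable[OF Ck_on_dd[OF S(1) Ck_on_dd[OF S(1) C3]] S])
  \<comment> \<open>Cyclic permutations suffice: they move an axis direction innermost, so that the
    second-order bound applies to \<open>dd ?i f\<close> and \<open>dd ?j f\<close>.\<close>
  have comm: "dd a (dd b (dd c f)) x = dd b (dd c (dd a f)) x" for a b c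
  proof -
    have "dd a (dd b (dd c f)) x = dd b (dd a (dd c f)) x" by (rule dd_commute[OF S dC2])
    also have "\<dots> = dd b (dd c (dd a f)) x"
      by (rule dd_cong[OF S]) (rule dd_commute[OF S(1) _ C2])
    finally show ?thesis .
  qed
  let ?i = "(1, 0) :: real \<times> real" and ?j = "(0, 1) :: real \<times> real"
  note B = B[unfolded pdx_eq_dd pdy_eq_dd]
  have "\<bar>dd e' (dd e'' (dd ?i f)) x\<bar> \<le> 4 * B"
    by (rule abs_dd_dd_le[OF S dC2 e(2,3)], unfold pdx_eq_dd pdy_eq_dd)
      (simp_all only: comm[of ?i ?i ?j, symmetric] comm[of ?i ?j ?j, symmetric] B)
  moreover have "\<bar>dd e' (dd e'' (dd ?j f)) x\<bar> \<le> 4 * B"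
    by (rule abs_dd_dd_le[OF S dC2 e(2,3)], unfold pdx_eq_dd pdy_eq_dd) (rule B)+
  ultimately have "\<bar>pdx (dd e' (dd e'' f)) x\<bar> \<le> 4 * B" "\<bar>pdy (dd e' (dd e'' f)) x\<bar> \<le> 4 * B"
    unfolding pdx_eq_dd pdy_eq_dd comm[of ?i e' e''] comm[of ?j e' e''] .
  from abs_dd_le[OF D e(1) this] show ?thesis by simp
qed

text \<open>\<open>D\<close> covers all directional derivatives of \<open>lam\<close> of orders one
  to three, whose expansion into partials costs factors 2, 4 and 8. \<open>N\<close> reflects the
  third derivative of ln lam: one linear term, three quadratic terms, and a cubic term with
  coefficient 2, with a factor 1 / m for each division by \<open>lam\<close>. It exceeds the bounds
  for lower orders.\<close>

lemma ln_derivative_bounds: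
  assumes S: "open S" "x \<in> S" and C: "Ck_on 4 lam S" and lam0: "\<And>y. y \<in> S \<Longrightarrow> lam y > 0"
    and bd: "bounds_on lam S m M"
    and e: "norm e \<le> 1" "norm e' \<le> 1" "norm e'' \<le> 1"
  defines "D \<equiv> 8 * (M 1 + M 2 + M 3)"
  defines "N \<equiv> D * (1 / m) + 3 * (D * D * (1 / m) * (1 / m)) + 2 * (D * D * D * (1 / m) * (1 / m) * (1 / m))"
  shows "\<bar>dd e (\<lambda>y. ln (lam y)) x\<bar> \<le> N" "\<bar>dd e (dd e' (\<lambda>y. ln (lam y))) x\<bar> \<le> N"
    "\<bar>dd e (dd e' (dd e'' (\<lambda>y. ln (lam y)))) x\<bar> \<le> N"
proof -
  have m: "m > 0" "m \<le> lam x" using bd S(2) by (auto simp: bounds_on_def)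
  have pb: "\<bar>(pdx ^^ i) ((pdy ^^ j) lam) x\<bar> \<le> M (i + j)" for i j
    using bd S(2) unfolding bounds_on_def by metis
  have M0: "M 1 \<ge> 0" "M 2 \<ge> 0" "M 3 \<ge> 0"
    using pb[of 1 0] pb[of 2 0] pb[of 3 0] by (simp_all; metis abs_ge_zero order_trans)+
  have C3: "Ck_on 3 lam S" and C2: "Ck_on 2 lam S" by (rule Ck_on_le[OF C], simp)+
  have C': "Ck_on (Suc (Suc (Suc (Suc 0)))) lam S" by (rule Ck_on_le[OF C]) simp
  have Dl: "lam differentiable at y" "dd a lam differentiable at y" "dd a (dd b lam) differentiable at y"
    if "y \<in> S" for y a b
    using Ck_on_differentiable[OF C' S(1) that] Ck_on_differentiable[OF Ck_on_dd[OF S(1) C'] S(1) that]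
      Ck_on_differentiable[OF Ck_on_dd[OF S(1) Ck_on_dd[OF S(1) C']] S(1) that] by simp_all
  have b1: "\<bar>dd a lam x\<bar> \<le> D" if "norm a \<le> 1" for a
    using abs_dd_le[OF Dl(1)[OF S(2)] that, of "M 1"] pb[of 1 0] pb[of 0 1] M0
    by (simp add: D_def)
  have b2: "\<bar>dd a (dd b lam) x\<bar> \<le> D" if "norm a \<le> 1" "norm b \<le> 1" for a b
    using abs_dd_dd_le[OF S C2 that, of "M 2"] pb[of 2 0] pb[of 1 1] pb[of 0 2] M0
    by (simp add: D_def numeral_2_eq_2)
  have b3: "\<bar>dd a (dd b (dd c lam)) x\<bar> \<le> D" if "norm a \<le> 1" "norm b \<le> 1" "norm c \<le> 1" for a b c
    using abs_dd_dd_dd_le[OF S C3 that, of "M 3"] pb[of 3 0] pb[of 2 1] pb[of 1 2] pb[of 0 3] M0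
    by (simp add: D_def numeral_2_eq_2 numeral_3_eq_3)
  define w where "w y = inverse (lam y)" for y
  have lne: "lam y \<noteq> 0" if "y \<in> S" for y using lam0[OF that] by simp
  have dw: "dd a w y = - (w y * dd a lam y * w y)" and Dw: "w differentiable at y" if "y \<in> S" for a y
    using dd_eqI[OF Deriv.has_derivative_inverse[OF lne[OF that] has_derivative_dd[OF Dl(1)[OF that]]]]
      differentiableI[OF Deriv.has_derivative_inverse[OF lne[OF that] has_derivative_dd[OF Dl(1)[OF that]]]]
    by (simp_all add: w_def[abs_def])
  have wb: "\<bar>w x\<bar> \<le> 1 / m" using m by (simp add: w_def divide_inverse le_imp_inverse_le)
  have d1: "dd a (\<lambda>y. ln (lam y)) y = dd a lam y * w y" if "y \<in> S" for a y
    using dd_ln(1)[OF Dl(1)[OF that] lam0[OF that]] by (simp add: w_def divide_inverse)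
  have d2: "dd a (dd b (\<lambda>y. ln (lam y))) y = dd a (dd b lam) y * w y - dd b lam y * dd a lam y * w y * w y"
    if "y \<in> S" for a b y
  proof -
    have "dd a (dd b (\<lambda>y. ln (lam y))) y = dd a (\<lambda>y. dd b lam y * w y) y"
      by (rule dd_cong[OF S(1) that]) (rule d1)
    then show ?thesis
      by (simp add: dd_mult Dl[OF that] Dw[OF that] dw[OF that] algebra_simps)
  qed
  have d3: "dd a (dd b (dd c (\<lambda>y. ln (lam y)))) x = dd a (dd b (dd c lam)) x * w x
      - dd b (dd c lam) x * dd a lam x * w x * w x - dd a (dd c lam) x * dd b lam x * w x * w x
      - dd c lam x * dd a (dd b lam) x * w x * w x + 2 * (dd c lam x * dd b lam x * dd a lam x * w x * w x * w x)" for a b c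
  proof -
    have "dd a (dd b (dd c (\<lambda>y. ln (lam y)))) x
        = dd a (\<lambda>y. dd b (dd c lam) y * w y - dd c lam y * dd b lam y * w y * w y) x"
      by (rule dd_cong[OF S]) (rule d2)
    then show ?thesis
      by (simp add: dd_mult dd_diff Dl[OF S(2)] Dw[OF S(2)] dw[OF S(2)] algebra_simps)
  qed
  have D0: "D \<ge> 0" using M0 by (simp add: D_def)
  have nn: "0 \<le> D * (1 / m)" "0 \<le> D * D * (1 / m) * (1 / m)" "0 \<le> D * D * D * (1 / m) * (1 / m) * (1 / m)"
    using D0 m by simp_all
  show "\<bar>dd e (\<lambda>y. ln (lam y)) x\<bar> \<le> N"
    using abs_mult_le[OF b1[OF e(1)] wb] nn unfolding d1[OF S(2)] N_def by linarith
  show "\<bar>dd e (dd e' (\<lambda>y. ln (lam y))) x\<bar> \<le> N"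
    using abs_mult_le[OF b2[OF e(1,2)] wb]
      abs_mult_le[OF abs_mult_le[OF abs_mult_le[OF b1[OF e(2)] b1[OF e(1)]] wb] wb] nn
    unfolding d2[OF S(2)] N_def by linarith
  show "\<bar>dd e (dd e' (dd e'' (\<lambda>y. ln (lam y)))) x\<bar> \<le> N"
    using abs_mult_le[OF b3[OF e] wb]
      abs_mult_le[OF abs_mult_le[OF abs_mult_le[OF b2[OF e(2,3)] b1[OF e(1)]] wb] wb]
      abs_mult_le[OF abs_mult_le[OF abs_mult_le[OF b2[OF e(1,3)] b1[OF e(2)]] wb] wb]
      abs_mult_le[OF abs_mult_le[OF abs_mult_le[OF b1[OF e(3)] b2[OF e(1,2)]] wb] wb]
      abs_mult_le[OF abs_mult_le[OF abs_mult_le[OF abs_mult_le[OF abs_mult_le[OF b1[OF e(3)] b1[OF e(2)]] b1[OF e(1)]] wb] wb] wb]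
    unfolding d3 N_def by linarith
qed

section \<open>Lengths and the distance to the boundary\<close>

text \<open>The fundamental theorem of calculus for f along \<gamma>, with the integrand bounded by
  C times the metric speed. The bound on the derivative is required only up to time
  \<open>s\<close>, so a curve may be stopped where it leaves a region; the remaining length is
  nonnegative.\<close>

lemma length_lower_bound:
  fixes f :: "real \<times> real \<Rightarrow> 'b::banach"
  assumes \<gamma>: "\<gamma> C1_differentiable_on {0..1}" "path_image \<gamma> \<subseteq> D"
    and lam: "continuous_on D lam" "\<And>x. x \<in> D \<Longrightarrow> lam x > 0"
    and s: "0 \<le> s" "s \<le> 1" and C: "C \<ge> 0"
    and f: "\<And>t. 0 \<le> t \<Longrightarrow> t \<le> s \<Longrightarrow> (f has_derivative F t) (at (\<gamma> t))"
    and F: "\<And>t v. 0 \<le> t \<Longrightarrow> t \<le> s \<Longrightarrow> norm (F t v) \<le> C * (lam (\<gamma> t) * norm v)"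
  shows "norm (f (\<gamma> s) - f (\<gamma> 0)) \<le> C * metric_length lam \<gamma>"
proof -
  obtain V where V: "\<And>t. t \<in> {0..1} \<Longrightarrow> (\<gamma> has_vector_derivative V t) (at t)" and VC: "continuous_on {0..1} V"
    using \<gamma>(1) unfolding C1_differentiable_on_def by blast
  have \<gamma>D: "\<gamma> t \<in> D" if "t \<in> {0..1}" for t using \<gamma>(2) that by (auto simp: path_image_def)
  have \<gamma>C: "continuous_on {0..1} \<gamma>"
    using V by (meson continuous_at_imp_continuous_on has_vector_derivative_continuous)
  define g where "g t = lam (\<gamma> t) * norm (V t)" for t
  have gC: "continuous_on {0..1} g" unfolding g_def
    by (intro continuous_intros VC continuous_on_compose2[OF lam(1) \<gamma>C]) (use \<gamma>D in auto)
  have g0: "g t \<ge> 0" if "t \<in> {0..1}" for t using lam(2)[OF \<gamma>D[OF that]] by (simp add: g_def)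
  have len: "metric_length lam \<gamma> = integral {0..1} g"
    unfolding metric_length_def g_def
    by (rule integral_cong) (simp add: vector_derivative_at[OF V])
  have gi: "g integrable_on {0..1}" by (rule integrable_continuous_real[OF gC])
  have gis: "g integrable_on {0..s}"
    by (rule integrable_continuous_real, rule continuous_on_subset[OF gC]) (use s in auto)
  have I: "((\<lambda>t. F t (V t)) has_integral f (\<gamma> s) - f (\<gamma> 0)) {0..s}"
  proof (rule fundamental_theorem_of_calculus[OF s(1)])
    fix t assume t: "t \<in> {0..s}"
    then have "t \<in> {0..1}" using s by auto
    from vector_derivative_diff_chain_within[OF has_vector_derivative_at_within[OF V[OF this]], of f "F t" "{0..s}"]
    show "((\<lambda>t. f (\<gamma> t)) has_vector_derivative F t (V t)) (at t within {0..s})"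
      using f[of t] t by (simp add: o_def has_derivative_at_withinI)
  qed
  have "norm (f (\<gamma> s) - f (\<gamma> 0)) = norm (integral {0..s} (\<lambda>t. F t (V t)))"
    using integral_unique[OF I] by simp
  also have "\<dots> \<le> integral {0..s} (\<lambda>t. C * g t)"
  proof (rule Henstock_Kurzweil_Integration.integral_norm_bound_integral)
    show "(\<lambda>t. F t (V t)) integrable_on {0..s}" by (rule has_integral_integrable[OF I])
    show "(\<lambda>t. C * g t) integrable_on {0..s}"
      using integrable_cmul[OF gis, of C] by simp
    show "norm (F t (V t)) \<le> C * g t" if "t \<in> {0..s}" for t
      using F[of t "V t"] that by (simp add: g_def)
  qed
  also have "\<dots> = C * integral {0..s} g" by simp
  also have "\<dots> \<le> C * integral {0..1} g"
    by (rule mult_left_mono[OF integral_subset_le[OF _ gis gi] C]) (use s g0 in auto)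
  finally show ?thesis by (simp add: len)
qed

lemma metric_length_nonneg:
  assumes "\<gamma> C1_differentiable_on {0..1}" "path_image \<gamma> \<subseteq> D"
    and "continuous_on D lam" "\<And>x. x \<in> D \<Longrightarrow> lam x > 0"
  shows "0 \<le> metric_length lam \<gamma>"
  using length_lower_bound[OF assms, of 0 1 "\<lambda>_. 0::real" "\<lambda>_ _. 0"] assms(4)
    assms(2) by (simp add: path_image_def image_subset_iff less_imp_le)

text \<open>This keeps the set of lengths in \<open>metric_dist\<close> nonempty; an infimum over
  the empty set would carry no information. Polynomial paths are C^1 up to the endpoints.\<close>

lemma C1_path_exists:
  fixes D :: "(real \<times> real) set"
  assumes "open D" "connected D" "p \<in> D" "q \<in> D"
  shows "\<exists>\<gamma>. \<gamma> C1_differentiable_on {0..1} \<and> path_image \<gamma> \<subseteq> D \<and> pathstart \<gamma> = p \<and> pathfinish \<gamma> = q"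
proof -
  obtain g where g: "polynomial_function g" "path_image g \<subseteq> D" "pathstart g = p" "pathfinish g = q"
    using connected_open_polynomial_connected[OF assms] by metis
  obtain g' where g': "polynomial_function g'" "\<And>x. (g has_vector_derivative g' x) (at x)"
    using has_vector_derivative_polynomial_function[OF g(1)] by metis
  have "g C1_differentiable_on {0..1}"
    unfolding C1_differentiable_on_def using g'(2) continuous_on_polymonial_function[OF g'(1)] by blast
  then show ?thesis using g by blast
qed

lemma metric_dist_ge:
  fixes D :: "(real \<times> real) set"
  assumes D: "open D" "connected D" "p \<in> D" "q \<in> D"
    and "\<And>\<gamma>. \<gamma> C1_differentiable_on {0..1} \<Longrightarrow> path_image \<gamma> \<subseteq> D \<Longrightarrow> \<gamma> 0 = p \<Longrightarrow> \<gamma> 1 = q \<Longrightarrow> c \<le> metric_length lam \<gamma>"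
  shows "c \<le> metric_dist D lam p q"
  unfolding metric_dist_def
  by (rule cInf_greatest) (use C1_path_exists[OF D] assms(5) in \<open>auto simp: pathstart_def pathfinish_def\<close>)

lemma metric_dist_le:
  assumes lam: "continuous_on D lam" "\<And>x. x \<in> D \<Longrightarrow> lam x > 0"
    and "\<gamma> C1_differentiable_on {0..1}" "path_image \<gamma> \<subseteq> D" "\<gamma> 0 = p" "\<gamma> 1 = q"
  shows "metric_dist D lam p q \<le> metric_length lam \<gamma>"
  unfolding metric_dist_def
proof (rule cInf_lower)
  show "bdd_below {metric_length lam \<gamma> |\<gamma>. \<gamma> C1_differentiable_on {0..1} \<and> path_image \<gamma> \<subseteq> D \<and> pathstart \<gamma> = p \<and> pathfinish \<gamma> = q}"
    by (rule bdd_belowI[of _ 0]) (use metric_length_nonneg[OF _ _ lam] in auto)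
qed (use assms(3-) in \<open>auto simp: pathstart_def pathfinish_def\<close>)

section \<open>The half-plane chart, unboundedness and completeness\<close>

lemma hyperbolic_chart:
  assumes "hyperbolic_coordinates D lam"
  obtains X g where "open D" "connected D" "Ck_on 4 lam D" "\<And>x. x \<in> D \<Longrightarrow> lam x > 0"
    "\<And>x. x \<in> D \<Longrightarrow> snd (X x) > 0" "\<And>x. x \<in> D \<Longrightarrow> (X has_derivative frechet_derivative X (at x)) (at x)"
    "\<And>x v. x \<in> D \<Longrightarrow> norm (frechet_derivative X (at x) v) = lam x * snd (X x) * norm v"
    "homeomorphism D half_plane X g"
proof -
  obtain X where X: "bij_betw X D half_plane" "smooth_fun_on (\<lambda>p. fst (X p)) D" "smooth_fun_on (\<lambda>p. snd (X p)) D"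
      "\<And>p v. p \<in> D \<Longrightarrow> norm (frechet_derivative X (at p) v) / snd (X p) = lam p * norm v"
    and D: "open D" "smooth_fun_on lam D" "\<And>x. x \<in> D \<Longrightarrow> lam x > 0"
    using assms unfolding hyperbolic_coordinates_def by blast
  have pos: "snd (X x) > 0" if "x \<in> D" for x
    using bij_betwE[OF X(1)] that by (auto simp: half_plane_def)
  have "Ck_on (Suc 0) (\<lambda>p. fst (X p)) D" "Ck_on (Suc 0) (\<lambda>p. snd (X p)) D"
    using X(2,3) unfolding smooth_fun_on_def by metis+
  note c = this[THEN Ck_on_differentiable, OF D(1)]
  have dX: "(X has_derivative frechet_derivative X (at x)) (at x)" if "x \<in> D" for x
  proof -
    have "((\<lambda>p. (fst (X p), snd (X p))) has_derivative
        (\<lambda>h. (dd h (\<lambda>p. fst (X p)) x, dd h (\<lambda>p. snd (X p)) x))) (at x)"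
      by (rule has_derivative_Pair[OF has_derivative_dd[OF c(1)[OF that]] has_derivative_dd[OF c(2)[OF that]]])
    then have "X differentiable at x" by (simp add: differentiableI)
    then show ?thesis by (simp add: frechet_derivative_works)
  qed
  have XC: "continuous_on D X"
    using dX has_derivative_continuous by (metis continuous_at_imp_continuous_on)
  have img: "X ` D = half_plane" and inj: "inj_on X D"
    using X(1) by (simp_all add: bij_betw_def)
  obtain g where g: "homeomorphism D half_plane X g"
    using invariance_of_domain_homeomorphism[OF D(1) XC _ inj] img by auto
  have "half_plane = {x. inner (0, 1) x > (0::real)}" by (simp add: half_plane_def inner_prod_def)
  then have "convex half_plane" using convex_halfspace_gt[of 0 "(0::real, 1::real)"] by simp
  then have "connected half_plane" by (rule convex_connected)
  then have "connected D"
    using connected_continuous_image[of half_plane g] g unfolding homeomorphism_def by metis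
  moreover have "norm (frechet_derivative X (at x) v) = lam x * snd (X x) * norm v" if "x \<in> D" for x v
    using X(4)[OF that, of v] pos[OF that] by (simp add: field_simps)
  moreover have "Ck_on 4 lam D" using D(2) by (simp add: smooth_fun_on_def)
  ultimately show ?thesis using that D pos dX g by blast
qed

text \<open>The logarithm of the height is 1-Lipschitz for the half-plane metric, since |dy| / y is
  at most the length element. It provides lower bounds for lengths and keeps curves of finite length
  away from the ideal boundary y = 0.\<close>

lemma log_height_derivative:
  fixes X :: "real \<times> real \<Rightarrow> real \<times> real"
  assumes "snd (X x) > 0" "(X has_derivative X') (at x)" "\<And>v. norm (X' v) = l * snd (X x) * norm v"
  shows "((\<lambda>x. ln (snd (X x))) has_derivative (\<lambda>v. snd (X' v) / snd (X x))) (at x)"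
    and "norm (snd (X' v) / snd (X x)) \<le> l * norm v"
proof -
  show "((\<lambda>x. ln (snd (X x))) has_derivative (\<lambda>v. snd (X' v) / snd (X x))) (at x)"
    using has_derivative_ln[OF assms(1) has_derivative_snd[OF assms(2)]] by (simp add: divide_inverse mult.commute)
  have "\<bar>snd (X' v)\<bar> \<le> norm (X' v)" using norm_snd_le[of "snd (X' v)" "fst (X' v)"] by simp
  then have "\<bar>snd (X' v)\<bar> \<le> l * norm v * snd (X x)" by (simp add: assms(3) mult_ac)
  then show "norm (snd (X' v) / snd (X x)) \<le> l * norm v"
    using assms(1) by (simp add: pos_divide_le_eq)
qed

text \<open>The points at heights 1 and exp (R + 1) on a vertical line have logarithmic heights that
  differ by R + 1.\<close>

lemma hyperbolic_plane_unbounded: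
  assumes "hyperbolic_coordinates D lam"
  shows "\<not> metric_bounded D lam D"
proof
  assume "metric_bounded D lam D"
  then obtain R where R: "\<And>p q. p \<in> D \<Longrightarrow> q \<in> D \<Longrightarrow> metric_dist D lam p q \<le> R"
    unfolding metric_bounded_def by blast
  obtain X g where D: "open D" "connected D" and lamC: "Ck_on 4 lam D" and lam0: "\<And>x. x \<in> D \<Longrightarrow> lam x > 0"
    and pos: "\<And>x. x \<in> D \<Longrightarrow> snd (X x) > 0"
    and dX: "\<And>x. x \<in> D \<Longrightarrow> (X has_derivative frechet_derivative X (at x)) (at x)"
    and nX: "\<And>x v. x \<in> D \<Longrightarrow> norm (frechet_derivative X (at x) v) = lam x * snd (X x) * norm v"
    and g: "homeomorphism D half_plane X g"
    using hyperbolic_chart[OF assms] by metis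
  define p where "p = g (0, 1)"
  define q where "q = g (0, exp (R + 1))"
  have "(0, 1) \<in> half_plane" "(0, exp (R + 1)) \<in> half_plane" by (simp_all add: half_plane_def)
  then have pq: "p \<in> D" "q \<in> D" "X p = (0, 1)" "X q = (0, exp (R + 1))"
    using g unfolding homeomorphism_def p_def q_def by auto
  have "R + 1 \<le> metric_dist D lam p q"
  proof (rule metric_dist_ge[OF D pq(1,2)])
    fix \<gamma> :: "real \<Rightarrow> real \<times> real"
    assume \<gamma>: "\<gamma> C1_differentiable_on {0..1}" "path_image \<gamma> \<subseteq> D" "\<gamma> 0 = p" "\<gamma> 1 = q"
    have \<gamma>D: "\<gamma> t \<in> D" if "0 \<le> t" "t \<le> 1" for t using \<gamma>(2) that by (auto simp: path_image_def)
    have "norm (ln (snd (X (\<gamma> 1))) - ln (snd (X (\<gamma> 0)))) \<le> 1 * metric_length lam \<gamma>"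
    proof (rule length_lower_bound[OF \<gamma>(1,2) Ck_on_continuous_on[OF lamC] lam0])
      fix t :: real assume t: "0 \<le> t" "t \<le> 1"
      note h = log_height_derivative[OF pos[OF \<gamma>D[OF t]] dX[OF \<gamma>D[OF t]] nX[OF \<gamma>D[OF t]]]
      show "((\<lambda>x. ln (snd (X x))) has_derivative
          (\<lambda>v. snd (frechet_derivative X (at (\<gamma> t)) v) / snd (X (\<gamma> t)))) (at (\<gamma> t))"
        by (rule h(1))
      show "norm (snd (frechet_derivative X (at (\<gamma> t)) v) / snd (X (\<gamma> t))) \<le> 1 * (lam (\<gamma> t) * norm v)" for v
        using h(2)[of v] by simp
    qed simp_all
    then show "R + 1 \<le> metric_length lam \<gamma>" by (simp add: \<gamma> pq)
  qed
  then show False using R[OF pq(1,2)] by simp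
qed

text \<open>The infimum defining \<open>dist_to_boundary\<close> is then taken over a nonempty set.
  A connected D that contains a nonempty \<Omega> and misses its frontier equals \<Omega>, which
  would make D bounded.\<close>

lemma boundary_nonempty:
  assumes "hyperbolic_coordinates D lam" "\<Omega> \<subseteq> D" "\<Omega> \<noteq> {}" "metric_bounded D lam \<Omega>"
  shows "D \<inter> frontier \<Omega> \<noteq> {}"
proof
  assume e: "D \<inter> frontier \<Omega> = {}"
  have "connected D" using hyperbolic_chart[OF assms(1)] by metis
  then have "D - \<Omega> = {}" using connected_Int_frontier[of D \<Omega>] e assms(2,3) by blast
  then have "\<Omega> = D" using assms(2) by blast
  then show False using hyperbolic_plane_unbounded[OF assms(1)] assms(4) by simp
qed

text \<open>A curve to the boundary must cross a small Euclidean ball about p inside \<Omega>, where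
  the metric is at least m times the Euclidean one. The lemma shows that values d <= 0 of the
  distance never occur.\<close>

lemma dist_to_boundary_pos:
  assumes hyp: "hyperbolic_coordinates D lam" and \<Omega>: "\<Omega> \<subseteq> D" "open \<Omega>" "p \<in> \<Omega>"
    and bounded: "metric_bounded D lam \<Omega>" and m: "m > 0" "\<And>x. x \<in> \<Omega> \<Longrightarrow> m \<le> lam x"
  shows "dist_to_boundary D lam \<Omega> p > 0"
proof -
  have D: "open D" "connected D" and lamC: "Ck_on 4 lam D" and lam0: "\<And>x. x \<in> D \<Longrightarrow> lam x > 0"
    using hyperbolic_chart[OF hyp] by metis+
  obtain \<epsilon> where \<epsilon>: "\<epsilon> > 0" "cball p \<epsilon> \<subseteq> \<Omega>" using \<Omega> open_contains_cball by metis
  have "m * \<epsilon> \<le> metric_dist D lam p q" if q: "q \<in> D \<inter> frontier \<Omega>" for q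
  proof (rule metric_dist_ge[OF D])
    show "p \<in> D" "q \<in> D" using \<Omega> q by auto
    fix \<gamma> :: "real \<Rightarrow> real \<times> real"
    assume \<gamma>: "\<gamma> C1_differentiable_on {0..1}" "path_image \<gamma> \<subseteq> D" "\<gamma> 0 = p" "\<gamma> 1 = q"
    have \<gamma>C: "continuous_on {0..1} \<gamma>" by (rule C1_differentiable_imp_continuous_on[OF \<gamma>(1)])
    have "q \<notin> \<Omega>" using q \<Omega>(2) by (simp add: frontier_def interior_open)
    then have "dist p q > \<epsilon>" using \<epsilon>(2) by (meson mem_cball not_le subsetD)
    then have "\<exists>t. 0 \<le> t \<and> t \<le> 1 \<and> dist p (\<gamma> t) = \<epsilon>"
      using \<epsilon>(1) by (intro IVT') (auto simp: \<gamma>(3,4) intro!: continuous_intros \<gamma>C)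
    then obtain t0 where t0: "0 \<le> t0" "t0 \<le> 1" "dist p (\<gamma> t0) = \<epsilon>" by blast
    \<comment> \<open>The least element of \<open>S\<close> is the first time at Euclidean distance
      \<epsilon> from \<open>p\<close>. Until then the curve stays in the ball, so
      \<open>lam\<close> is bounded below along it; later it may leave \<Omega>.\<close>
    define S where "S = {0..1} \<inter> (\<lambda>t. dist p (\<gamma> t)) -` {\<epsilon>}"
    have "closed S" unfolding S_def
      by (rule continuous_closed_preimage) (auto intro!: continuous_intros \<gamma>C)
    moreover have "bounded S" by (rule bounded_subset[OF bounded_closed_interval[of 0 1]]) (auto simp: S_def)
    ultimately have "compact S" by (simp add: compact_eq_bounded_closed)
    moreover have "S \<noteq> {}" using t0 by (auto simp: S_def)
    ultimately obtain s where s: "s \<in> S" "\<And>t. t \<in> S \<Longrightarrow> s \<le> t" using compact_attains_inf by metis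
    have s01: "0 \<le> s" "s \<le> 1" "dist p (\<gamma> s) = \<epsilon>" using s(1) by (auto simp: S_def)
    have near: "dist p (\<gamma> t) \<le> \<epsilon>" if "0 \<le> t" "t \<le> s" for t
    proof (rule ccontr)
      assume "\<not> ?thesis"
      then have "\<exists>x. 0 \<le> x \<and> x \<le> t \<and> dist p (\<gamma> x) = \<epsilon>"
        using \<epsilon>(1) that s01 by (intro IVT')
          (auto simp: \<gamma>(3) intro!: continuous_intros continuous_on_subset[OF \<gamma>C])
      then obtain x where x: "0 \<le> x" "x \<le> t" "dist p (\<gamma> x) = \<epsilon>" by blast
      then have "s \<le> x" using s(2) that s01 by (simp add: S_def)
      then have "x = t" using x that by linarith
      then show False using x \<open>\<not> dist p (\<gamma> t) \<le> \<epsilon>\<close> by simp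
    qed
    have "norm (\<gamma> s - \<gamma> 0) \<le> (1 / m) * metric_length lam \<gamma>"
    proof (rule length_lower_bound[OF \<gamma>(1,2) Ck_on_continuous_on[OF lamC] lam0 s01(1,2)])
      show "1 / m \<ge> 0" using m by simp
      fix t :: real assume t: "0 \<le> t" "t \<le> s"
      show "((\<lambda>x. x) has_derivative (\<lambda>v. v)) (at (\<gamma> t))" by (rule has_derivative_ident)
      show "norm v \<le> 1 / m * (lam (\<gamma> t) * norm v)" for v :: "real \<times> real"
      proof -
        have "\<gamma> t \<in> \<Omega>" using near[OF t] \<epsilon>(2) by (meson mem_cball subsetD)
        then have "m * norm v \<le> lam (\<gamma> t) * norm v" using m(2) by (intro mult_right_mono) auto
        then show ?thesis using m(1) by (simp add: field_simps)
      qed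
    qed
    moreover have "norm (\<gamma> s - \<gamma> 0) = \<epsilon>" using s01(3) by (simp add: \<gamma>(3) dist_norm norm_minus_commute)
    ultimately show "m * \<epsilon> \<le> metric_length lam \<gamma>" using m(1) by (simp add: field_simps)
  qed
  then have "m * \<epsilon> \<le> dist_to_boundary D lam \<Omega> p"
    unfolding dist_to_boundary_def
    using boundary_nonempty[OF hyp \<Omega>(1) _ bounded] \<Omega>(3) by (intro cINF_greatest) auto
  then show ?thesis using m(1) \<epsilon>(1) by (meson less_le_trans mult_pos_pos)
qed

text \<open>The segment from \<open>p\<close> cannot run out of \<open>D\<close> before it meets the boundary of \<open>\<Omega>\<close>: its image
  in the half-plane has finite length, so it converges there by completeness.\<close>

lemma cball_subset_domain:
  assumes hyp: "hyperbolic_coordinates D lam" and \<Omega>: "\<Omega> \<subseteq> D" "open \<Omega>" "p \<in> \<Omega>"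
    and M: "M > 0" "\<And>x. x \<in> \<Omega> \<Longrightarrow> lam x \<le> M"
    and r: "r \<ge> 0" "M * r < dist_to_boundary D lam \<Omega> p"
  shows "cball p r \<subseteq> \<Omega>"
proof
  fix q assume q: "q \<in> cball p r"
  obtain X g where D: "open D" "connected D" and lamC: "Ck_on 4 lam D" and lam0: "\<And>x. x \<in> D \<Longrightarrow> lam x > 0"
    and pos: "\<And>x. x \<in> D \<Longrightarrow> snd (X x) > 0"
    and dX: "\<And>x. x \<in> D \<Longrightarrow> (X has_derivative frechet_derivative X (at x)) (at x)"
    and nX: "\<And>x v. x \<in> D \<Longrightarrow> norm (frechet_derivative X (at x) v) = lam x * snd (X x) * norm v"
    and g: "homeomorphism D half_plane X g"
    using hyperbolic_chart[OF hyp] by metis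
  have lamD: "continuous_on D lam" by (rule Ck_on_continuous_on[OF lamC])
  show "q \<in> \<Omega>"
  proof (rule ccontr)
    assume q\<Omega>: "q \<notin> \<Omega>"
    define \<gamma> where "\<gamma> t = p + t *\<^sub>R (q - p)" for t :: real
    have \<gamma>C: "continuous_on A \<gamma>" for A unfolding \<gamma>_def by (intro continuous_intros)
    have \<gamma>d: "(\<gamma> has_derivative (\<lambda>h. h *\<^sub>R (q - p))) (at t within A)" for t A
      unfolding \<gamma>_def by (auto intro!: derivative_eq_intros)
    \<comment> \<open>The least element \<open>s\<close> of this set is the first time the segment
      leaves \<Omega>. Before \<open>s\<close> it lies in \<Omega>, hence in D; whether its point at
      time \<open>s\<close> still belongs to D has to be proved.\<close>
    define S where "S = {0..1} \<inter> \<gamma> -` (- \<Omega>)"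
    have "closed S" unfolding S_def
      by (rule continuous_closed_preimage) (use \<Omega>(2) \<gamma>C in auto)
    moreover have "bounded S" by (rule bounded_subset[OF bounded_closed_interval[of 0 1]]) (auto simp: S_def)
    ultimately have "compact S" by (simp add: compact_eq_bounded_closed)
    moreover have "1 \<in> S" using q\<Omega> by (simp add: S_def \<gamma>_def)
    ultimately obtain s where s: "s \<in> S" "\<And>t. t \<in> S \<Longrightarrow> s \<le> t"
      using compact_attains_inf by (metis empty_iff)
    have s01: "0 \<le> s" "s \<le> 1" and s\<Omega>: "\<gamma> s \<notin> \<Omega>" using s(1) by (auto simp: S_def)
    have "s \<noteq> 0" using s\<Omega> \<Omega>(3) by (auto simp: \<gamma>_def)
    then have s0: "s > 0" using s01 by simp
    have \<gamma>\<Omega>: "\<gamma> t \<in> \<Omega>" if "0 \<le> t" "t < s" for t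
    proof (rule ccontr)
      assume "\<gamma> t \<notin> \<Omega>"
      then have "t \<in> S" using that s01 by (simp add: S_def)
      then show False using s(2) that by fastforce
    qed
    have \<gamma>D: "\<gamma> t \<in> D" if "t \<in> {0..<s}" for t using \<gamma>\<Omega> that \<Omega>(1) by auto
    define c where "c = M * norm (q - p)"
    have c0: "c \<ge> 0" using M(1) by (simp add: c_def)
    \<comment> \<open>The height is controlled first: its logarithm is Lipschitz along the segment,
      so heights stay between two positive constants. The upper one makes the image curve Lipschitz,
      and the lower one keeps its limit inside the open half-plane.\<close>
    define f where "f t = ln (snd (X (\<gamma> t)))" for t
    have fL: "norm (f t - f 0) \<le> c * norm (t - 0)" if t: "t \<in> {0..<s}" for t
    proof (rule differentiable_bound[OF convex_real_interval(7)[of 0 s] _ _ t])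
      fix t assume t: "t \<in> {0..<s}"
      note h = log_height_derivative[OF pos[OF \<gamma>D[OF t]] dX[OF \<gamma>D[OF t]] nX[OF \<gamma>D[OF t]]]
      show "(f has_derivative (\<lambda>k. snd (frechet_derivative X (at (\<gamma> t)) (k *\<^sub>R (q - p))) / snd (X (\<gamma> t)))) (at t within {0..<s})"
        unfolding f_def by (rule has_derivative_compose[OF \<gamma>d h(1)])
      show "onorm (\<lambda>k. snd (frechet_derivative X (at (\<gamma> t)) (k *\<^sub>R (q - p))) / snd (X (\<gamma> t))) \<le> c"
      proof (rule onorm_le)
        fix k :: real
        have "norm (snd (frechet_derivative X (at (\<gamma> t)) (k *\<^sub>R (q - p))) / snd (X (\<gamma> t))) \<le> lam (\<gamma> t) * norm (k *\<^sub>R (q - p))"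
          by (rule h(2))
        also have "\<dots> \<le> M * norm (k *\<^sub>R (q - p))"
          using M(2) \<gamma>\<Omega> t by (intro mult_right_mono) auto
        finally show "norm (snd (frechet_derivative X (at (\<gamma> t)) (k *\<^sub>R (q - p))) / snd (X (\<gamma> t))) \<le> c * norm k"
          by (simp add: c_def mult_ac)
      qed
    qed (use s0 in simp)
    define y0 where "y0 = snd (X (\<gamma> 0))"
    have y0: "y0 > 0" using pos[OF \<gamma>D[of 0]] s0 by (simp add: y0_def)
    have fc: "\<bar>f t - f 0\<bar> \<le> c" if t: "t \<in> {0..<s}" for t
    proof -
      have "c * norm (t - 0) \<le> c * 1" using c0 t s01 by (intro mult_left_mono) auto
      then show ?thesis using fL[OF t] by simp
    qed
    have yf: "snd (X (\<gamma> t)) = exp (f t)" if "t \<in> {0..<s}" for t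
      using pos[OF \<gamma>D[OF that]] by (simp add: f_def)
    have f0: "y0 = exp (f 0)" using yf[of 0] s0 by (simp add: y0_def)
    have y_le: "snd (X (\<gamma> t)) \<le> exp (f 0 + c)" and y_ge: "exp (f 0 - c) \<le> snd (X (\<gamma> t))" if "t \<in> {0..<s}" for t
      using fc[OF that] unfolding yf[OF that] by (simp_all add: abs_le_iff)
    define B where "B = exp (f 0 + c) * c"
    have XL: "norm (X (\<gamma> t) - X (\<gamma> t')) \<le> B * norm (t - t')" if t: "t \<in> {0..<s}" "t' \<in> {0..<s}" for t t'
    proof (rule differentiable_bound[OF convex_real_interval(7)[of 0 s] _ _ t])
      fix t assume t: "t \<in> {0..<s}"
      show "((\<lambda>t. X (\<gamma> t)) has_derivative (\<lambda>k. frechet_derivative X (at (\<gamma> t)) (k *\<^sub>R (q - p)))) (at t within {0..<s})"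
        by (rule has_derivative_compose[OF \<gamma>d dX[OF \<gamma>D[OF t]]])
      show "onorm (\<lambda>k. frechet_derivative X (at (\<gamma> t)) (k *\<^sub>R (q - p))) \<le> B"
      proof (rule onorm_le)
        fix k :: real
        have "lam (\<gamma> t) * snd (X (\<gamma> t)) \<le> M * exp (f 0 + c)"
          using M \<gamma>\<Omega> t y_le[OF t] pos[OF \<gamma>D[OF t]] by (intro mult_mono) auto
        then have "lam (\<gamma> t) * snd (X (\<gamma> t)) * norm (k *\<^sub>R (q - p)) \<le> M * exp (f 0 + c) * norm (k *\<^sub>R (q - p))"
          by (rule mult_right_mono) simp
        then show "norm (frechet_derivative X (at (\<gamma> t)) (k *\<^sub>R (q - p))) \<le> B * norm k"
          unfolding nX[OF \<gamma>D[OF t]] by (simp add: B_def c_def mult_ac)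
      qed
    qed
    \<comment> \<open>Times increasing to \<open>s\<close> but strictly below it, so that the
      segment is still in \<Omega> at each of them.\<close>
    define \<tau> where "\<tau> n = s * (1 - inverse (real (Suc n)))" for n
    have \<tau>: "\<tau> n \<in> {0..<s}" for n
      using s0 by (simp add: \<tau>_def inverse_le_1_iff)
    have \<tau>s: "\<tau> \<longlonglongrightarrow> s"
    proof -
      have "(\<lambda>n. s * (1 - inverse (real (Suc n)))) \<longlonglongrightarrow> s * (1 - 0)"
        by (intro tendsto_intros LIMSEQ_inverse_real_of_nat)
      then show ?thesis by (simp add: \<tau>_def[abs_def])
    qed
    have B0: "B \<ge> 0" using c0 by (simp add: B_def)
    have "Cauchy (\<lambda>n. X (\<gamma> (\<tau> n)))"
    proof (rule CauchyI)
      fix e :: real assume e: "e > 0"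
      have "e / (B + 1) > 0" using e B0 by simp
      then obtain N where N: "\<And>i j. i \<ge> N \<Longrightarrow> j \<ge> N \<Longrightarrow> norm (\<tau> i - \<tau> j) < e / (B + 1)"
        using CauchyD[OF LIMSEQ_imp_Cauchy[OF \<tau>s]] by meson
      have "norm (X (\<gamma> (\<tau> i)) - X (\<gamma> (\<tau> j))) < e" if "i \<ge> N" "j \<ge> N" for i j
      proof -
        have "norm (X (\<gamma> (\<tau> i)) - X (\<gamma> (\<tau> j))) \<le> B * norm (\<tau> i - \<tau> j)" by (rule XL[OF \<tau> \<tau>])
        also have "\<dots> \<le> (B + 1) * norm (\<tau> i - \<tau> j)" by (intro mult_right_mono) auto
        also have "\<dots> < e" using N[OF that] B0 by (simp add: pos_less_divide_eq mult.commute)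
        finally show ?thesis .
      qed
      then show "\<exists>M. \<forall>m\<ge>M. \<forall>n\<ge>M. norm (X (\<gamma> (\<tau> m)) - X (\<gamma> (\<tau> n))) < e" by blast
    qed
    then obtain Z where Z: "(\<lambda>n. X (\<gamma> (\<tau> n))) \<longlonglongrightarrow> Z"
      using Cauchy_convergent_iff convergent_def by blast
    have "exp (f 0 - c) \<le> snd Z"
      by (rule LIMSEQ_le_const[OF tendsto_snd[OF Z]]) (use y_ge[OF \<tau>] in auto)
    then have "snd Z > 0" using exp_gt_zero[of "f 0 - c"] by linarith
    then have ZH: "Z \<in> half_plane" by (simp add: half_plane_def)
    have gC: "continuous_on half_plane g" and gX: "\<And>x. x \<in> D \<Longrightarrow> g (X x) = x" and gD: "g Z \<in> D"
      using g ZH unfolding homeomorphism_def by auto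
    have "(\<lambda>n. g (X (\<gamma> (\<tau> n)))) \<longlonglongrightarrow> g Z"
    proof (rule continuous_on_tendsto_compose[OF gC Z ZH])
      show "\<forall>\<^sub>F n in sequentially. X (\<gamma> (\<tau> n)) \<in> half_plane"
        using pos[OF \<gamma>D[OF \<tau>]] by (simp add: half_plane_def)
    qed
    then have "(\<lambda>n. \<gamma> (\<tau> n)) \<longlonglongrightarrow> g Z" by (simp add: gX[OF \<gamma>D[OF \<tau>]])
    moreover have \<gamma>\<tau>: "(\<lambda>n. \<gamma> (\<tau> n)) \<longlonglongrightarrow> \<gamma> s"
      unfolding \<gamma>_def by (intro tendsto_intros \<tau>s)
    \<comment> \<open>Completeness has paid off: the Euclidean limit of the segment and the point of
      D given by the chart coincide.\<close>
    ultimately have "\<gamma> s = g Z" using LIMSEQ_unique by blast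
    then have sD: "\<gamma> s \<in> D" using gD by simp
    have lam_s: "lam (\<gamma> s) \<le> M"
    proof (rule LIMSEQ_le_const2)
      show "(\<lambda>n. lam (\<gamma> (\<tau> n))) \<longlonglongrightarrow> lam (\<gamma> s)"
        by (rule tendsto_of_continuous_on[OF D(1) sD lamD \<gamma>\<tau>])
      show "\<exists>N. \<forall>n\<ge>N. lam (\<gamma> (\<tau> n)) \<le> M" using M(2) \<gamma>\<Omega> \<tau> by auto
    qed
    have "\<gamma> s \<in> closure \<Omega>"
      unfolding closure_sequential using \<gamma>\<tau> \<gamma>\<Omega> \<tau> by (intro exI[of _ "\<lambda>n. \<gamma> (\<tau> n)"]) auto
    then have fr: "\<gamma> s \<in> D \<inter> frontier \<Omega>"
      using sD s\<Omega> \<Omega>(2) by (simp add: frontier_def interior_open)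
    \<comment> \<open>The segment up to time \<open>s\<close>, reparametrised over [0, 1], is an
      admissible curve to a boundary point. Its length is at most M r, less than the distance to the
      boundary.\<close>
    define \<eta> where "\<eta> t = \<gamma> (t * s)" for t
    have \<eta>d: "(\<eta> has_vector_derivative s *\<^sub>R (q - p)) (at t)" for t
      unfolding \<eta>_def \<gamma>_def by (auto intro!: derivative_eq_intros)
    have \<eta>1: "\<eta> C1_differentiable_on {0..1}"
      unfolding C1_differentiable_on_def using \<eta>d by (intro exI[of _ "\<lambda>_. s *\<^sub>R (q - p)"]) auto
    have \<eta>b: "\<eta> t \<in> D" "lam (\<eta> t) \<le> M" if "t \<in> {0..1}" for t
    proof -
      have "t * s < s" if "t \<noteq> 1" using that \<open>t \<in> {0..1}\<close> s0 by simp
      then have "\<eta> t \<in> D \<and> lam (\<eta> t) \<le> M"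
        using \<gamma>\<Omega>[of "t * s"] M(2) \<Omega>(1) sD lam_s that s0 by (cases "t = 1") (auto simp: \<eta>_def)
      then show "\<eta> t \<in> D" "lam (\<eta> t) \<le> M" by simp_all
    qed
    have \<eta>D: "path_image \<eta> \<subseteq> D" using \<eta>b(1) by (auto simp: path_image_def)
    have "metric_dist D lam p (\<gamma> s) \<le> metric_length lam \<eta>"
      by (rule metric_dist_le[OF lamD lam0 \<eta>1 \<eta>D]) (simp_all add: \<eta>_def \<gamma>_def)
    also have "metric_length lam \<eta> = integral {0..1} (\<lambda>t. lam (\<eta> t) * norm (s *\<^sub>R (q - p)))"
      unfolding metric_length_def vector_derivative_at[OF \<eta>d] ..
    also have "\<dots> \<le> integral {0..1::real} (\<lambda>t. M * norm (s *\<^sub>R (q - p)))"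
    proof (rule integral_le)
      show "(\<lambda>t. lam (\<eta> t) * norm (s *\<^sub>R (q - p))) integrable_on {0..1}"
        by (intro integrable_continuous_real continuous_intros continuous_on_compose2[OF lamD])
          (use \<eta>b in \<open>auto simp: \<eta>_def \<gamma>_def intro!: continuous_intros\<close>)
      show "lam (\<eta> t) * norm (s *\<^sub>R (q - p)) \<le> M * norm (s *\<^sub>R (q - p))" if "t \<in> {0..1}" for t
        by (rule mult_right_mono[OF \<eta>b(2)[OF that]]) simp
    qed (rule integrable_const_ivl)
    also have "\<dots> = M * norm (s *\<^sub>R (q - p))" by simp
    also have "\<dots> \<le> M * r"
    proof -
      have "s * norm (q - p) \<le> 1 * norm (q - p)" using s01 by (intro mult_right_mono) auto
      also have "\<dots> \<le> r" using q by (simp add: dist_norm norm_minus_commute)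
      finally show ?thesis using M(1) s01 by simp
    qed
    also have "M * r < dist_to_boundary D lam \<Omega> p" by (rule r(2))
    also have "dist_to_boundary D lam \<Omega> p \<le> metric_dist D lam p (\<gamma> s)"
      unfolding dist_to_boundary_def
    proof (rule cINF_lower[OF _ fr])
      have "0 \<le> metric_dist D lam p q" if "q \<in> D" for q
        using \<Omega>(1,3) that by (intro metric_dist_ge[OF D]) (auto intro: metric_length_nonneg[OF _ _ lamD lam0])
      then show "bdd_below (metric_dist D lam p ` (D \<inter> frontier \<Omega>))"
        by (intro bdd_belowI2[of _ 0]) auto
    qed
    finally show False by simp
  qed
qed

section \<open>The gradient estimate\<close>

text \<open>The four arguments before \<open>C\<close> are numerical data only, so existence of
  \<open>C\<close> for each of them yields the required function by choice.\<close>

definition gradient_bound :: "real \<Rightarrow> real \<Rightarrow> real \<Rightarrow> (nat \<Rightarrow> real) \<Rightarrow> real \<Rightarrow> bool"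
  where "gradient_bound h d m M C \<longleftrightarrow> C > 0 \<and>
    (\<forall>D lam \<Omega> u. hyperbolic_coordinates D lam \<longrightarrow> \<Omega> \<subseteq> D \<longrightarrow> open \<Omega> \<longrightarrow> metric_bounded D lam \<Omega> \<longrightarrow>
       bounds_on lam \<Omega> m M \<longrightarrow> minimal_surface_solution lam \<Omega> u \<longrightarrow> (\<forall>q\<in>\<Omega>. u q \<ge> 0) \<longrightarrow>
       (\<forall>p\<in>\<Omega>. u p = h \<longrightarrow> dist_to_boundary D lam \<Omega> p = d \<longrightarrow> gr_W lam u p \<le> C))"

lemma gradient_bound_exists: "\<exists>C. gradient_bound h d m M C"
proof (cases "h \<ge> 0 \<and> m > 0 \<and> M 0 > 0 \<and> d > 0")
  case True
  define B where "B = 8 * (M 1 + M 2 + M 3)"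
  \<comment> \<open>The absolute value secures N >= 0 at this point, where no \<open>lam\<close> is
    given and the signs of \<open>M 1\<close>, \<open>M 2\<close>, \<open>M 3\<close> are
    unknown.\<close>
  define N where "N = \<bar>B * (1 / m) + 3 * (B * B * (1 / m) * (1 / m))
    + 2 * (B * B * B * (1 / m) * (1 / m) * (1 / m))\<bar>"
  \<comment> \<open>Half of the largest radius whose metric length is controlled by d, so that M 0 *
    r = d / 2 is strictly below the distance to the boundary.\<close>
  define r where "r = d / (2 * M 0)"
  have r: "r > 0" "M 0 * r < d" using True by (simp_all add: r_def)
  have "N \<ge> 0" by (simp add: N_def)
  from interior_slope_bound[of m "M 0" N r h] True r(1) this
  obtain C where C: "\<And>lam \<Omega> u p. open \<Omega> \<Longrightarrow> Ck_on 4 lam \<Omega> \<Longrightarrow> minimal_surface_solution lam \<Omega> u \<Longrightarrow>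
    (\<forall>y\<in>\<Omega>. m \<le> lam y \<and> lam y \<le> M 0) \<Longrightarrow> (\<forall>y\<in>\<Omega>. 0 \<le> u y) \<Longrightarrow>
    (\<forall>y\<in>\<Omega>. \<forall>e e' e''. norm e \<le> 1 \<longrightarrow> norm e' \<le> 1 \<longrightarrow> norm e'' \<le> 1 \<longrightarrow>
      \<bar>dd e (\<lambda>x. ln (lam x)) y\<bar> \<le> N \<and> \<bar>dd e (dd e' (\<lambda>x. ln (lam x))) y\<bar> \<le> N \<and>
      \<bar>dd e (dd e' (dd e'' (\<lambda>x. ln (lam x)))) y\<bar> \<le> N) \<Longrightarrow>
    cball p r \<subseteq> \<Omega> \<Longrightarrow> u p = h \<Longrightarrow>
    sqrt ((slope1 lam u (1, 0) (0, 1) p)\<^sup>2 + (slope2 lam u (1, 0) (0, 1) p)\<^sup>2) \<le> C"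
    by blast
  have "gradient_bound h d m M (sqrt (1 + C\<^sup>2 / m\<^sup>2))"
    unfolding gradient_bound_def
  proof (intro conjI allI impI ballI)
    show "sqrt (1 + C\<^sup>2 / m\<^sup>2) > 0" by (simp add: add_pos_nonneg)
    fix D lam \<Omega> u and p :: "real \<times> real"
    assume hyp: "hyperbolic_coordinates D lam" and \<Omega>: "\<Omega> \<subseteq> D" "open \<Omega>" "metric_bounded D lam \<Omega>"
      and bd: "bounds_on lam \<Omega> m M" and sol: "minimal_surface_solution lam \<Omega> u"
      and u0: "\<forall>q\<in>\<Omega>. u q \<ge> 0" and p: "p \<in> \<Omega>" "u p = h" "dist_to_boundary D lam \<Omega> p = d"
    have "Ck_on 4 lam D" "\<And>x. x \<in> D \<Longrightarrow> lam x > 0" using hyperbolic_chart[OF hyp] by metis+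
    then have lamC: "Ck_on 4 lam \<Omega>" and lam0: "\<And>x. x \<in> \<Omega> \<Longrightarrow> lam x > 0"
      using Ck_on_subset \<Omega>(1) by blast+
    have lamb: "m \<le> lam y" "lam y \<le> M 0" if "y \<in> \<Omega>" for y
    proof -
      show "m \<le> lam y" using bd that by (simp add: bounds_on_def)
      have "\<bar>(pdx ^^ 0) ((pdy ^^ 0) lam) y\<bar> \<le> M (0 + 0)" using bd that unfolding bounds_on_def by blast
      then show "lam y \<le> M 0" by simp
    qed
    have ball: "cball p r \<subseteq> \<Omega>"
      by (rule cball_subset_domain[OF hyp \<Omega>(1,2) p(1), of "M 0"]) (use True lamb r p(3) in auto)
    define S where "S = sqrt ((slope1 lam u (1, 0) (0, 1) p)\<^sup>2 + (slope2 lam u (1, 0) (0, 1) p)\<^sup>2)"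
    have "S \<le> C" unfolding S_def
    proof (rule C[OF \<Omega>(2) lamC sol _ u0 _ ball p(2)])
      show "\<forall>y\<in>\<Omega>. m \<le> lam y \<and> lam y \<le> M 0" using lamb by simp
      have N: "B * (1 / m) + 3 * (B * B * (1 / m) * (1 / m))
          + 2 * (B * B * B * (1 / m) * (1 / m) * (1 / m)) \<le> N"
        unfolding N_def by (rule abs_ge_self)
      show "\<forall>y\<in>\<Omega>. \<forall>e e' e''. norm e \<le> 1 \<longrightarrow> norm e' \<le> 1 \<longrightarrow> norm e'' \<le> 1 \<longrightarrow>
        \<bar>dd e (\<lambda>x. ln (lam x)) y\<bar> \<le> N \<and> \<bar>dd e (dd e' (\<lambda>x. ln (lam x))) y\<bar> \<le> N \<and>
        \<bar>dd e (dd e' (dd e'' (\<lambda>x. ln (lam x)))) y\<bar> \<le> N"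
      proof (intro ballI allI impI conjI)
        fix y e e' e'' :: "real \<times> real"
        assume y: "y \<in> \<Omega>" and e: "norm e \<le> 1" "norm e' \<le> 1" "norm e'' \<le> 1"
        note L = ln_derivative_bounds[OF \<Omega>(2) y lamC lam0 bd e, folded B_def]
        show "\<bar>dd e (\<lambda>x. ln (lam x)) y\<bar> \<le> N" by (rule order_trans[OF L(1) N])
        show "\<bar>dd e (dd e' (\<lambda>x. ln (lam x))) y\<bar> \<le> N" by (rule order_trans[OF L(2) N])
        show "\<bar>dd e (dd e' (dd e'' (\<lambda>x. ln (lam x)))) y\<bar> \<le> N" by (rule order_trans[OF L(3) N])
      qed
    qed
    moreover have "S \<ge> 0" by (simp add: S_def)
    ultimately have "S\<^sup>2 \<le> C\<^sup>2" by (intro power_mono)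
    moreover have "m\<^sup>2 \<le> (lam p)\<^sup>2" using lamb(1)[OF p(1)] True by (intro power_mono) auto
    ultimately have "S\<^sup>2 / (lam p)\<^sup>2 \<le> C\<^sup>2 / m\<^sup>2" using True by (intro frac_le) auto
    moreover have "gr_W lam u p = sqrt (1 + S\<^sup>2 / (lam p)\<^sup>2)"
    proof -
      have "Ck_on (Suc 0) lam \<Omega>" by (rule Ck_on_le[OF lamC]) simp
      from gr_W_slope[OF Ck_on_differentiable[OF this \<Omega>(2) p(1)] lam0[OF p(1)]]
      show ?thesis by (simp add: S_def)
    qed
    ultimately show "gr_W lam u p \<le> sqrt (1 + C\<^sup>2 / m\<^sup>2)" by simp
  qed
  then show ?thesis by blast
next
  case False
  \<comment> \<open>No solution has such data: a point of \<Omega> forces h, m, \<open>M 0\<close>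
    and d into the excluded ranges. The value 1 is a default that keeps the constant
    positive.\<close>
  have "gradient_bound h d m M 1"
    unfolding gradient_bound_def
  proof (intro conjI allI impI ballI)
    fix D lam \<Omega> u and p :: "real \<times> real"
    assume hyp: "hyperbolic_coordinates D lam" and \<Omega>: "\<Omega> \<subseteq> D" "open \<Omega>" "metric_bounded D lam \<Omega>"
      and bd: "bounds_on lam \<Omega> m M"
      and u0: "\<forall>q\<in>\<Omega>. u q \<ge> 0" and p: "p \<in> \<Omega>" "u p = h" "dist_to_boundary D lam \<Omega> p = d"
    have m: "m > 0" "\<And>x. x \<in> \<Omega> \<Longrightarrow> m \<le> lam x" using bd by (simp_all add: bounds_on_def)
    have "\<bar>(pdx ^^ 0) ((pdy ^^ 0) lam) p\<bar> \<le> M (0 + 0)" using bd p(1) unfolding bounds_on_def by blast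
    then have "M 0 > 0" using m p(1) by fastforce
    moreover have "d > 0" using dist_to_boundary_pos[OF hyp \<Omega>(1,2) p(1) \<Omega>(3) m] p(3) by simp
    ultimately show "gr_W lam u p \<le> 1" using False u0 p m(1) by auto
  qed simp
  then show ?thesis by blast
qed

theorem theorem4p2:
  shows "\<exists>C :: real \<Rightarrow> real \<Rightarrow> real \<Rightarrow> (nat \<Rightarrow> real) \<Rightarrow> real.
    (\<forall>h d m M. C h d m M > 0) \<and>
    (\<forall>(D :: (real \<times> real) set) (lam :: real \<times> real \<Rightarrow> real)
       (\<Omega> :: (real \<times> real) set) (u :: real \<times> real \<Rightarrow> real) (m :: real) (M :: nat \<Rightarrow> real).
       hyperbolic_coordinates D lam \<longrightarrow>
       \<Omega> \<subseteq> D \<longrightarrow> open \<Omega> \<longrightarrow> connected \<Omega> \<longrightarrow> metric_bounded D lam \<Omega> \<longrightarrow>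
       bounds_on lam \<Omega> m M \<longrightarrow>
       minimal_surface_solution lam \<Omega> u \<longrightarrow> (\<forall>q\<in>\<Omega>. u q \<ge> 0) \<longrightarrow>
       (\<forall>p\<in>\<Omega>. gr_W lam u p \<le> C (u p) (dist_to_boundary D lam \<Omega> p) m M))"
proof -
  obtain C where C: "\<And>h d m M. gradient_bound h d m M (C h d m M)"
    using gradient_bound_exists by metis
  show ?thesis
  proof (intro exI[of _ C] conjI allI impI ballI)
    show "C h d m M > 0" for h d m M using C unfolding gradient_bound_def by blast
    fix D lam \<Omega> u m M p
    assume "hyperbolic_coordinates D lam" "\<Omega> \<subseteq> D" "open \<Omega>" "metric_bounded D lam \<Omega>"
      "bounds_on lam \<Omega> m M" "minimal_surface_solution lam \<Omega> u" "\<forall>q\<in>\<Omega>. u q \<ge> 0" "p \<in> \<Omega>"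
    then show "gr_W lam u p \<le> C (u p) (dist_to_boundary D lam \<Omega> p) m M"
      using C[of "u p" "dist_to_boundary D lam \<Omega> p" m M] unfolding gradient_bound_def by blast
  qed
qed

end
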